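(* Let $S$ and $T$ be types which are representable over a finite field $\mathbf{F}_q$. Then $S$ and $T$ commute over $\mathbf{F}_q$ if and only if there exist separations $S^\star$ of $S$ and $T^\star$ of $T$ such that $S^\star$ and $T^\star$ commute componentwise over $\mathbf{F}_q$.
   Context: A partition is a weakly decreasing finite sequence of positive integers, whose terms are its parts; the sum of the parts of $\lambda$ is $|\lambda|$. For partitions $\mu$ and $\nu$, $\mu+\nu$ denotes the partition whose multiset of parts is the union (with multiplicities added) of the multisets of parts of $\mu$ and of $\nu$. All partitions in types are partitions of positive integers. Let $K$ be a field and $M\in\mathrm{Mat}_n(K)$. Let $f_1,\dots,f_t$ be the distinct monic irreducible factors over $K$ of the characteristic polynomial of $M$. For each $i$, let $\lambda_i$ be the partition such that the $f_i$-primary component of the $K[x]$-module $K^n$ (with $x$ acting as $M$) is isomorphic to $\bigoplus_j K[x]/(f_i^{\lambda_i(j)})$, where $\lambda_i(j)$ is the $j$-th part of $\lambda_i$. The class type of $M$ is the formal string $d_1^{\lambda_1}\cdots d_t^{\lambda_t}$, where $d_i=\deg f_i$; the order of the terms is unimportant. Any formal string $d_1^{\lambda_1}\cdots d_t^{\lambda_t}$ with $d_i$ positive integers and $\lambda_i$ partitions (order of terms unimportant) is called a type; the terms $d_i^{\lambda_i}$ are its primary components. A type is representable over $K$ if some matrix with entries in $K$ has that class type. Types $S$ and $T$ commute over $K$ if there are commuting matrices $X$ and $Y$ over $K$ of class types $S$ and $T$ respectively. A separation operation on a type $T$ is the replacement of a primary component $d^{\lambda}$ of $T$ by $d^{\mu}d^{\nu}$,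 where $\lambda=\mu+\nu$. A separation of $T$ is a type obtained from $T$ by repeated (zero or more) separation operations. Separations need not be representable over $K$. Types $S$ and $T$ commute componentwise over $K$ if their primary components can be ordered so that $S=c_1^{\lambda_1}\cdots c_t^{\lambda_t}$ and $T=d_1^{\mu_1}\cdots d_t^{\mu_t}$ (with the same number $t$ of components), where for each $i$ the single-component types $c_i^{\lambda_i}$ and $d_i^{\mu_i}$ commute over $K$. This does not require $S$ or $T$ themselves to be representable over $K$. *)

theory Defs
  imports
    "Jordan_Normal_Form.Char_Poly"
    "Jordan_Normal_Form.VS_Connect"
    "HOL-Algebra.QuotRing"
    "HOL-Library.Multiset"
begin

section \<open>Partitions and types\<close>

definition is_partition :: "nat list \<Rightarrow> bool" where
  "is_partition l \<longleftrightarrow> sorted_wrt (\<ge>) l \<and> (\<forall>k\<in>set l. k > 0)"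

text \<open>The sum \<open>\<mu> + \<nu>\<close>: the multisets of parts are added (not the parts themselves).\<close>

definition partition_plus :: "nat list \<Rightarrow> nat list \<Rightarrow> nat list" where
  "partition_plus \<mu> \<nu> = rev (sort (\<mu> @ \<nu>))"

text \<open>
  The formal string \<open>d\<^sub>1\<^sup>\<lambda>\<^sup>1 \<dots> d\<^sub>t\<^sup>\<lambda>\<^sup>t\<close>, in which the order of the terms is irrelevant but
  repetitions matter, is the multiset of the pairs \<open>(d\<^sub>i, \<lambda>\<^sub>i)\<close>. A partition occurring in a
  type is a partition of a positive integer, that is, it has at least one part.
\<close>

type_synonym ctype = "(nat \<times> nat list) multiset"

definition is_type :: "ctype \<Rightarrow> bool" where
  "is_type T \<longleftrightarrow> (\<forall>(d, l) \<in># T. d > 0 \<and> is_partition l \<and> l \<noteq> [])"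

section \<open>The polynomial module of a matrix\<close>

definition poly_mat :: "'k::field poly \<Rightarrow> 'k mat \<Rightarrow> 'k mat" where
  "poly_mat p M = mat (dim_row M) (dim_row M)
     (\<lambda>(i, j). \<Sum>k\<le>degree p. coeff p k * (M ^\<^sub>m k) $$ (i, j))"

text \<open>
  Below, \<^term>\<open>class_ring :: 'k::field poly ring\<close> is the polynomial ring \<open>K[x]\<close> as a
  carrier-based ring. The fields \<open>mult\<close> and \<open>one\<close> of a module record carry no meaning.
\<close>

definition matrix_module :: "'k::field mat \<Rightarrow> ('k poly, 'k vec) module" where
  "matrix_module M =
     \<lparr>carrier = carrier_vec (dim_row M), mult = undefined, one = undefined,
      zero = 0\<^sub>v (dim_row M), add = (+), smult = (\<lambda>p v. poly_mat p M *\<^sub>v v)\<rparr>"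

definition primary_submodule :: "'k::field mat \<Rightarrow> 'k poly \<Rightarrow> ('k poly, 'k vec) module" where
  "primary_submodule M f = (matrix_module M)
     \<lparr>carrier := {v \<in> carrier (matrix_module M).
        \<exists>k::nat. (f ^ k) \<odot>\<^bsub>matrix_module M\<^esub> v = \<zero>\<^bsub>matrix_module M\<^esub>}\<rparr>"

text \<open>The cyclic module \<open>R/(g)\<close>; its elements are the cosets of the principal ideal \<open>(g)\<close>.\<close>

definition cyclic_module :: "('a, 'b) ring_scheme \<Rightarrow> 'a \<Rightarrow> ('a, 'a set) module" where
  "cyclic_module R g =
     (let I = cgenideal R g; Q = FactRing R I in
     \<lparr>carrier = carrier Q, mult = undefined, one = undefined,
      zero = zero Q, add = add Q,
      smult = (\<lambda>p C. (I +>\<^bsub>R\<^esub> p) \<otimes>\<^bsub>Q\<^esub> C)\<rparr>)"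

text \<open>Only used for finite \<open>J\<close>, where the direct sum is the direct product.\<close>

definition direct_sum_over ::
    "'i set \<Rightarrow> ('i \<Rightarrow> ('a, 'b) module) \<Rightarrow> ('a, 'i \<Rightarrow> 'b) module" where
  "direct_sum_over J N =
     \<lparr>carrier = (\<Pi>\<^sub>E j\<in>J. carrier (N j)), mult = undefined, one = undefined,
      zero = (\<lambda>j\<in>J. \<zero>\<^bsub>N j\<^esub>),
      add = (\<lambda>u v. \<lambda>j\<in>J. u j \<oplus>\<^bsub>N j\<^esub> v j),
      smult = (\<lambda>p v. \<lambda>j\<in>J. p \<odot>\<^bsub>N j\<^esub> v j)\<rparr>"

definition module_isomorphic ::
    "('a, 'r) ring_scheme \<Rightarrow> ('a, 'b) module \<Rightarrow> ('a, 'c) module \<Rightarrow> bool" where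
  "module_isomorphic R M N \<longleftrightarrow>
     (\<exists>\<phi> \<in> LinearCombinations.module_hom R M N. bij_betw \<phi> (carrier M) (carrier N))"

section \<open>Class types\<close>

definition primary_partition :: "'k::field mat \<Rightarrow> 'k poly \<Rightarrow> nat list \<Rightarrow> bool" where
  "primary_partition M f l \<longleftrightarrow> is_partition l \<and>
     module_isomorphic class_ring (primary_submodule M f)
       (direct_sum_over {..<length l} (\<lambda>j. cyclic_module class_ring (f ^ (l ! j))))"

definition char_factors :: "'k::field mat \<Rightarrow> 'k poly set" where
  "char_factors M = {f. monic f \<and> irreducible f \<and> f dvd char_poly M}"

text \<open>
  The class type as a relation: the partitions attached to the irreducible factors exist and
  are unique, but this is a theorem. \<open>char_factors M\<close> is finite for square \<open>M\<close>.
\<close>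

definition has_class_type :: "'k::field mat \<Rightarrow> ctype \<Rightarrow> bool" where
  "has_class_type M T \<longleftrightarrow>
     (\<exists>L. (\<forall>f \<in> char_factors M. primary_partition M f (L f)) \<and>
          T = image_mset (\<lambda>f. (degree f, L f)) (mset_set (char_factors M)))"

definition representable :: "'k::field itself \<Rightarrow> ctype \<Rightarrow> bool" where
  "representable K T \<longleftrightarrow>
     (\<exists>n. \<exists>M \<in> carrier_mat n n. has_class_type (M :: 'k mat) T)"

definition types_commute :: "'k::field itself \<Rightarrow> ctype \<Rightarrow> ctype \<Rightarrow> bool" where
  "types_commute K S T \<longleftrightarrow>
     (\<exists>n. \<exists>X \<in> carrier_mat n n. \<exists>Y \<in> carrier_mat n n.
        X * Y = Y * X \<and> has_class_type (X :: 'k mat) S \<and> has_class_type Y T)"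

section \<open>Separations and componentwise commuting\<close>

inductive separation_step :: "ctype \<Rightarrow> ctype \<Rightarrow> bool" where
  "is_partition \<mu> \<Longrightarrow> \<mu> \<noteq> [] \<Longrightarrow> is_partition \<nu> \<Longrightarrow> \<nu> \<noteq> [] \<Longrightarrow>
     separation_step (add_mset (d, partition_plus \<mu> \<nu>) U)
                     (add_mset (d, \<mu>) (add_mset (d, \<nu>) U))"

definition is_separation :: "ctype \<Rightarrow> ctype \<Rightarrow> bool" where
  "is_separation T T' \<longleftrightarrow> separation_step\<^sup>*\<^sup>* T T'"

definition commute_componentwise :: "'k::field itself \<Rightarrow> ctype \<Rightarrow> ctype \<Rightarrow> bool" where
  "commute_componentwise K S T \<longleftrightarrow>
     (\<exists>ss ts. mset ss = S \<and> mset ts = T \<and>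
        list_all2 (\<lambda>s t. types_commute K {#s#} {#t#}) ss ts)"

end

theory Submission
  imports Defs "HOL-Library.Cardinality" "HOL-Library.Function_Algebras"
begin

text \<open>
  Over a finite field with \<open>q\<close> elements, dimensions can be read off from cardinalities: the
  partition \<open>\<lambda>\<close> attached to \<open>f\<close> is determined by \<open>|ker f(M)\<^sup>k| = q ^ (deg f * \<Sum>\<^sub>j min \<lambda>\<^sub>j k)\<close>
  for all \<open>k\<close>, and \<open>f\<close> divides the characteristic polynomial iff \<open>f(M)\<close> has a nontrivial kernel.

  If \<open>X\<close> and \<open>Y\<close> commute, their primary decompositions refine to a joint decomposition into blocks
  \<open>V\<^sub>f\<^sub>g\<close>, on which \<open>X\<close> and \<open>Y\<close> have single-component types; as kernel cardinalities multiply, these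
  types form separations of the types of \<open>X\<close> and \<open>Y\<close>.

  Conversely, commuting pairs \<open>(X\<^sub>i, Y\<^sub>i)\<close> for the components are to be combined into block diagonal
  matrices. The irreducible polynomials belonging to \<open>X\<^sub>i\<close> and \<open>Y\<^sub>i\<close> have the right degrees but may be
  the wrong ones. Irreducible polynomials of the same degree over a finite field have the same
  splitting behaviour, so \<open>X\<^sub>i\<close> can be replaced by a polynomial in \<open>X\<^sub>i\<close> that has the same partition for
  any prescribed irreducible polynomial of that degree, and likewise \<open>Y\<^sub>i\<close>; this preserves commutation.
\<close>

section \<open>Polynomials in a matrix\<close>

text \<open>Class types are defined by module isomorphisms, but such an isomorphism is built only
  once, to see that a partition exists. Counting then identifies the partition, and kernel
  cardinalities are all that is compared afterwards: they multiply over block sums and over primary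
  decompositions, so their exponents add, just as multisets of parts do. The obstacle in the
  converse is that separations need not be representable: there may be fewer irreducible polynomials
  of degree \<open>d\<close> than a separation has components of degree \<open>d\<close>. So no
  matrix of the separated type is sought. Each component remembers the irreducible polynomial of the
  component it was split from, blocks with equal polynomials merge again, and representability of
  \<open>S\<close> and \<open>T\<close> supplies distinct polynomials for the original components.
  Prescribing the polynomial of a block is where finiteness of the field is essential: in general,
  irreducible polynomials of equal degree may define different extensions. A root \<open>p\<close>
  of \<open>F\<close> modulo \<open>f\<close> is not enough either; if \<open>f ^ 2\<close> divided
  \<open>F(p)\<close>, the parts of the partition could change.\<close>

lemma index_poly_mat:
  assumes "M \<in> carrier_mat n n" "i < n" "j < n" "degree p \<le> N"
  shows "poly_mat p M $$ (i, j) = (\<Sum>k\<le>N. coeff p k * (M ^\<^sub>m k) $$ (i, j))"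
proof -
  have "(\<Sum>k\<le>degree p. coeff p k * (M ^\<^sub>m k) $$ (i, j)) = (\<Sum>k\<le>N. coeff p k * (M ^\<^sub>m k) $$ (i, j))"
    by (rule sum.mono_neutral_left) (use assms in \<open>auto simp: coeff_eq_0\<close>)
  then show ?thesis using assms by (simp add: poly_mat_def)
qed

lemma poly_mat_carrier [simp]: "M \<in> carrier_mat n n \<Longrightarrow> poly_mat p M \<in> carrier_mat n n"
  by (auto simp: poly_mat_def)

lemma dim_poly_mat [simp]:
  "dim_row (poly_mat p M) = dim_row M" "dim_col (poly_mat p M) = dim_row M"
  by (auto simp: poly_mat_def)

lemma poly_mat_0: "M \<in> carrier_mat n n \<Longrightarrow> poly_mat 0 M = 0\<^sub>m n n"
  by (intro eq_matI) (auto simp: poly_mat_def)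

lemma poly_mat_add:
  assumes M: "M \<in> carrier_mat n n"
  shows "poly_mat (p + q) M = poly_mat p M + poly_mat q M"
proof (rule eq_matI)
  fix i j assume "i < dim_row (poly_mat p M + poly_mat q M)" "j < dim_col (poly_mat p M + poly_mat q M)"
  then have ij: "i < n" "j < n" using M by auto
  let ?N = "max (degree p) (degree q)"
  have "degree (p + q) \<le> ?N" by (rule degree_add_le_max)
  then show "poly_mat (p + q) M $$ (i, j) = (poly_mat p M + poly_mat q M) $$ (i, j)"
    using M ij by (simp add: index_poly_mat[where N = ?N] algebra_simps sum.distrib)
qed (use M in auto)

lemma poly_mat_pCons:
  assumes M: "M \<in> carrier_mat n n"
  shows "poly_mat (pCons a p) M = a \<cdot>\<^sub>m 1\<^sub>m n + poly_mat p M * M"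
proof (rule eq_matI)
  fix i j
  assume "i < dim_row (a \<cdot>\<^sub>m 1\<^sub>m n + poly_mat p M * M)" "j < dim_col (a \<cdot>\<^sub>m 1\<^sub>m n + poly_mat p M * M)"
  then have ij: "i < n" "j < n" using M by auto
  let ?N = "degree p"
  have Suc: "(M ^\<^sub>m Suc k) $$ (i, j) = (\<Sum>l<n. (M ^\<^sub>m k) $$ (i, l) * M $$ (l, j))" for k
    using M ij by (simp add: scalar_prod_def atLeast0LessThan)
  have "(poly_mat p M * M) $$ (i, j) = (\<Sum>l<n. poly_mat p M $$ (i, l) * M $$ (l, j))"
    using M ij by (simp add: scalar_prod_def atLeast0LessThan)
  also have "\<dots> = (\<Sum>l<n. \<Sum>k\<le>?N. coeff p k * ((M ^\<^sub>m k) $$ (i, l) * M $$ (l, j)))"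
    by (rule sum.cong) (use M ij in \<open>auto simp: index_poly_mat[where N = ?N] sum_distrib_right mult.assoc\<close>)
  also have "\<dots> = (\<Sum>k\<le>?N. coeff p k * (M ^\<^sub>m Suc k) $$ (i, j))"
    by (subst sum.swap) (simp only: Suc sum_distrib_left)
  finally have *: "(poly_mat p M * M) $$ (i, j) = (\<Sum>k\<le>?N. coeff p k * (M ^\<^sub>m Suc k) $$ (i, j))" .
  have "poly_mat (pCons a p) M $$ (i, j)
      = (\<Sum>k\<le>Suc ?N. coeff (pCons a p) k * (M ^\<^sub>m k) $$ (i, j))"
    by (rule index_poly_mat[OF M ij]) (rule degree_pCons_le)
  also have "\<dots> = a * (1\<^sub>m n) $$ (i, j) + (poly_mat p M * M) $$ (i, j)"
    unfolding sum.atMost_Suc_shift * using M ij by simp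
  finally show "poly_mat (pCons a p) M $$ (i, j) = (a \<cdot>\<^sub>m 1\<^sub>m n + poly_mat p M * M) $$ (i, j)"
    using M ij by simp
qed (use M in auto)

lemma poly_mat_1: "M \<in> carrier_mat n n \<Longrightarrow> poly_mat 1 M = 1\<^sub>m n"
  by (intro eq_matI) (auto simp: poly_mat_def)

text \<open>One induction with a rectangular \<open>B\<close> serves several purposes:
  \<open>B = M\<close> shows that \<open>p(M)\<close> commutes with \<open>M\<close>, a square
  \<open>B\<close> commuting with \<open>X\<close> gives commuting polynomials, and a
  \<open>B\<close> whose columns are a basis of an invariant subspace passes from \<open>X\<close>
  to its restriction.\<close>

lemma poly_mat_intertwine:
  assumes X: "X \<in> carrier_mat n n" and Z: "Z \<in> carrier_mat m m" and B: "B \<in> carrier_mat n m"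
    and XB: "X * B = B * Z"
  shows "poly_mat p X * B = B * poly_mat p Z"
proof (induction p)
  case 0
  show ?case using X Z B by (simp add: poly_mat_0)
next
  case (pCons a p)
  have "poly_mat (pCons a p) X * B = a \<cdot>\<^sub>m B + poly_mat p X * X * B"
    unfolding poly_mat_pCons[OF X]
    using X B by (subst add_mult_distrib_mat[of _ n n _ _ m]) (auto simp: mult_smult_assoc_mat[of _ n n _ m])
  also have "poly_mat p X * X * B = poly_mat p X * (B * Z)"
    using X B by (simp add: XB assoc_mult_mat[of _ n n _ n])
  also have "\<dots> = B * (poly_mat p Z * Z)"
    using X B Z by (simp add: pCons.IH flip: assoc_mult_mat[of _ n n _ m _ m] assoc_mult_mat[of _ n m _ m _ m])
  also have "a \<cdot>\<^sub>m B + B * (poly_mat p Z * Z) = B * poly_mat (pCons a p) Z"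
    unfolding poly_mat_pCons[OF Z]
    using Z B by (subst mult_add_distrib_mat[of _ n m _ m]) (auto simp: mult_smult_distrib[of _ n m _ m])
  finally show ?case .
qed

lemma poly_mat_commute:
  assumes "X \<in> carrier_mat n n" "Y \<in> carrier_mat n n" "X * Y = Y * X"
  shows "poly_mat p X * poly_mat q Y = poly_mat q Y * poly_mat p X"
proof -
  have "poly_mat p X * Y = Y * poly_mat p X"
    using assms by (intro poly_mat_intertwine) auto
  then show ?thesis
    using assms by (intro poly_mat_intertwine[symmetric]) auto
qed

lemma poly_mat_smult:
  assumes M: "M \<in> carrier_mat n n"
  shows "poly_mat (Polynomial.smult a p) M = a \<cdot>\<^sub>m poly_mat p M"
  using M by (intro eq_matI) (auto simp: index_poly_mat[where N = "degree p"] sum_distrib_left mult.assoc)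

lemma poly_mat_mult:
  assumes M: "M \<in> carrier_mat n n"
  shows "poly_mat (p * q) (M :: 'a::field mat) = poly_mat p M * poly_mat q M"
proof (induction p)
  case 0
  then show ?case using M by (simp add: poly_mat_0)
next
  case (pCons a p)
  \<comment> \<open>The recursion for \<open>pCons\<close> multiplies by \<open>M\<close> on the
    right, so \<open>M\<close> has to be moved past \<open>q(M)\<close>.\<close>
  have c: "poly_mat q M * M = M * poly_mat q M"
    using M by (intro poly_mat_intertwine) auto
  have 0: "0 \<cdot>\<^sub>m 1\<^sub>m n + poly_mat p M * poly_mat q M * M = poly_mat p M * poly_mat q M * M"
    using M by (intro eq_matI) auto
  have "poly_mat (pCons a p * q) M = a \<cdot>\<^sub>m poly_mat q M + poly_mat p M * poly_mat q M * M"
    using M by (simp add: poly_mat_add poly_mat_smult poly_mat_pCons pCons.IH 0)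
  also have "poly_mat p M * poly_mat q M * M = poly_mat p M * M * poly_mat q M"
    using M by (simp add: c assoc_mult_mat[of _ n n _ n _ n])
  also have "a \<cdot>\<^sub>m poly_mat q M + \<dots> = poly_mat (pCons a p) M * poly_mat q M"
    unfolding poly_mat_pCons[OF M]
    using M by (subst add_mult_distrib_mat[of _ n n _ _ n]) (auto simp: mult_smult_assoc_mat[of _ n n _ n])
  finally show ?case .
qed

lemma poly_mat_pcompose:
  assumes M: "M \<in> carrier_mat n n"
  shows "poly_mat (pcompose p q) M = poly_mat p (poly_mat q M)"
proof (induction p)
  case 0
  then show ?case using M by (simp add: poly_mat_0[of _ n])
next
  case (pCons a p)
  have "poly_mat [:a:] M = a \<cdot>\<^sub>m 1\<^sub>m n" using M by (simp add: poly_mat_pCons poly_mat_0)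
  then show ?case
    using M by (simp add: pcompose_pCons mult.commute[of q] poly_mat_add poly_mat_mult pCons.IH
      poly_mat_pCons[of "poly_mat q M" n])
qed

lemma poly_mat_mult_vec:
  assumes "M \<in> carrier_mat n n" "v \<in> carrier_vec n"
  shows "poly_mat (p * q) M *\<^sub>v v = poly_mat p M *\<^sub>v (poly_mat q M *\<^sub>v v)"
  using assms by (simp add: poly_mat_mult assoc_mult_mat_vec[of _ n n _ n])

lemma poly_mat_four_block:
  assumes A: "A \<in> carrier_mat n n" and B: "B \<in> carrier_mat m m"
  shows "poly_mat p (four_block_mat A (0\<^sub>m n m) (0\<^sub>m m n) B)
    = four_block_mat (poly_mat p A) (0\<^sub>m n m) (0\<^sub>m m n) (poly_mat p B)"
proof -
  have [simp]: "dim_row A = n" "dim_col A = n" "dim_row B = m" "dim_col B = m" using A B by auto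
  show ?thesis
    by (intro eq_matI) (auto simp: poly_mat_def pow_four_block_mat[OF A B] pow_mat_dim_square[OF A] pow_mat_dim_square[OF B] simp del: pow_mat_dim)
qed

lemma poly_mat_sum_index:
  assumes M: "M \<in> carrier_mat n n" and "i < n" "j < n"
  shows "poly_mat (sum f I) M $$ (i, j) = (\<Sum>s\<in>I. poly_mat (f s) M $$ (i, j))"
  using assms by (induction I rule: infinite_finite_induct) (auto simp: poly_mat_0 poly_mat_add)

text \<open>Substituting \<open>M\<close> for \<open>x\<close> in the columns of a polynomial matrix \<open>U\<close>, that is, mapping
  a column \<open>u\<close> to \<open>\<Sum>\<^sub>l u\<^sub>l(M) e\<^sub>l\<close>, kills the multiples of \<open>x - M\<close>.\<close>

theorem cayley_hamilton:
  fixes M :: "'a::field mat"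
  assumes M: "M \<in> carrier_mat n n"
  shows "poly_mat (char_poly M) M = 0\<^sub>m n n"
proof (rule eq_matI)
  let ?C = "char_poly_matrix M"
  define U where "U = adj_mat ?C"
  have C: "?C \<in> carrier_mat n n" using M by simp
  have U: "U \<in> carrier_mat n n" and CU: "?C * U = char_poly M \<cdot>\<^sub>m 1\<^sub>m n"
    using adj_mat[OF C] by (auto simp: U_def char_poly_def)
  fix i j assume "i < dim_row (0\<^sub>m n n :: 'a mat)" "j < dim_col (0\<^sub>m n n :: 'a mat)"
  then have ij: "i < n" "j < n" by auto
  \<comment> \<open>Column \<open>j\<close> of \<open>(x - M) U\<close>, with the term containing
    \<open>x\<close> kept apart: under evaluation that \<open>x\<close> becomes a right factor
    \<open>M\<close>, as \<open>X\<close> records below.\<close>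
  have CUl: "(?C * U) $$ (l, j) = [:0, 1:] * U $$ (l, j) + (\<Sum>s<n. [:- M $$ (l, s):] * U $$ (s, j))"
    if "l < n" for l
  proof -
    have "(?C * U) $$ (l, j) = (\<Sum>s<n. ?C $$ (l, s) * U $$ (s, j))"
      using C U that ij by (simp add: scalar_prod_def atLeast0LessThan)
    also have "\<dots> = (\<Sum>s<n. (if s = l then [:0, 1:] * U $$ (s, j) else 0)
        + [:- M $$ (l, s):] * U $$ (s, j))"
      by (rule sum.cong) (use M that in \<open>auto simp: char_poly_matrix_def algebra_simps\<close>)
    also have "\<dots> = [:0, 1:] * U $$ (l, j) + (\<Sum>s<n. [:- M $$ (l, s):] * U $$ (s, j))"
      using that by (simp only: sum.distrib sum.delta finite_lessThan lessThan_iff if_True)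
    finally show ?thesis .
  qed
  have X: "poly_mat ([:0, 1:] * u) M $$ (i, l) = (\<Sum>s<n. poly_mat u M $$ (i, s) * M $$ (s, l))"
    if "l < n" for u l
    using M ij that by (simp add: poly_mat_pCons scalar_prod_def atLeast0LessThan)
  \<comment> \<open>Since \<open>?C * U\<close> is diagonal, evaluating its column \<open>j\<close>
    leaves a single term.\<close>
  have "poly_mat (char_poly M) M $$ (i, j) = (\<Sum>l<n. poly_mat ((?C * U) $$ (l, j)) M $$ (i, l))"
  proof -
    have "(\<Sum>l<n. poly_mat ((?C * U) $$ (l, j)) M $$ (i, l))
        = (\<Sum>l<n. if l = j then poly_mat (char_poly M) M $$ (i, j) else 0)"
      by (rule sum.cong) (use ij M in \<open>auto simp: CU poly_mat_0\<close>)
    then show ?thesis using ij by simp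
  qed
  also have "\<dots> = (\<Sum>l<n. (\<Sum>s<n. poly_mat (U $$ (l, j)) M $$ (i, s) * M $$ (s, l)))
      + (\<Sum>l<n. \<Sum>s<n. - (M $$ (l, s) * poly_mat (U $$ (s, j)) M $$ (i, l)))"
  proof (subst sum.distrib[symmetric], rule sum.cong[OF refl])
    fix l assume "l \<in> {..<n}"
    then have l: "l < n" by simp
    have "poly_mat ((?C * U) $$ (l, j)) M $$ (i, l)
      = poly_mat ([:0, 1:] * U $$ (l, j)) M $$ (i, l)
       + (\<Sum>s<n. poly_mat ([:- M $$ (l, s):] * U $$ (s, j)) M $$ (i, l))"
      unfolding CUl[OF l] using M ij l by (simp only: poly_mat_add[OF M] poly_mat_sum_index[OF M] index_add_mat dim_poly_mat carrier_matD)
    also have "(\<Sum>s<n. poly_mat ([:- M $$ (l, s):] * U $$ (s, j)) M $$ (i, l))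
      = (\<Sum>s<n. - (M $$ (l, s) * poly_mat (U $$ (s, j)) M $$ (i, l)))"
      using M ij l by (auto simp: poly_mat_smult[OF M] smult_minus_left[symmetric] simp del: smult_minus_left)
    finally show "poly_mat ((?C * U) $$ (l, j)) M $$ (i, l)
      = (\<Sum>s<n. poly_mat (U $$ (l, j)) M $$ (i, s) * M $$ (s, l))
       + (\<Sum>s<n. - (M $$ (l, s) * poly_mat (U $$ (s, j)) M $$ (i, l)))"
      by (simp only: X[OF l])
  qed
  also have "(\<Sum>l<n. \<Sum>s<n. - (M $$ (l, s) * poly_mat (U $$ (s, j)) M $$ (i, l)))
      = (\<Sum>s<n. \<Sum>l<n. - (M $$ (l, s) * poly_mat (U $$ (s, j)) M $$ (i, l)))"
    by (rule sum.swap)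
  also have "(\<Sum>l<n. (\<Sum>s<n. poly_mat (U $$ (l, j)) M $$ (i, s) * M $$ (s, l))) + \<dots> = 0"
    by (simp add: sum_negf mult.commute)
  finally show "poly_mat (char_poly M) M $$ (i, j) = 0\<^sub>m n n $$ (i, j)" using ij by simp
qed (use M in auto)

section \<open>Irreducible polynomials and kernels\<close>

text \<open>Coprimality in Bezout form, which is how it acts on modules: what \<open>a\<close> and
  \<open>b\<close> both kill is killed by 1, and the two summands become projections.\<close>

definition comaximal :: "'a::comm_ring_1 \<Rightarrow> 'a \<Rightarrow> bool" where
  "comaximal a b \<longleftrightarrow> (\<exists>u v. u * a + v * b = 1)"

lemma comaximal_sym: "comaximal a b \<Longrightarrow> comaximal b a"
  unfolding comaximal_def by (metis add.commute)

lemma comaximal_mult: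
  assumes "comaximal a c" "comaximal b c"
  shows "comaximal (a * b) c"
proof -
  obtain u v w z where "u * a + v * c = 1" "w * b + z * c = 1"
    using assms unfolding comaximal_def by blast
  then have "(u * a + v * c) * (w * b + z * c) = 1" by simp
  then have "(u * w) * (a * b) + (u * a * z + v * w * b + v * z * c) * c = 1"
    by (simp add: algebra_simps)
  then show ?thesis unfolding comaximal_def by blast
qed

lemma comaximal_power: "comaximal a c \<Longrightarrow> comaximal (a ^ k) c"
proof (induction k)
  case 0
  show ?case unfolding comaximal_def by (rule exI[of _ 1], rule exI[of _ 0]) simp
qed (simp add: comaximal_mult)

lemma comaximal_powers: "comaximal a c \<Longrightarrow> comaximal (a ^ k) (c ^ m)"
  by (meson comaximal_power comaximal_sym)

text \<open>A nonzero element of least degree in the ideal generated by \<open>f\<close> and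
  \<open>g\<close> divides the whole ideal, since remainders stay in it. Dividing \<open>f\<close>
  but not being an associate of it, it is a unit.\<close>

lemma irreducible_comaximal:
  fixes f g :: "'a::field poly"
  assumes f: "irreducible f" and ndvd: "\<not> f dvd g"
  shows "comaximal f g"
proof -
  let ?I = "\<lambda>d. d \<noteq> 0 \<and> (\<exists>u v. d = u * f + v * g)"
  have "?I f" using f by (metis add.right_neutral irreducible_not_unit mult_1 mult_zero_left not_irreducible_zero)
  then obtain d where d: "?I d" and min: "\<And>e. ?I e \<Longrightarrow> degree d \<le> degree e"
    using exists_least_lemma arg_min_nat_lemma[of ?I f degree] by blast
  obtain u v where uv: "d = u * f + v * g" using d by blast
  have dvd: "d dvd h" if "h = a * f + b * g" for h a b
  proof (rule ccontr)
    assume n: "\<not> d dvd h"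
    have "h mod d = h - (h div d) * d" by (simp add: minus_div_mult_eq_mod)
    also have "\<dots> = (a - h div d * u) * f + (b - h div d * v) * g"
      unfolding that uv by (simp add: algebra_simps)
    finally have "?I (h mod d)" using n by (auto simp: dvd_eq_mod_eq_0)
    from min[OF this] show False
      using n d degree_mod_less'[of d h] by (auto simp: dvd_eq_mod_eq_0)
  qed
  have "d dvd f" using dvd[of f 1 0] by simp
  moreover have "d dvd g" using dvd[of g 0 1] by simp
  ultimately have "d dvd 1"
    using f ndvd by (metis dvd_trans irreducibleD')
  then obtain e where "1 = d * e" unfolding dvd_def by blast
  then have "(e * u) * f + (e * v) * g = 1" unfolding uv by (simp add: algebra_simps)
  then show ?thesis unfolding comaximal_def by blast
qed

lemma irreducible_poly_dvd_mult:
  fixes f :: "'a::field poly"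
  assumes "irreducible f" "f dvd a * b"
  shows "f dvd a \<or> f dvd b"
proof (rule ccontr)
  assume "\<not> ?thesis"
  then have "comaximal a f" "comaximal b f" using irreducible_comaximal[OF assms(1)] comaximal_sym by blast+
  then obtain u v where "u * (a * b) + v * f = 1" using comaximal_mult unfolding comaximal_def by blast
  then have "f dvd 1" using assms(2) by (metis dvd_add dvd_mult dvd_triv_right)
  then show False using assms(1) irreducible_not_unit by blast
qed

lemma monic_irreducible_dvd_eq:
  fixes f g :: "'a::field poly"
  assumes "irreducible f" "irreducible g" "monic f" "monic g" "f dvd g"
  shows "f = g"
proof -
  obtain c where c: "g = f * c" using assms(5) unfolding dvd_def by blast
  have "\<not> is_unit f" using assms irreducible_not_unit by blast
  then have "is_unit c" using assms(2) c irreducible_def by metis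
  then obtain a where "c = [:a:]" using degree_eq_zeroE by (auto simp: is_unit_iff_degree)
  then show ?thesis using assms c by (auto simp: lead_coeff_mult)
qed

definition poly_kernel :: "'k::field mat \<Rightarrow> 'k poly \<Rightarrow> 'k vec set" where
  "poly_kernel M p = {v \<in> carrier_vec (dim_row M). poly_mat p M *\<^sub>v v = 0\<^sub>v (dim_row M)}"

lemma zero_in_poly_kernel: "M \<in> carrier_mat n n \<Longrightarrow> 0\<^sub>v n \<in> poly_kernel M p"
  using poly_mat_carrier[of M n p] by (auto simp: poly_kernel_def)

lemma poly_kernel_mult_right:
  assumes "M \<in> carrier_mat n n" "v \<in> poly_kernel M p"
  shows "v \<in> poly_kernel M (q * p)"
  using assms poly_mat_carrier[of M n q] by (auto simp: poly_kernel_def poly_mat_mult_vec[of M n])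

lemma poly_kernel_comaximal:
  assumes M: "M \<in> carrier_mat n n" and pq: "comaximal p q"
    and v: "v \<in> poly_kernel M p" "v \<in> poly_kernel M q"
  shows "v = 0\<^sub>v n"
proof -
  obtain a b where ab: "a * p + b * q = 1" using pq unfolding comaximal_def by blast
  have vc: "v \<in> carrier_vec n" using v M by (auto simp: poly_kernel_def)
  have "v = poly_mat (a * p + b * q) M *\<^sub>v v" using vc M by (simp add: ab poly_mat_1)
  also have "\<dots> = poly_mat (a * p) M *\<^sub>v v + poly_mat (b * q) M *\<^sub>v v"
    using M vc by (simp add: poly_mat_add add_mult_distrib_mat_vec[of _ n n])
  also have "\<dots> = 0\<^sub>v n"
    using poly_kernel_mult_right[OF M v(1), of a] poly_kernel_mult_right[OF M v(2), of b] M
    by (auto simp: poly_kernel_def)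
  finally show ?thesis .
qed

lemma poly_kernel_char_poly:
  assumes M: "M \<in> carrier_mat n n"
  shows "poly_kernel M (char_poly M) = carrier_vec n"
  using M by (auto simp: poly_kernel_def cayley_hamilton)

text \<open>The remainder theorem for matrices: \<open>p I - p(M) = (x - M) H\<close>. If
  \<open>H\<close> works for \<open>p\<close>, then \<open>p I + M H\<close> works for
  \<open>a + x p\<close>, because \<open>M\<close> commutes with \<open>p(M)\<close>.\<close>

lemma char_poly_matrix_dvd:
  fixes M :: "'a::field mat"
  assumes M: "M \<in> carrier_mat n n"
  shows "\<exists>H. \<forall>i<n. \<forall>j<n. (if i = j then p else 0) - [:poly_mat p M $$ (i, j):]
    = [:0, 1:] * H i j - (\<Sum>l<n. [:M $$ (i, l):] * H l j)"
proof (induction p)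
  case 0
  show ?case by (rule exI[of _ "\<lambda>_ _. 0"]) (use M in \<open>auto simp: poly_mat_0\<close>)
next
  case (pCons a p)
  let ?x = "[:0, 1:] :: 'a poly"
  let ?c = "\<lambda>i l. [:M $$ (i, l):]"
  obtain H where H: "\<And>i j. i < n \<Longrightarrow> j < n \<Longrightarrow>
      (if i = j then p else 0) - [:poly_mat p M $$ (i, j):] = ?x * H i j - (\<Sum>l<n. ?c i l * H l j)"
    using pCons.IH by blast
  define H' where "H' = (\<lambda>i j. (if i = j then p else 0) + (\<Sum>l<n. ?c i l * H l j))"
  have "(if i = j then pCons a p else 0) - [:poly_mat (pCons a p) M $$ (i, j):]
    = ?x * H' i j - (\<Sum>l<n. ?c i l * H' l j)" if ij: "i < n" "j < n" for i j
  proof -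
    have "poly_mat p M * M = M * poly_mat p M"
      using M by (intro poly_mat_intertwine) auto
    then have *: "poly_mat (pCons a p) M $$ (i, j)
        = (if i = j then a else 0) + (\<Sum>l<n. M $$ (i, l) * poly_mat p M $$ (l, j))"
      using M ij by (simp add: poly_mat_pCons scalar_prod_def atLeast0LessThan)
    have const: "(\<Sum>l<m. [:g l:]) = [:\<Sum>l<m. g l:]" for g :: "nat \<Rightarrow> 'a" and m
      by (induction m) auto
    have "(\<Sum>l<n. ?c i l * H' l j) = (\<Sum>l<n. ?c i l * (if l = j then p else 0) + ?c i l * (\<Sum>s<n. ?c l s * H s j))"
      unfolding H'_def by (simp only: distrib_left)
    also have "\<dots> = (\<Sum>l<n. ?c i l * (?x * H l j) + [:M $$ (i, l) * poly_mat p M $$ (l, j):])"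
    proof (rule sum.cong[OF refl])
      fix l assume "l \<in> {..<n}"
      then have "(\<Sum>s<n. ?c l s * H s j) = ?x * H l j - ((if l = j then p else 0) - [:poly_mat p M $$ (l, j):])"
        using H[of l j] ij by (simp only: lessThan_iff) (simp add: algebra_simps)
      then show "?c i l * (if l = j then p else 0) + ?c i l * (\<Sum>s<n. ?c l s * H s j)
          = ?c i l * (?x * H l j) + [:M $$ (i, l) * poly_mat p M $$ (l, j):]"
        by (simp only:) (simp add: algebra_simps smult_diff_right smult_add_right)
    qed
    also have "\<dots> = ?x * (\<Sum>l<n. ?c i l * H l j) + [:\<Sum>l<n. M $$ (i, l) * poly_mat p M $$ (l, j):]"
      unfolding sum.distrib sum_distrib_left const by (simp only: mult.left_commute[of ?x])
    finally show ?thesis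
      unfolding * H'_def by (cases "i = j") (simp_all add: distrib_left)
  qed
  then show ?case by blast
qed

text \<open>Taking determinants in \<open>f I - f(M) = (x - M) H\<close> shows that
  \<open>char_poly M\<close> divides the characteristic polynomial of \<open>f(M)\<close> with
  \<open>f\<close> substituted for \<open>x\<close>. So \<open>f\<close> divides its constant term,
  which is nonzero if \<open>f(M)\<close> is injective. This avoids extending the field.\<close>

lemma poly_kernel_nontrivial:
  fixes M :: "'a::field mat"
  assumes M: "M \<in> carrier_mat n n" and f: "irreducible f" and dvd: "f dvd char_poly M"
  shows "poly_kernel M f \<noteq> {0\<^sub>v n}"
proof
  assume triv: "poly_kernel M f = {0\<^sub>v n}"
  let ?A = "poly_mat f M"
  have A: "?A \<in> carrier_mat n n" using M by simp
  \<comment> \<open>This is \<open>f I - f(M)\<close>.\<close>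
  let ?F = "map_mat (\<lambda>q. pcompose q f) (char_poly_matrix ?A)"
  obtain H where H: "\<And>i j. i < n \<Longrightarrow> j < n \<Longrightarrow> (if i = j then f else 0) - [:?A $$ (i, j):]
    = [:0, 1:] * H i j - (\<Sum>l<n. [:M $$ (i, l):] * H l j)"
    using char_poly_matrix_dvd[OF M, of f] by blast
  have "?F = char_poly_matrix M * mat n n (\<lambda>(i, j). H i j)"
  proof (rule eq_matI)
    fix i j assume "i < dim_row (char_poly_matrix M * mat n n (\<lambda>(i, j). H i j))"
      "j < dim_col (char_poly_matrix M * mat n n (\<lambda>(i, j). H i j))"
    then have ij: "i < n" "j < n" using M char_poly_matrix_closed[OF M] by auto
    have "(char_poly_matrix M * mat n n (\<lambda>(i, j). H i j)) $$ (i, j)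
      = (\<Sum>l<n. char_poly_matrix M $$ (i, l) * H l j)"
      using char_poly_matrix_closed[OF M] ij by (simp add: scalar_prod_def atLeast0LessThan)
    also have "\<dots> = (\<Sum>l<n. (if i = l then [:0, 1:] * H i j else 0) - [:M $$ (i, l):] * H l j)"
      by (rule sum.cong) (use M ij in \<open>auto simp: char_poly_matrix_def\<close>)
    also have "\<dots> = (\<Sum>l<n. (if i = l then [:0, 1:] * H i j else 0)) - (\<Sum>l<n. [:M $$ (i, l):] * H l j)"
      by (rule sum_subtractf)
    also have "\<dots> = [:0, 1:] * H i j - (\<Sum>l<n. [:M $$ (i, l):] * H l j)"
      using ij by (simp only: sum.delta' finite_lessThan lessThan_iff if_True)
    also have "\<dots> = ?F $$ (i, j)"
      unfolding H[OF ij, symmetric] using M ij by (simp add: char_poly_matrix_def pcompose_pCons)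
    finally show "?F $$ (i, j) = (char_poly_matrix M * mat n n (\<lambda>(i, j). H i j)) $$ (i, j)" by simp
  qed (use carrier_matD[OF char_poly_matrix_closed[OF M]] carrier_matD[OF char_poly_matrix_closed[OF A]] in auto)
  then have "det ?F = char_poly M * det (mat n n (\<lambda>(i, j). H i j))"
    using char_poly_matrix_closed[OF M] by (simp add: det_mult[of _ n] char_poly_def)
  moreover have "det ?F = pcompose (char_poly ?A) f"
    by (simp add: comm_ring_hom.hom_det[OF pcompose_hom.comm_ring_hom_axioms] char_poly_def)
  ultimately have dvd': "f dvd pcompose (char_poly ?A) f" using dvd by simp
  obtain c r where cr: "char_poly ?A = pCons c r" by (cases "char_poly ?A")
  \<comment> \<open>All terms but the constant one are multiples of \<open>f\<close>.\<close>
  have "f dvd [:c:]"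
    using dvd' unfolding cr pcompose_pCons by (simp add: dvd_add_left_iff)
  moreover have "c \<noteq> 0"
  proof
    assume "c = 0"
    then have "eigenvalue ?A 0" unfolding eigenvalue_root_char_poly[OF A] cr by simp
    moreover have "0 \<cdot>\<^sub>v v = 0\<^sub>v n" if "v \<in> carrier_vec n" for v :: "'a vec"
      using that by (intro eq_vecI) auto
    ultimately obtain v where "v \<in> carrier_vec n" "v \<noteq> 0\<^sub>v n" "?A *\<^sub>v v = 0\<^sub>v n"
      using M by (auto simp: eigenvalue_def eigenvector_def)
    then show False using triv M by (auto simp: poly_kernel_def)
  qed
  ultimately have "f dvd 1"
    by (metis dvd_trans is_unit_triv)
  then show False using f irreducible_not_unit by blast
qed

text \<open>The remaining direction is Cayley-Hamilton: if \<open>f\<close> does not divide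
  \<open>char_poly M\<close>, the two are comaximal and both kill the kernel of
  \<open>f(M)\<close>.\<close>

theorem irreducible_dvd_char_poly_iff:
  assumes M: "M \<in> carrier_mat n n" and f: "irreducible f"
  shows "f dvd char_poly M \<longleftrightarrow> poly_kernel M f \<noteq> {0\<^sub>v n}"
proof
  assume "poly_kernel M f \<noteq> {0\<^sub>v n}"
  then obtain v where v: "v \<in> poly_kernel M f" "v \<noteq> 0\<^sub>v n" using zero_in_poly_kernel[OF M] by blast
  then have "v \<in> poly_kernel M (char_poly M)"
    using M poly_kernel_char_poly[OF M] by (auto simp: poly_kernel_def)
  then show "f dvd char_poly M"
    using poly_kernel_comaximal[OF M irreducible_comaximal[OF f] v(1)] v(2) by blast
qed (rule poly_kernel_nontrivial[OF M f])

lemma char_factors_eq: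
  assumes M: "M \<in> carrier_mat n n"
  shows "char_factors M = {f. monic f \<and> irreducible f \<and> poly_kernel M f \<noteq> {0\<^sub>v n}}"
  using irreducible_dvd_char_poly_iff[OF M] by (auto simp: char_factors_def)


section \<open>Roots modulo an irreducible polynomial over a finite field\<close>

text \<open>The polynomials of degree below \<open>m\<close>, including 0 also for
  \<open>m = 0\<close>. They form a complete residue system modulo any polynomial of degree
  \<open>m\<close> over a field.\<close>

definition short_polys :: "nat \<Rightarrow> 'a::zero poly set" where
  "short_polys m = {p. \<forall>i\<ge>m. coeff p i = 0}"

lemma short_polys_Suc: "short_polys (Suc m) = (\<lambda>(a, p). pCons a p) ` (UNIV \<times> short_polys m)"
proof (intro equalityI subsetI)
  fix p :: "'a poly" assume p: "p \<in> short_polys (Suc m)"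
  obtain a q where pq: "p = pCons a q" by (cases p)
  have "q \<in> short_polys m"
    using p unfolding pq short_polys_def by (auto simp: coeff_pCons split: nat.splits)
  then show "p \<in> (\<lambda>(a, p). pCons a p) ` (UNIV \<times> short_polys m)" using pq by auto
qed (auto simp: short_polys_def coeff_pCons split: nat.splits)

lemma card_short_polys:
  "finite (short_polys m :: 'k::{field,finite} poly set)
    \<and> card (short_polys m :: 'k poly set) = CARD('k) ^ m"
proof (induction m)
  case 0
  have "short_polys 0 = {0 :: 'k poly}" by (auto simp: short_polys_def poly_eq_iff)
  then show ?case by simp
next
  case (Suc m)
  have "inj_on (\<lambda>(a, p). pCons a p) (UNIV \<times> short_polys m :: ('k \<times> 'k poly) set)"
    by (auto simp: inj_on_def)
  then show ?case using Suc by (simp add: short_polys_Suc card_image card_cartesian_product)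
qed

lemma finite_short_polys [simp]: "finite (short_polys m :: 'k::{field,finite} poly set)"
  using card_short_polys by blast

lemma mod_in_short_polys:
  fixes f :: "'a::field poly"
  assumes "f \<noteq> 0"
  shows "p mod f \<in> short_polys (degree f)"
  using degree_mod_less[OF assms, of p] by (auto simp: short_polys_def coeff_eq_0)

lemma short_polys_dvd_diff:
  fixes f :: "'a::field poly"
  assumes "a \<in> short_polys (degree f)" "b \<in> short_polys (degree f)" "f dvd a - b"
  shows "a = b"
proof (rule ccontr)
  assume "a \<noteq> b"
  have "coeff (a - b) i = 0" if "i \<ge> degree f" for i
    using assms(1,2) that by (auto simp: short_polys_def)
  moreover have "degree f \<le> degree (a - b)"
    using assms(3) \<open>a \<noteq> b\<close> by (intro dvd_imp_degree_le) auto
  ultimately have "lead_coeff (a - b) = 0" by blast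
  then show False using \<open>a \<noteq> b\<close> leading_coeff_0_iff[of "a - b"] by simp
qed

text \<open>Fermat's argument in the field of residues modulo \<open>f\<close>: multiplication by
  \<open>p\<close> permutes the nonzero residues \<open>R\<close>, so \<open>p ^ card R\<close>
  leaves their product unchanged.\<close>

lemma finite_field_fermat:
  fixes f :: "'k::{field,finite} poly"
  assumes f: "irreducible f"
  shows "f dvd p ^ (CARD('k) ^ degree f) - p"
proof (cases "f dvd p")
  case True
  then show ?thesis by (intro dvd_diff dvd_power_le) (auto intro: dvd_trans[OF _ dvd_power])
next
  case False
  let ?Q = "CARD('k) ^ degree f"
  define R where "R = short_polys (degree f) - {0 :: 'k poly}"
  have f0: "f \<noteq> 0" using f by auto
  have finR: "finite R" by (simp add: R_def)
  have cardR: "Suc (card R) = ?Q"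
  proof -
    have "card (short_polys (degree f) :: 'k poly set) = Suc (card R)"
      unfolding R_def by (rule card.remove[OF finite_short_polys]) (auto simp: short_polys_def)
    then show ?thesis using card_short_polys[where ?'k = 'k, of "degree f"] by simp
  qed
  have ndvd: "\<not> f dvd r" if "r \<in> R" for r
    using short_polys_dvd_diff[of r f 0] that by (auto simp: R_def short_polys_def)
  have inj: "inj_on (\<lambda>r. (p * r) mod f) R"
  proof (rule inj_onI)
    fix r s assume rs: "r \<in> R" "s \<in> R" "(p * r) mod f = (p * s) mod f"
    then have "f dvd p * (r - s)" by (simp add: mod_eq_dvd_iff right_diff_distrib)
    then have "f dvd r - s" using irreducible_poly_dvd_mult[OF f] False by blast
    then show "r = s" using short_polys_dvd_diff rs by (auto simp: R_def)
  qed
  have "(\<lambda>r. (p * r) mod f) ` R \<subseteq> R"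
  proof clarify
    fix r assume r: "r \<in> R"
    then have "\<not> f dvd p * r" using irreducible_poly_dvd_mult[OF f] False ndvd by blast
    then show "(p * r) mod f \<in> R" by (auto simp: R_def mod_in_short_polys[OF f0] dvd_eq_mod_eq_0)
  qed
  then have img: "(\<lambda>r. (p * r) mod f) ` R = R"
    using inj finR by (simp add: endo_inj_surj)
  have "\<Prod>R mod f = (\<Prod>r\<in>R. (p * r) mod f) mod f"
    using prod.reindex[OF inj, of id] unfolding img by simp
  also have "\<dots> = (p ^ card R * \<Prod>R) mod f"
    by (simp add: mod_prod_eq prod.distrib)
  finally have "f dvd (p ^ card R - 1) * \<Prod>R"
    by (simp add: mod_eq_dvd_iff algebra_simps) (metis dvd_minus_iff minus_diff_eq)
  \<comment> \<open>The product of the nonzero residues can be cancelled; subsets \<open>A\<close>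
    are allowed for the sake of the induction.\<close>
  moreover have "\<not> f dvd prod (\<lambda>r. r) A" if "A \<subseteq> R" for A
    using finite_subset[OF that finR] that
  proof (induction A rule: finite_induct)
    case empty
    then show ?case using f irreducible_not_unit by auto
  next
    case (insert r A)
    then show ?case using irreducible_poly_dvd_mult[OF f] ndvd by auto
  qed
  ultimately have "f dvd p ^ card R - 1"
    using irreducible_poly_dvd_mult[OF f] by blast
  then have "f dvd p * (p ^ card R - 1)" by simp
  then show ?thesis unfolding cardR[symmetric] by (simp add: algebra_simps)
qed

text \<open>Over the field of residues modulo \<open>f\<close>, a polynomial with more roots than
  its degree is zero. Everything is expressed in representatives: roots are divided off by
  \<open>synthetic_div\<close>, and vanishing means divisibility by \<open>f\<close>.\<close>

lemma dvd_coeffs_of_many_roots: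
  fixes f :: "'a::field poly" and P :: "'a poly poly"
  assumes f: "irreducible f"
  shows "\<lbrakk>finite A; degree P < card A; \<And>a. a \<in> A \<Longrightarrow> f dvd poly P a;
    \<And>a b. a \<in> A \<Longrightarrow> b \<in> A \<Longrightarrow> f dvd a - b \<Longrightarrow> a = b\<rbrakk> \<Longrightarrow> f dvd coeff P i"
proof (induction "degree P" arbitrary: P A i)
  case 0
  then obtain c where c: "P = [:c:]" by (metis degree_eq_zeroE)
  obtain a where "a \<in> A" using 0 by fastforce
  then show ?case using 0 c by (cases i) auto
next
  case (Suc n)
  obtain a where a: "a \<in> A" using Suc.prems by fastforce
  define Q where "Q = synthetic_div P a"
  have PQ: "P = [:- a, 1:] * Q + [:poly P a:]" unfolding Q_def by (rule synthetic_div_correct'[symmetric])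
  have Q: "f dvd coeff Q j" for j
  proof (rule Suc.hyps(1)[of Q "A - {a}"])
    show "n = degree Q" using Suc.hyps(2) by (simp add: Q_def degree_synthetic_div)
    then show "degree Q < card (A - {a})" using Suc a by simp
    fix b assume b: "b \<in> A - {a}"
    have "(b - a) * poly Q b = poly P b - poly P a"
      by (subst PQ, subst (2) PQ) (simp add: algebra_simps)
    then have "f dvd (b - a) * poly Q b" using Suc.prems(3) a b by auto
    then show "f dvd poly Q b" using irreducible_poly_dvd_mult[OF f] Suc.prems(4) a b by blast
  qed (use Suc.prems in auto)
  show ?case
    by (subst PQ) (auto simp: coeff_pCons Q Suc.prems(3)[OF a] split: nat.splits)
qed

text \<open>Translation by 1 permutes the field, so it does not change the sum of all
  elements.\<close>

lemma of_nat_card_field: "of_nat CARD('k) = (0 :: 'k::{field,finite})"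
proof -
  have "(\<Sum>x\<in>(UNIV :: 'k set). x) = (\<Sum>x\<in>UNIV. x + 1)"
    by (rule sum.reindex_bij_witness[of _ "\<lambda>x. x + 1" "\<lambda>x. x - 1"]) auto
  also have "\<dots> = (\<Sum>x\<in>(UNIV :: 'k set). x) + of_nat CARD('k)" by (simp add: sum.distrib)
  finally show ?thesis by simp
qed

text \<open>Needed with \<open>h = f\<close>, to see how \<open>F(p)\<close> changes modulo
  \<open>f ^ 2\<close> when \<open>p\<close> is replaced by \<open>p + f\<close>.\<close>

lemma pcompose_taylor:
  fixes F :: "'a::field poly"
  shows "h ^ 2 dvd pcompose F (p + h) - pcompose F p - h * pcompose (pderiv F) p"
proof (induction F)
  case 0
  show ?case by simp
next
  case (pCons a F)
  obtain r where r: "pcompose F (p + h) = pcompose F p + h * pcompose (pderiv F) p + h ^ 2 * r"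
    using pCons.IH unfolding dvd_def by (metis add.commute diff_add_cancel diff_diff_eq)
  have "pcompose (pCons a F) (p + h) - pcompose (pCons a F) p - h * pcompose (pderiv (pCons a F)) p
    = h ^ 2 * (pcompose (pderiv F) p + (p + h) * r)"
    unfolding pcompose_pCons pderiv_pCons r
    by (simp add: pcompose_pCons pcompose_add algebra_simps power2_eq_square)
  then show ?case by simp
qed

text \<open>Both \<open>f\<close> and \<open>F\<close> divide \<open>x\<^sup>Q - x\<close> with \<open>Q = q ^ deg f\<close>, all of whose roots lie in \<open>K[x]/(f)\<close>. As
  its derivative is \<open>-1\<close>, \<open>F\<close> is separable, so \<open>p\<close> or \<open>p + f\<close> is not a root of \<open>F\<close> modulo \<open>f\<^sup>2\<close>.\<close>

lemma simple_root_mod_irreducible: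
  fixes f F :: "'k::{field,finite} poly"
  assumes f: "irreducible f" and F: "irreducible F" and deg: "degree F = degree f"
  shows "\<exists>p. f dvd pcompose F p \<and> \<not> f ^ 2 dvd pcompose F p"
proof -
  let ?Q = "CARD('k) ^ degree f"
  let ?x = "[:0, 1:] :: 'k poly"
  have f0: "f \<noteq> 0" and F0: "F \<noteq> 0" using f F by auto
  have "\<not> is_unit f" using f irreducible_not_unit by blast
  then have d: "degree f > 0" using f0 by (auto simp: is_unit_iff_degree)
  have "CARD('k) \<ge> 2"
    using card_mono[of UNIV "{0, 1 :: 'k}"] by simp
  then have Q2: "?Q > 1" using d by (intro one_less_power) auto
  obtain G where G: "?x ^ ?Q - ?x = F * G"
    using finite_field_fermat[OF F, of ?x] unfolding deg dvd_def by blast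
  have degE: "degree (?x ^ ?Q - ?x) = ?Q"
    unfolding diff_conv_add_uminus using Q2 by (subst degree_add_eq_left) (simp_all add: degree_power_eq)
  then have "?x ^ ?Q - ?x \<noteq> 0" using Q2 by auto
  then have G0: "G \<noteq> 0" using G by auto
  have "degree F + degree G = ?Q" using degE F0 G0 unfolding G by (simp add: degree_mult_eq)
  then have degG: "degree G < ?Q" using d deg by simp
  \<comment> \<open>The cofactor \<open>G\<close> has degree below \<open>?Q\<close>, the number of
    residues, so it cannot vanish at all of them. Where it does not vanish, \<open>F\<close>
    must.\<close>
  have "\<exists>p. \<not> f dvd pcompose G p"
  proof (rule ccontr)
    assume "\<not> ?thesis"
    then have all: "f dvd pcompose G p" for p by blast
    have "f dvd coeff (map_poly (\<lambda>a. [:a:]) G) i" for i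
    proof (rule dvd_coeffs_of_many_roots[OF f, of "short_polys (degree f)"])
      show "degree (map_poly (\<lambda>a. [:a:]) G) < card (short_polys (degree f) :: 'k poly set)"
        using degG by (simp add: card_short_polys degree_map_poly)
      show "f dvd poly (map_poly (\<lambda>a. [:a:]) G) a" for a
        using all[of a] by (simp add: pcompose_altdef)
    qed (auto intro: short_polys_dvd_diff)
    from this[of "degree G"] have "f dvd [:lead_coeff G:]" by (simp add: coeff_map_poly)
    moreover have "[:lead_coeff G:] dvd 1" using G0 by (simp add: is_unit_iff_degree)
    ultimately show False using \<open>\<not> is_unit f\<close> dvd_trans by blast
  qed
  then obtain p where p: "\<not> f dvd pcompose G p" by blast
  have "pcompose (?x ^ ?Q - ?x) p = p ^ ?Q - p"
    by (simp add: pcompose_diff pcompose_hom.hom_power pcompose_pCons)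
  then have "f dvd pcompose F p * pcompose G p"
    using finite_field_fermat[OF f, of p] unfolding G by (simp add: pcompose_mult)
  then have root: "f dvd pcompose F p" using irreducible_poly_dvd_mult[OF f] p by blast
  have "(of_nat ?Q :: 'k) = 0" using d by (simp add: of_nat_card_field)
  then have "(of_nat ?Q :: 'k poly) = 0" by (simp add: of_nat_poly)
  then have "pderiv (?x ^ ?Q - ?x) = - 1"
    by (simp add: pderiv_diff pderiv_power pderiv_pCons of_nat_poly flip: one_pCons)
  \<comment> \<open>The derivative of \<open>F * G\<close> is substituted at \<open>p\<close>.
    Modulo \<open>f\<close> the term containing \<open>F(p)\<close> drops out, so
    \<open>F'(p)\<close> cannot be divisible by \<open>f\<close>.\<close>
  then have "pcompose (pderiv F * G + F * pderiv G) p = - 1"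
    unfolding G pderiv_mult by (simp add: algebra_simps pcompose_hom.hom_uminus)
  then have "pcompose (pderiv F) p * pcompose G p + pcompose F p * pcompose (pderiv G) p = - 1"
    by (simp add: pcompose_add pcompose_mult)
  then have simple: "\<not> f dvd pcompose (pderiv F) p"
    using root \<open>\<not> is_unit f\<close> by (metis dvd_add dvd_minus_iff dvd_mult2)
  show ?thesis
  proof (cases "f ^ 2 dvd pcompose F p")
    case False
    then show ?thesis using root by blast
  next
    case True
    \<comment> \<open>Modulo \<open>f ^ 2\<close>, passing from \<open>p\<close> to
      \<open>p + f\<close> adds \<open>f F'(p)\<close>, which is nonzero there because
      \<open>p\<close> is a simple root modulo \<open>f\<close>.\<close>
    have t: "f ^ 2 dvd pcompose F (p + f) - pcompose F p - f * pcompose (pderiv F) p"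
      by (rule pcompose_taylor)
    have "\<not> f ^ 2 dvd pcompose F (p + f)"
    proof
      assume "f ^ 2 dvd pcompose F (p + f)"
      then have "f ^ 2 dvd (pcompose F (p + f) - pcompose F p)
          - (pcompose F (p + f) - pcompose F p - f * pcompose (pderiv F) p)"
        by (rule dvd_diff[OF dvd_diff[OF _ True] t])
      then have "f * f dvd f * pcompose (pderiv F) p" by (simp add: power2_eq_square)
      then show False using simple f0 by simp
    qed
    moreover have "f dvd pcompose F (p + f)"
    proof -
      have "f dvd (pcompose F (p + f) - pcompose F p - f * pcompose (pderiv F) p)
          + (pcompose F p + f * pcompose (pderiv F) p)"
        using root t by (intro dvd_add) (auto intro: dvd_trans[of f "f ^ 2"] simp: power2_eq_square)
      then show ?thesis by simp
    qed
    ultimately show ?thesis by blast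
  qed
qed

section \<open>Primary modules\<close>

text \<open>A module on a subset of a type, so that submodules are instances again and induction can
  pass from \<open>U\<close> to \<open>f U\<close>. Negatives come from the action of -1.\<close>

locale ring_action =
  fixes V :: "'v::ab_group_add set" and act :: "'r::comm_ring_1 \<Rightarrow> 'v \<Rightarrow> 'v" (infixr \<open>\<star>\<close> 75)
  assumes zero_closed: "0 \<in> V"
    and add_closed: "v \<in> V \<Longrightarrow> w \<in> V \<Longrightarrow> v + w \<in> V"
    and act_closed: "v \<in> V \<Longrightarrow> a \<star> v \<in> V"
    and act_add: "v \<in> V \<Longrightarrow> w \<in> V \<Longrightarrow> a \<star> (v + w) = a \<star> v + a \<star> w"
    and add_act: "v \<in> V \<Longrightarrow> (a + b) \<star> v = a \<star> v + b \<star> v"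
    and mult_act: "v \<in> V \<Longrightarrow> (a * b) \<star> v = a \<star> b \<star> v"
    and one_act: "v \<in> V \<Longrightarrow> 1 \<star> v = v"
begin

lemma zero_act [simp]: "v \<in> V \<Longrightarrow> 0 \<star> v = 0"
  using add_act[of v 0 0] by simp

lemma act_zero [simp]: "a \<star> 0 = 0"
  using act_add[OF zero_closed zero_closed, of a] by simp

lemma minus_act: "v \<in> V \<Longrightarrow> (- a) \<star> v = - (a \<star> v)"
  using add_act[of v "- a" a] by (simp add: eq_neg_iff_add_eq_0)

lemma uminus_closed: "v \<in> V \<Longrightarrow> - v \<in> V"
  using act_closed[of v "- 1"] by (simp add: minus_act one_act)

lemma diff_closed: "v \<in> V \<Longrightarrow> w \<in> V \<Longrightarrow> v - w \<in> V"
  using add_closed[of v "- w"] uminus_closed by simp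

lemma act_minus: "v \<in> V \<Longrightarrow> a \<star> (- v) = - (a \<star> v)"
  using act_add[of "- v" v a] uminus_closed by (simp add: eq_neg_iff_add_eq_0)

lemma act_diff: "v \<in> V \<Longrightarrow> w \<in> V \<Longrightarrow> a \<star> (v - w) = a \<star> v - a \<star> w"
  using act_add[of v "- w" a] uminus_closed act_minus by simp

lemma diff_act: "v \<in> V \<Longrightarrow> (a - b) \<star> v = a \<star> v - b \<star> v"
  using add_act[of v a "- b"] minus_act by simp

lemma sum_closed: "(\<And>j. j \<in> J \<Longrightarrow> u j \<in> V) \<Longrightarrow> sum u J \<in> V"
  by (induction J rule: infinite_finite_induct) (auto simp: zero_closed add_closed)

lemma act_sum: "(\<And>j. j \<in> J \<Longrightarrow> u j \<in> V) \<Longrightarrow> a \<star> sum u J = (\<Sum>j\<in>J. a \<star> u j)"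
  by (induction J rule: infinite_finite_induct) (auto simp: act_add sum_closed)

definition submod :: "'v set \<Rightarrow> bool" where
  "submod U \<longleftrightarrow> U \<subseteq> V \<and> 0 \<in> U \<and> (\<forall>v\<in>U. \<forall>w\<in>U. v + w \<in> U) \<and> (\<forall>a. \<forall>v\<in>U. a \<star> v \<in> U)"

lemma submod_action: "submod U \<Longrightarrow> ring_action U (\<star>)"
  by unfold_locales (auto simp: submod_def act_add add_act mult_act one_act subset_eq)

text \<open>Says that \<open>U\<close> is the direct sum of the cyclic modules
  \<open>R/(f ^ l j)\<close> generated by the \<open>u j\<close>: the map from \<open>R^t\<close> to
  \<open>U\<close> is onto, and the last clause gives its exact kernel, hence directness and all
  annihilators at once.\<close>

definition cyclic_decomposition :: "'r \<Rightarrow> 'v set \<Rightarrow> nat \<Rightarrow> (nat \<Rightarrow> 'v) \<Rightarrow> (nat \<Rightarrow> nat) \<Rightarrow> bool" where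
  "cyclic_decomposition f U t u l \<longleftrightarrow> (\<forall>j<t. u j \<in> U \<and> 0 < l j)
    \<and> (\<forall>x\<in>U. \<exists>a. x = (\<Sum>j<t. a j \<star> u j))
    \<and> (\<forall>a. (\<Sum>j<t. a j \<star> u j) = 0 \<longleftrightarrow> (\<forall>j<t. f ^ l j dvd a j))"

end

text \<open>The assumptions on \<open>f\<close> say that it is a nonzero element generating a
  maximal ideal: nonzero so that powers of \<open>f\<close> cancel, maximal so that the socle is a
  vector space over \<open>R/(f)\<close>.\<close>

locale primary_action = ring_action V act
  for V :: "'v::ab_group_add set" and act :: "'r::idom \<Rightarrow> 'v \<Rightarrow> 'v" (infixr \<open>\<star>\<close> 75) +
  fixes f :: 'r
  assumes f_nonzero: "f \<noteq> 0" and f_nonunit: "\<not> f dvd 1"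
    and f_maximal: "\<not> f dvd a \<Longrightarrow> \<exists>b. f dvd a * b - 1"
begin

text \<open>On vectors killed by \<open>f\<close> this is linear independence over
  \<open>R/(f)\<close>, with coefficients in \<open>R\<close> that matter only modulo
  \<open>f\<close>.\<close>

definition socle_independent :: "nat \<Rightarrow> (nat \<Rightarrow> 'v) \<Rightarrow> bool" where
  "socle_independent t e \<longleftrightarrow> (\<forall>a. (\<Sum>j<t. a j \<star> e j) = 0 \<longrightarrow> (\<forall>j<t. f dvd a j))"

lemma socle_independent_inj:
  assumes e: "\<And>j. j < t \<Longrightarrow> e j \<in> V" and ind: "socle_independent t e"
  shows "inj_on e {..<t}"
proof (rule inj_onI, rule ccontr)
  fix i j assume ij: "i \<in> {..<t}" "j \<in> {..<t}" "e i = e j" "i \<noteq> j"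
  define a where "a = (\<lambda>k. if k = i then 1 else if k = j then - 1 else (0 :: 'r))"
  have "(\<Sum>k<t. a k \<star> e k) = (\<Sum>k\<in>{i, j}. a k \<star> e k)"
    by (rule sum.mono_neutral_right) (use ij e in \<open>auto simp: a_def\<close>)
  also have "\<dots> = 0" using ij e by (simp add: a_def minus_act one_act)
  finally have "f dvd a i" using ind ij(1) unfolding socle_independent_def by blast
  then show False using f_nonunit by (simp add: a_def)
qed

text \<open>Basis extension over \<open>R/(f)\<close>. Independent vectors are distinct, so there
  are at most \<open>card U\<close> of them and the process stops.\<close>

lemma extend_socle_basis:
  assumes sub: "submod U" and fin: "finite U" and soc: "\<And>x. x \<in> U \<Longrightarrow> f \<star> x = 0"
  shows "\<lbrakk>\<And>j. j < t \<Longrightarrow> e j \<in> U; socle_independent t e\<rbrakk> \<Longrightarrow>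
    \<exists>s e'. t \<le> s \<and> (\<forall>j<t. e' j = e j) \<and> (\<forall>j<s. e' j \<in> U) \<and> socle_independent s e' \<and>
      (\<forall>x\<in>U. \<exists>a. x = (\<Sum>j<s. a j \<star> e' j))"
proof (induction "card U - t" arbitrary: t e rule: less_induct)
  case less
  have UV: "U \<subseteq> V" using sub by (simp add: submod_def)
  have eV: "e j \<in> V" if "j < t" for j using less.prems(1) UV that by blast
  show ?case
  proof (cases "\<forall>x\<in>U. \<exists>a. x = (\<Sum>j<t. a j \<star> e j)")
    case True
    then show ?thesis using less.prems by blast
  next
    case False
    then obtain x where x: "x \<in> U" and nx: "\<And>a. x \<noteq> (\<Sum>j<t. a j \<star> e j)" by blast
    define e' where "e' = e(t := x)"
    have e'U: "e' j \<in> U" if "j < Suc t" for j using that x less.prems(1) by (auto simp: e'_def)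
    have xV: "x \<in> V" using x UV by blast
    have ind: "socle_independent (Suc t) e'"
      unfolding socle_independent_def
    proof (intro allI impI)
      fix a j assume "(\<Sum>j<Suc t. a j \<star> e' j) = 0" and j: "j < Suc t"
      then have 0: "(\<Sum>j<t. a j \<star> e j) + a t \<star> x = 0" by (simp add: e'_def)
      \<comment> \<open>Otherwise \<open>a t\<close> is invertible modulo \<open>f\<close>, and the
        relation expresses \<open>x\<close> by the vectors of \<open>e\<close>.\<close>
      have "f dvd a t"
      proof (rule ccontr)
        assume "\<not> f dvd a t"
        then obtain b c where bc: "a t * b - 1 = f * c" using f_maximal unfolding dvd_def by blast
        have "(c * f) \<star> x = 0" using soc[OF x] xV by (simp add: mult_act)
        then have "(b * a t - 1) \<star> x = 0" using bc by (simp add: mult.commute)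
        then have "x = b \<star> a t \<star> x" using xV by (simp add: diff_act one_act mult_act)
        also have "a t \<star> x = - (\<Sum>j<t. a j \<star> e j)"
          using 0 by (simp add: eq_neg_iff_add_eq_0 add.commute)
        also have "b \<star> (- (\<Sum>j<t. a j \<star> e j)) = - (\<Sum>j<t. b \<star> a j \<star> e j)"
          using eV by (subst act_minus) (auto intro!: sum_closed act_closed act_sum)
        also have "\<dots> = (\<Sum>j<t. (- (b * a j)) \<star> e j)"
          using eV by (simp add: minus_act mult_act sum_negf)
        finally show False using nx[of "\<lambda>j. - (b * a j)"] by simp
      qed
      moreover from this have "a t \<star> x = 0"
        using soc[OF x] xV by (auto elim!: dvdE simp: mult.commute[of f] mult_act)
      ultimately show "f dvd a j"
        using 0 less.prems(2) j unfolding socle_independent_def by (auto simp: less_Suc_eq)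
    qed
    have "card (e' ` {..<Suc t}) = Suc t"
      using socle_independent_inj[OF _ ind] e'U UV by (subst card_image) auto
    moreover have "card (e' ` {..<Suc t}) \<le> card U"
      using e'U by (intro card_mono[OF fin]) auto
    ultimately have "card U - Suc t < card U - t" by simp
    from less.hyps[OF this e'U ind] obtain s e'' where
      s: "Suc t \<le> s" "\<forall>j<Suc t. e'' j = e' j" "\<forall>j<s. e'' j \<in> U" "socle_independent s e''"
        "\<forall>x\<in>U. \<exists>a. x = (\<Sum>j<s. a j \<star> e'' j)" by blast
    then show ?thesis
      by (intro exI[of _ s] exI[of _ e'']) (auto simp: e'_def)
  qed
qed

text \<open>Decompose \<open>f U\<close>, divide its generators by \<open>f\<close>, and complete their multiples in the socle
  (the kernel of \<open>f\<close>) to a basis of the socle over the field \<open>R/(f)\<close>.\<close>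

theorem cyclic_decomposition_exists:
  "\<lbrakk>submod U; finite U; \<And>x. x \<in> U \<Longrightarrow> f ^ N \<star> x = 0\<rbrakk> \<Longrightarrow> \<exists>t u l. cyclic_decomposition f U t u l"
proof (induction N arbitrary: U)
  case 0
  then have "x = 0" if "x \<in> U" for x using that one_act[of x] by (auto simp: submod_def)
  then have "U = {0}" using 0 by (auto simp: submod_def)
  then have "cyclic_decomposition f U 0 (\<lambda>_. 0) (\<lambda>_. 0)" by (simp add: cyclic_decomposition_def)
  then show ?case by blast
next
  case (Suc N)
  have UV: "U \<subseteq> V" using Suc.prems by (simp add: submod_def)
  interpret U: ring_action U act by (rule submod_action[OF Suc.prems(1)])
  let ?W = "(\<lambda>x. f \<star> x) ` U"
  have "submod ?W"
    unfolding submod_def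
  proof (intro conjI ballI allI)
    show "?W \<subseteq> V" using UV act_closed by auto
    show "0 \<in> ?W" using U.zero_closed U.act_zero[of f] by (metis image_eqI)
    fix v assume "v \<in> ?W"
    then obtain x where x: "x \<in> U" "v = f \<star> x" by blast
    show "a \<star> v \<in> ?W" for a
      using x U.act_closed[of x a] UV by (auto intro!: image_eqI[of _ _ "a \<star> x"] simp: mult.commute subset_eq simp flip: mult_act)
    fix w assume "w \<in> ?W"
    then obtain y where y: "y \<in> U" "w = f \<star> y" by blast
    show "v + w \<in> ?W"
      using x y U.add_closed UV by (auto intro!: image_eqI[of _ _ "x + y"] simp: U.act_add)
  qed
  moreover have "finite ?W" using Suc.prems by simp
  moreover have "f ^ N \<star> x = 0" if "x \<in> ?W" for x
    using that Suc.prems(3) by (auto simp: power_commutes simp flip: U.mult_act)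
  ultimately obtain t w m where W: "cyclic_decomposition f ?W t w m" using Suc.IH by blast
  have w_W: "w j \<in> ?W" and m_pos: "0 < m j" if "j < t" for j
    using W that unfolding cyclic_decomposition_def by simp_all
  have "\<forall>j\<in>{..<t}. \<exists>x. x \<in> U \<and> w j = f \<star> x" using w_W by auto
  from bchoice[OF this] obtain u where u: "\<And>j. j < t \<Longrightarrow> u j \<in> U \<and> w j = f \<star> u j" by auto
  have span_W: "\<exists>a. x = (\<Sum>j<t. a j \<star> w j)" if "x \<in> ?W" for x
    using W that unfolding cyclic_decomposition_def by auto
  have rel_W: "(\<Sum>j<t. a j \<star> w j) = 0 \<longleftrightarrow> (\<forall>j<t. f ^ m j dvd a j)" for a
    using W unfolding cyclic_decomposition_def by simp
  have ann: "f ^ Suc (m j) \<star> u j = 0" if "j < t" for j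
  proof -
    \<comment> \<open>Coefficients concentrated at \<open>j\<close> extract from
      \<open>rel_W\<close> that \<open>f ^ m j\<close> kills \<open>w j\<close>.\<close>
    define a where "a = (\<lambda>i. if i = j then f ^ m j else 0)"
    have wV: "w i \<in> U" if "i < t" for i using u[OF that] U.act_closed by auto
    have "(\<Sum>i<t. a i \<star> w i) = 0" unfolding rel_W by (simp add: a_def)
    moreover have "(\<Sum>i<t. a i \<star> w i) = (\<Sum>i\<in>{j}. a i \<star> w i)"
      by (rule sum.mono_neutral_right) (use that wV in \<open>auto simp: a_def\<close>)
    ultimately have "f ^ m j \<star> f \<star> u j = 0" using u that by (simp add: a_def)
    then show ?thesis using u that by (simp add: power_commutes flip: U.mult_act)
  qed
  define soc where "soc = {x \<in> U. f \<star> x = 0}"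
  have soc_sub: "submod soc"
    using UV U.zero_closed U.add_closed U.act_closed
    by (auto simp: submod_def soc_def U.act_add U.mult_act[symmetric] mult.commute[of f])
      (simp add: U.mult_act)
  define e where "e = (\<lambda>j. f ^ m j \<star> u j)"
  have e: "e j \<in> soc" if "j < t" for j
    using u that ann by (auto simp: e_def soc_def U.act_closed simp flip: U.mult_act)
  have ind: "socle_independent t e"
    unfolding socle_independent_def
  proof (intro allI impI)
    fix a j assume 0: "(\<Sum>j<t. a j \<star> e j) = 0" and j: "j < t"
    \<comment> \<open>One factor \<open>f\<close> of \<open>f ^ m j\<close>, available since
      \<open>m j > 0\<close>, turns \<open>u j\<close> into \<open>w j\<close>; so a relation
      between the \<open>e j\<close> is a relation in \<open>f U\<close>.\<close>
    have "(\<Sum>j<t. (a j * f ^ (m j - 1)) \<star> w j) = (\<Sum>j<t. a j \<star> e j)"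
    proof (rule sum.cong[OF refl])
      fix i assume "i \<in> {..<t}"
      then have i: "i < t" by simp
      have "f ^ m i = f ^ (m i - 1) * f"
        using m_pos[OF i] by (metis Suc_pred power_Suc2 diff_Suc_1)
      then show "(a i * f ^ (m i - 1)) \<star> w i = a i \<star> e i"
        using u[OF i] by (simp add: e_def mult.assoc flip: U.mult_act)
    qed
    then have "f ^ m j dvd a j * f ^ (m j - 1)" using 0 rel_W j by simp
    moreover have "f ^ m j = f * f ^ (m j - 1)"
      using m_pos[OF j] by (metis Suc_pred power_Suc diff_Suc_1)
    ultimately show "f dvd a j" using f_nonzero by simp
  qed
  have fin_soc: "finite soc" using Suc.prems(2) by (simp add: soc_def)
  have f_soc: "f \<star> x = 0" if "x \<in> soc" for x using that by (simp add: soc_def)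
  obtain s e' where s: "t \<le> s" and ee: "\<forall>j<t. e' j = e j" "\<forall>j<s. e' j \<in> soc"
    and e'_ind: "socle_independent s e'" and span: "\<forall>x\<in>soc. \<exists>a. x = (\<Sum>j<s. a j \<star> e' j)"
    using extend_socle_basis[OF soc_sub fin_soc f_soc e ind] by blast
  have e'e: "e' j = e j" if "j < t" for j using ee that by blast
  have e'_soc: "e' j \<in> soc" if "j < s" for j using ee that by blast
  have e'_span: "\<exists>a. x = (\<Sum>j<s. a j \<star> e' j)" if "x \<in> soc" for x using span that by blast
  have e'U: "e' j \<in> U" and fe': "f \<star> e' j = 0" if "j < s" for j
    using e'_soc[OF that] by (auto simp: soc_def)
  \<comment> \<open>The lifted generators gain one power of \<open>f\<close>; the socle vectors that
    complete the basis are new summands with exponent 1.\<close>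
  define u' where "u' = (\<lambda>j. if j < t then u j else e' j)"
  define l where "l = (\<lambda>j. if j < t then Suc (m j) else 1)"
  have u'U: "u' j \<in> U" if "j < s" for j using u e'U that by (simp add: u'_def)
  have split_sum: "(\<Sum>j<s. g j) = (\<Sum>j<t. g j) + (\<Sum>j\<in>{t..<s}. g j)" for g :: "nat \<Rightarrow> 'v"
    using s by (subst sum.union_disjoint[symmetric]) (auto intro: sum.cong)
  have ann': "f ^ l j \<star> u' j = 0" if "j < s" for j
    using ann fe' that by (auto simp: l_def u'_def)
  have "\<exists>c. x = (\<Sum>j<s. c j \<star> u' j)" if x: "x \<in> U" for x
  proof -
    \<comment> \<open>Lifting an expression for \<open>f \<star> x\<close> produces
      \<open>?y\<close> with \<open>f \<star> ?y = f \<star> x\<close>, so \<open>x - ?y\<close>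
      lies in the socle and is spanned by the \<open>e' j\<close>.\<close>
    obtain a where a: "f \<star> x = (\<Sum>j<t. a j \<star> w j)" using span_W[of "f \<star> x"] x by blast
    let ?y = "\<Sum>j<t. a j \<star> u j"
    have yU: "?y \<in> U" using u by (intro U.sum_closed U.act_closed) auto
    have "f \<star> ?y = (\<Sum>j<t. f \<star> a j \<star> u j)" using u by (intro U.act_sum U.act_closed) auto
    also have "\<dots> = (\<Sum>j<t. a j \<star> w j)"
      using u by (intro sum.cong) (auto simp: mult.commute simp flip: U.mult_act)
    finally have "x - ?y \<in> soc" using x yU a by (simp add: soc_def U.diff_closed U.act_diff)
    then obtain b where b: "x - ?y = (\<Sum>j<s. b j \<star> e' j)" using e'_span by blast
    \<comment> \<open>The extra term appears because \<open>e' j\<close> is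
      \<open>f ^ m j \<star> u j\<close> for \<open>j < t\<close>.\<close>
    define c where "c = (\<lambda>j. if j < t then a j + b j * f ^ m j else b j)"
    have "(\<Sum>j<s. c j \<star> u' j)
        = (\<Sum>j<t. a j \<star> u j + b j \<star> e' j) + (\<Sum>j\<in>{t..<s}. b j \<star> e' j)"
      unfolding split_sum
      using u by (intro arg_cong2[where f = "(+)"] sum.cong)
        (auto simp: c_def u'_def e'e e_def U.add_act U.mult_act)
    also have "\<dots> = ?y + (x - ?y)" unfolding b split_sum by (simp add: sum.distrib add.assoc)
    finally show ?thesis by (metis add.commute diff_add_cancel)
  qed
  moreover have "(\<Sum>j<s. a j \<star> u' j) = 0 \<longleftrightarrow> (\<forall>j<s. f ^ l j dvd a j)" for a
  proof
    assume "\<forall>j<s. f ^ l j dvd a j"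
    then have "a j \<star> u' j = 0" if "j < s" for j
      using ann'[OF that] u'U[OF that] that by (auto elim!: allE[of _ j] dvdE simp: mult.commute[of "f ^ _"] U.mult_act)
    then show "(\<Sum>j<s. a j \<star> u' j) = 0" by simp
  next
    assume 0: "(\<Sum>j<s. a j \<star> u' j) = 0"
    \<comment> \<open>Multiplying by \<open>f\<close> removes the socle summands and leaves a
      relation in \<open>f U\<close>, which gives \<open>f ^ m j\<close> dividing
      \<open>a j\<close>. The quotients then form a relation between the \<open>e' j\<close>, which
      supplies the missing factor \<open>f\<close>.\<close>
    have "f \<star> (\<Sum>j<s. a j \<star> u' j) = (\<Sum>j<s. f \<star> a j \<star> u' j)"
      using u'U by (intro U.act_sum U.act_closed) auto
    also have "\<dots> = (\<Sum>j<t. a j \<star> w j) + (\<Sum>j\<in>{t..<s}. 0)"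
      unfolding split_sum
    proof (intro arg_cong2[where f = "(+)"] sum.cong refl)
      fix j assume "j \<in> {..<t}"
      then show "f \<star> a j \<star> u' j = a j \<star> w j"
        using u by (auto simp: u'_def mult.commute simp flip: U.mult_act)
    next
      fix j assume j: "j \<in> {t..<s}"
      then have "f \<star> a j \<star> e' j = a j \<star> f \<star> e' j"
        using e'U by (simp add: mult.commute flip: U.mult_act)
      then show "f \<star> a j \<star> u' j = 0" using j fe' by (simp add: u'_def)
    qed
    finally have "\<forall>j<t. f ^ m j dvd a j" using 0 rel_W by simp
    then obtain a'' where a'': "\<And>j. j < t \<Longrightarrow> a j = f ^ m j * a'' j" unfolding dvd_def by metis
    define a' where "a' = (\<lambda>j. if j < t then a'' j else a j)"
    have "(\<Sum>j<s. a' j \<star> e' j) = (\<Sum>j<s. a j \<star> u' j)"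
    proof (rule sum.cong[OF refl])
      fix j assume "j \<in> {..<s}"
      then show "a' j \<star> e' j = a j \<star> u' j"
        using u by (cases "j < t") (auto simp: a'_def u'_def e'e e_def a'' mult.commute simp flip: U.mult_act)
    qed
    then have dvd: "\<forall>j<s. f dvd a' j" using 0 e'_ind unfolding socle_independent_def by simp
    show "\<forall>j<s. f ^ l j dvd a j"
    proof (intro allI impI)
      fix j assume "j < s"
      then show "f ^ l j dvd a j"
        using dvd by (cases "j < t") (auto simp: l_def a'_def a'' mult.commute[of f] intro!: mult_dvd_mono dest!: spec[of _ j])
    qed
  qed
  ultimately have "cyclic_decomposition f U s u' l"
    unfolding cyclic_decomposition_def using u'U by (auto simp: l_def)
  then show ?case by blast
qed

end

section \<open>Kernel cardinalities of primary modules\<close>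

definition residue :: "'a::comm_ring_1 \<Rightarrow> 'a \<Rightarrow> 'a set" where
  "residue g a = {x. g dvd x - a}"

lemma residue_eq_iff: "residue g a = residue g b \<longleftrightarrow> g dvd a - b"
proof
  assume "residue g a = residue g b"
  then have "a \<in> residue g b" unfolding residue_def by (metis diff_self dvd_0_right mem_Collect_eq)
  then show "g dvd a - b" by (simp add: residue_def)
next
  assume *: "g dvd a - b"
  have "g dvd x - a \<longleftrightarrow> g dvd x - b" for x
    using dvd_add_left_iff[OF *, of "x - a"] by simp
  then show "residue g a = residue g b" by (simp add: residue_def)
qed

lemma cgenideal_rcoset: "cgenideal class_ring g +>\<^bsub>class_ring\<^esub> a = residue g (a :: 'a::comm_ring_1)"
proof -
  have "x \<in> cgenideal class_ring g +>\<^bsub>class_ring\<^esub> a \<longleftrightarrow> g dvd x - a" for x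
  proof
    assume "g dvd x - a"
    then obtain k where "x - a = g * k" unfolding dvd_def by blast
    then have "x = k * g + a" by (simp add: algebra_simps)
    then show "x \<in> cgenideal class_ring g +>\<^bsub>class_ring\<^esub> a"
      by (auto simp: a_r_coset_def' cgenideal_def)
  qed (auto simp: a_r_coset_def' cgenideal_def)
  then show ?thesis by (auto simp: residue_def)
qed

lemma cgenideal_class_ring: "ideal (cgenideal class_ring g) (class_ring :: 'a::comm_ring_1 ring)"
  using cring.cgenideal_ideal[OF class_cring.cring_axioms, of g] by simp

lemma cyclic_module_simps:
  fixes g :: "'a::comm_ring_1"
  shows "carrier (cyclic_module class_ring g) = range (residue g)"
    and "\<zero>\<^bsub>cyclic_module class_ring g\<^esub> = residue g 0"
    and "residue g a \<oplus>\<^bsub>cyclic_module class_ring g\<^esub> residue g b = residue g (a + b)"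
    and "p \<odot>\<^bsub>cyclic_module class_ring g\<^esub> residue g a = residue g (p * a)"
proof -
  interpret I: ideal "cgenideal class_ring g" "class_ring :: 'a ring" by (rule cgenideal_class_ring)
  show "carrier (cyclic_module class_ring g) = range (residue g)"
    by (auto simp: cyclic_module_def Let_def FactRing_def A_RCOSETS_def' cgenideal_rcoset)
  show "\<zero>\<^bsub>cyclic_module class_ring g\<^esub> = residue g 0"
    by (auto simp: cyclic_module_def Let_def FactRing_def cgenideal_def residue_def mult.commute elim!: dvdE)
  show "residue g a \<oplus>\<^bsub>cyclic_module class_ring g\<^esub> residue g b = residue g (a + b)"
    using I.a_rcos_sum[of a b] by (simp add: cyclic_module_def Let_def FactRing_def cgenideal_rcoset)
  show "p \<odot>\<^bsub>cyclic_module class_ring g\<^esub> residue g a = residue g (p * a)"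
    using I.rcoset_mult_add[of p a] by (simp add: cyclic_module_def Let_def FactRing_def cgenideal_rcoset)
qed

text \<open>With \<open>m = min l k\<close>, the part of \<open>R/(f ^ l)\<close> killed by
  \<open>f ^ k\<close> consists of the multiples of \<open>f ^ (l - m)\<close>. It is a copy of
  \<open>R/(f ^ m)\<close>, counted by remainders of degree below
  \<open>degree f * m\<close>.\<close>

lemma card_cyclic_module_torsion:
  fixes f :: "'k::{field,finite} poly"
  assumes "f \<noteq> 0"
  shows "card {C \<in> carrier (cyclic_module class_ring (f ^ l)).
      f ^ k \<odot>\<^bsub>cyclic_module class_ring (f ^ l)\<^esub> C = \<zero>\<^bsub>cyclic_module class_ring (f ^ l)\<^esub>}
    = CARD('k) ^ (degree f * min l k)" (is "card ?T = _")
proof -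
  define m where "m = min l k"
  have split_l: "f ^ l = f ^ (l - m) * f ^ m" and split_k: "f ^ k = f ^ (k - m) * f ^ m"
    by (simp_all add: m_def flip: power_add)
  have deg: "degree (f ^ m) = degree f * m" using assms by (simp add: degree_power_eq)
  have dvd_iff: "f ^ l dvd f ^ (l - m) * c \<longleftrightarrow> f ^ m dvd c" for c
    using assms by (simp add: split_l)
  have "bij_betw (\<lambda>b. residue (f ^ l) (f ^ (l - m) * b)) (short_polys (degree f * m)) ?T"
    unfolding bij_betw_def
  proof
    show "inj_on (\<lambda>b. residue (f ^ l) (f ^ (l - m) * b)) (short_polys (degree f * m))"
      by (auto intro!: inj_onI short_polys_dvd_diff[of _ "f ^ m"]
        simp: residue_eq_iff deg dvd_iff simp flip: right_diff_distrib)
    show "(\<lambda>b. residue (f ^ l) (f ^ (l - m) * b)) ` short_polys (degree f * m) = ?T"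
    proof (intro equalityI subsetI)
      fix C assume "C \<in> (\<lambda>b. residue (f ^ l) (f ^ (l - m) * b)) ` short_polys (degree f * m)"
      then obtain b where C: "C = residue (f ^ l) (f ^ (l - m) * b)" by blast
      have "f ^ k * (f ^ (l - m) * b) = f ^ l * (f ^ (k - m) * b)"
        unfolding split_k split_l by (simp only: mult_ac)
      then have "f ^ l dvd f ^ k * (f ^ (l - m) * b)" by (simp only: dvd_triv_left)
      then show "C \<in> ?T" by (simp only: C cyclic_module_simps residue_eq_iff mem_Collect_eq rangeI diff_zero)
    next
      fix C assume "C \<in> ?T"
      then obtain a where C: "C = residue (f ^ l) a" by (auto simp: cyclic_module_simps)
      have a: "f ^ l dvd f ^ k * a"
        using \<open>C \<in> ?T\<close> by (simp add: C cyclic_module_simps residue_eq_iff)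
      have "f ^ (l - m) dvd a"
      proof (cases "l \<le> k")
        case False
        then have "f ^ l = f ^ k * f ^ (l - m)" by (simp add: m_def flip: power_add)
        then show ?thesis using a assms by simp
      qed (simp add: m_def)
      then obtain c where c: "a = f ^ (l - m) * c" unfolding dvd_def by blast
      have "C = residue (f ^ l) (f ^ (l - m) * (c mod f ^ m))"
        unfolding C c residue_eq_iff right_diff_distrib[symmetric] dvd_iff
        by (simp add: minus_mod_eq_mult_div)
      moreover have "c mod f ^ m \<in> short_polys (degree f * m)"
        using mod_in_short_polys[of "f ^ m" c] assms deg by simp
      ultimately show "C \<in> (\<lambda>b. residue (f ^ l) (f ^ (l - m) * b)) ` short_polys (degree f * m)"
        by blast
    qed
  qed
  then show ?thesis
    using card_short_polys[where ?'k = 'k, of "degree f * m"] by (simp add: m_def flip: bij_betw_same_card)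
qed

text \<open>The sum of the first \<open>k\<close> parts of the conjugate partition;
  \<open>degree f\<close> times this is the dimension of the kernel of
  \<open>f(M) ^ k\<close>.\<close>

definition truncated_size :: "nat list \<Rightarrow> nat \<Rightarrow> nat" where
  "truncated_size l k = (\<Sum>x\<leftarrow>l. min x k)"

lemma primary_submodule_simps:
  "M \<in> carrier_mat n n \<Longrightarrow> carrier (primary_submodule M f) = (\<Union>k. poly_kernel M (f ^ k))"
  "v \<oplus>\<^bsub>primary_submodule M f\<^esub> w = v + w"
  "p \<odot>\<^bsub>primary_submodule M f\<^esub> v = poly_mat p M *\<^sub>v v"
  by (auto simp: primary_submodule_def matrix_module_def poly_kernel_def)

lemma direct_sum_over_simps:
  "carrier (direct_sum_over J N) = (\<Pi>\<^sub>E j\<in>J. carrier (N j))"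
  "\<zero>\<^bsub>direct_sum_over J N\<^esub> = (\<lambda>j\<in>J. \<zero>\<^bsub>N j\<^esub>)"
  "u \<oplus>\<^bsub>direct_sum_over J N\<^esub> v = (\<lambda>j\<in>J. u j \<oplus>\<^bsub>N j\<^esub> v j)"
  "p \<odot>\<^bsub>direct_sum_over J N\<^esub> v = (\<lambda>j\<in>J. p \<odot>\<^bsub>N j\<^esub> v j)"
  by (auto simp: direct_sum_over_def)

lemma finite_carrier_vec: "finite (carrier_vec n :: 'k::finite vec set)"
proof -
  have "carrier_vec n \<subseteq> vec_of_list ` {xs :: 'k list. set xs \<subseteq> UNIV \<and> length xs = n}"
  proof
    fix v :: "'k vec" assume "v \<in> carrier_vec n"
    then show "v \<in> vec_of_list ` {xs. set xs \<subseteq> UNIV \<and> length xs = n}"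
      by (intro image_eqI[of _ _ "list_of_vec v"]) (auto simp: vec_list)
  qed
  then show ?thesis by (rule finite_subset) (intro finite_imageI finite_lists_length_eq finite)
qed

lemma finite_poly_kernel [simp]: "finite (poly_kernel M p :: 'k::{field,finite} vec set)"
  by (rule finite_subset[OF _ finite_carrier_vec[of "dim_row M"]]) (auto simp: poly_kernel_def)

lemma poly_mat_act_poly_kernel:
  assumes "M \<in> carrier_mat n n" "v \<in> poly_kernel M p"
  shows "poly_mat q M *\<^sub>v v \<in> poly_kernel M p"
proof -
  have v: "v \<in> carrier_vec n" using assms by (auto simp: poly_kernel_def)
  have "poly_mat p M *\<^sub>v (poly_mat q M *\<^sub>v v) = poly_mat (q * p) M *\<^sub>v v"
    unfolding mult.commute[of q] by (rule poly_mat_mult_vec[OF assms(1) v, symmetric])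
  then show ?thesis
    using poly_kernel_mult_right[OF assms, of q] mult_mat_vec_carrier[OF poly_mat_carrier[OF assms(1)] v]
      v assms(1) by (simp add: poly_kernel_def)
qed

text \<open>An isomorphism matches the vectors killed by \<open>f ^ k\<close> on both sides, and in
  a direct sum these form the product over the summands.\<close>

theorem card_poly_kernel_of_primary_partition:
  fixes M :: "'k::{field,finite} mat"
  assumes M: "M \<in> carrier_mat n n" and f: "f \<noteq> 0" and l: "primary_partition M f l"
  shows "card (poly_kernel M (f ^ k)) = CARD('k) ^ (degree f * truncated_size l k)"
proof -
  let ?P = "primary_submodule M f"
  let ?c = "\<lambda>j. cyclic_module class_ring (f ^ (l ! j))"
  let ?N = "direct_sum_over {..<length l} ?c"
  obtain \<phi> where hom: "\<phi> \<in> LinearCombinations.module_hom class_ring ?P ?N"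
    and bij: "bij_betw \<phi> (carrier ?P) (carrier ?N)"
    using l by (auto simp: primary_partition_def module_isomorphic_def)
  note P = primary_submodule_simps(1)[OF M, of f]
  have smult: "\<phi> (poly_mat p M *\<^sub>v v) = p \<odot>\<^bsub>?N\<^esub> \<phi> v" if "v \<in> carrier ?P" for p v
    using LinearCombinations.module_hom_smult[OF hom, of p v] that by (simp add: primary_submodule_simps(3))
  have into: "\<phi> v \<in> carrier ?N" if "v \<in> carrier ?P" for v
    using LinearCombinations.module_hom_closed[OF hom] that by (rule funcset_mem)
  have 0: "0\<^sub>v n \<in> carrier ?P" unfolding P using zero_in_poly_kernel[OF M] by blast
  have zeroN: "0 \<odot>\<^bsub>?N\<^esub> C = \<zero>\<^bsub>?N\<^esub>" if "C \<in> carrier ?N" for C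
  proof -
    have "0 \<odot>\<^bsub>?c j\<^esub> C j = \<zero>\<^bsub>?c j\<^esub>" if "j < length l" for j
    proof -
      have "C j \<in> range (residue (f ^ (l ! j)))"
        using that \<open>C \<in> carrier ?N\<close> unfolding direct_sum_over_simps by (auto simp: PiE_iff cyclic_module_simps)
      then show ?thesis by (auto simp: cyclic_module_simps)
    qed
    then show ?thesis by (auto simp: direct_sum_over_simps intro!: restrict_ext)
  qed
  \<comment> \<open>That \<open>\<phi>\<close> preserves zero is obtained from compatibility with
    the scalar 0.\<close>
  have "\<phi> (poly_mat 0 M *\<^sub>v 0\<^sub>v n) = \<zero>\<^bsub>?N\<^esub>"
    using smult[OF 0, of 0] zeroN[OF into[OF 0]] by (rule trans)
  moreover have "poly_mat 0 M *\<^sub>v 0\<^sub>v n = 0\<^sub>v n" using M by (intro eq_vecI) (auto simp: poly_mat_0)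
  ultimately have phi0: "\<phi> (0\<^sub>v n) = \<zero>\<^bsub>?N\<^esub>" by (simp only:)
  let ?S = "{u \<in> carrier ?N. f ^ k \<odot>\<^bsub>?N\<^esub> u = \<zero>\<^bsub>?N\<^esub>}"
  let ?T = "\<lambda>j. {C \<in> carrier (?c j). f ^ k \<odot>\<^bsub>?c j\<^esub> C = \<zero>\<^bsub>?c j\<^esub>}"
  have ker: "v \<in> poly_kernel M (f ^ k) \<longleftrightarrow> f ^ k \<odot>\<^bsub>?N\<^esub> \<phi> v = \<zero>\<^bsub>?N\<^esub>" if v: "v \<in> carrier ?P" for v
  proof -
    have vn: "v \<in> carrier_vec n" using v M unfolding P by (auto simp: poly_kernel_def)
    have c: "poly_mat (f ^ k) M *\<^sub>v v \<in> carrier ?P"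
      using v poly_mat_act_poly_kernel[OF M] unfolding P by blast
    have "v \<in> poly_kernel M (f ^ k) \<longleftrightarrow> poly_mat (f ^ k) M *\<^sub>v v = 0\<^sub>v n"
      using vn M by (simp add: poly_kernel_def)
    also have "\<dots> \<longleftrightarrow> \<phi> (poly_mat (f ^ k) M *\<^sub>v v) = \<phi> (0\<^sub>v n)"
      using inj_on_eq_iff[OF bij_betw_imp_inj_on[OF bij] c 0] by (rule sym)
    finally show ?thesis unfolding smult[OF v, of "f ^ k"] phi0 .
  qed
  have "poly_kernel M (f ^ k) \<subseteq> carrier ?P" unfolding P by blast
  then have "bij_betw \<phi> (poly_kernel M (f ^ k)) ?S"
  proof (rule bij_betw_subset[OF bij])
    show "\<phi> ` poly_kernel M (f ^ k) = ?S"
    proof (intro equalityI subsetI)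
      fix u assume u: "u \<in> ?S"
      then obtain v where "v \<in> carrier ?P" "u = \<phi> v" using bij_betw_imp_surj_on[OF bij] by blast
      then show "u \<in> \<phi> ` poly_kernel M (f ^ k)" using u ker by blast
    qed (use ker into \<open>poly_kernel M (f ^ k) \<subseteq> carrier ?P\<close> in blast)
  qed
  then have "card (poly_kernel M (f ^ k)) = card ?S" by (rule bij_betw_same_card)
  also have "?S = (\<Pi>\<^sub>E j\<in>{..<length l}. ?T j)"
  proof (intro equalityI subsetI)
    fix u assume u: "u \<in> ?S"
    then have eq: "(\<lambda>j\<in>{..<length l}. f ^ k \<odot>\<^bsub>?c j\<^esub> u j) = (\<lambda>j\<in>{..<length l}. \<zero>\<^bsub>?c j\<^esub>)"
      by (simp add: direct_sum_over_simps)
    have "f ^ k \<odot>\<^bsub>?c j\<^esub> u j = \<zero>\<^bsub>?c j\<^esub>" if "j < length l" for j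
      using fun_cong[OF eq, of j] that by simp
    then show "u \<in> (\<Pi>\<^sub>E j\<in>{..<length l}. ?T j)" using u by (simp add: direct_sum_over_simps PiE_iff)
  next
    fix u assume "u \<in> (\<Pi>\<^sub>E j\<in>{..<length l}. ?T j)"
    then show "u \<in> ?S" by (auto simp: direct_sum_over_simps PiE_iff intro!: restrict_ext)
  qed
  also have "card (\<Pi>\<^sub>E j\<in>{..<length l}. ?T j) = (\<Prod>j<length l. CARD('k) ^ (degree f * min (l ! j) k))"
    by (simp add: card_PiE card_cyclic_module_torsion[OF f])
  also have "\<dots> = CARD('k) ^ (degree f * truncated_size l k)"
    by (simp add: truncated_size_def sum_list_sum_nth atLeast0LessThan sum_distrib_left flip: power_sum)
  finally show ?thesis .
qed

lemma truncated_size_Suc: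
  "truncated_size l (Suc k) = truncated_size l k + length (filter (\<lambda>x. k < x) l)"
  by (induction l) (auto simp: truncated_size_def)

lemma truncated_size_mset: "truncated_size l k = (\<Sum>x\<in>#mset l. min x k)"
  by (simp add: truncated_size_def flip: sum_mset_sum_list)

text \<open>The first differences in \<open>k\<close> count the parts exceeding \<open>k\<close>,
  and the second differences give the multiplicity of the part \<open>k + 1\<close>. Parts equal to
  0 would be invisible, hence positivity.\<close>

lemma mset_eq_of_truncated_size:
  assumes pos: "\<forall>x\<in>set l. 0 < x" "\<forall>x\<in>set l'. 0 < x"
    and eq: "\<And>k. truncated_size l k = truncated_size l' k"
  shows "mset l = mset l'"
proof (rule multiset_eqI)
  fix x :: nat
  have filter_eq: "length (filter (\<lambda>x. k < x) l) = length (filter (\<lambda>x. k < x) l')" for k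
    using truncated_size_Suc[of l k] truncated_size_Suc[of l' k] eq[of k] eq[of "Suc k"] by simp
  have count: "length (filter (\<lambda>x. k < x) xs)
      = count (mset xs) (Suc k) + length (filter (\<lambda>x. Suc k < x) xs)" for k xs
    by (induction xs) auto
  show "count (mset l) x = count (mset l') x"
  proof (cases x)
    case 0
    then have "x \<notin> set l" "x \<notin> set l'" using pos by auto
    then show ?thesis by (metis count_eq_zero_iff set_mset_mset)
  next
    case (Suc k)
    then show ?thesis using count[of k l] count[of k l'] filter_eq by simp
  qed
qed

lemma is_partition_mset_unique:
  assumes "is_partition l" "is_partition l'" "mset l = mset l'"
  shows "l = l'"
proof -
  have "sorted (rev l)" "sorted (rev l')" using assms by (auto simp: is_partition_def sorted_wrt_rev)
  then have "rev l = rev l'" using assms(3) by (metis mset_rev properties_for_sort)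
  then show ?thesis by simp
qed

lemma is_partition_of_mset:
  "\<forall>x\<in>#A. 0 < x \<Longrightarrow> \<exists>l. is_partition l \<and> mset l = A"
  by (rule exI[of _ "rev (sorted_list_of_multiset A)"])
    (auto simp: is_partition_def sorted_wrt_rev)

context ring_action begin

text \<open>The recursive construction yields the exponents in no particular order, whereas a
  partition is a decreasing list.\<close>

lemma cyclic_decomposition_sorted:
  assumes dec: "cyclic_decomposition f U t u l"
  shows "\<exists>ls u'. is_partition ls \<and> cyclic_decomposition f U (length ls) u' ((!) ls)"
proof -
  define js where "js = rev (sort_key l [0..<t])"
  define ls where "ls = map l js"
  have js: "distinct js" "set js = {..<t}" "length js = t" by (auto simp: js_def)
  have bij: "bij_betw ((!) js) {..<t} {..<t}"
    by (rule bij_betw_nth) (simp_all add: js)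
  have nth: "ls ! j = l (js ! j)" if "j < t" for j
    using js that by (simp add: ls_def)
  have lent: "length ls = t" using js by (simp add: ls_def)
  have jst: "js ! j < t" if "j < t" for j using nth_mem[of j js] that by (simp add: js)
  have reindex: "(\<Sum>j<t. g (js ! j)) = (\<Sum>j<t. g j)" for g :: "nat \<Rightarrow> 'v"
    by (rule sum.reindex_bij_betw[OF bij])
  have "sorted (rev ls)" by (simp add: ls_def js_def rev_map)
  moreover have "\<forall>x\<in>set ls. 0 < x" using dec js by (auto simp: ls_def cyclic_decomposition_def)
  ultimately have "is_partition ls" by (simp add: is_partition_def sorted_wrt_rev)
  moreover have "cyclic_decomposition f U t (\<lambda>j. u (js ! j)) ((!) ls)"
    unfolding cyclic_decomposition_def
  proof (intro conjI allI impI ballI)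
    fix j assume "j < t"
    then show "u (js ! j) \<in> U" "0 < ls ! j" using dec jst nth by (auto simp: cyclic_decomposition_def)
  next
    fix x assume "x \<in> U"
    then obtain a where "x = (\<Sum>j<t. a j \<star> u j)" using dec by (auto simp: cyclic_decomposition_def)
    then have "x = (\<Sum>j<t. a (js ! j) \<star> u (js ! j))" using reindex[of "\<lambda>j. a j \<star> u j"] by simp
    then show "\<exists>a. x = (\<Sum>j<t. a j \<star> u (js ! j))" by (rule exI[of _ "\<lambda>j. a (js ! j)"])
  next
    fix a :: "nat \<Rightarrow> 'r"
    \<comment> \<open>The coefficients are carried back along the permutation \<open>js\<close>, so
      that the original relation clause applies.\<close>
    define b where "b = (\<lambda>j. a (the_inv_into {..<t} ((!) js) j))"
    have ab: "a j = b (js ! j)" if "j < t" for j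
      using the_inv_into_f_f[OF bij_betw_imp_inj_on[OF bij], of j] that by (simp add: b_def)
    have "(\<Sum>j<t. a j \<star> u (js ! j)) = (\<Sum>j<t. b j \<star> u j)"
      using reindex[of "\<lambda>j. b j \<star> u j"] ab by simp
    also have "\<dots> = 0 \<longleftrightarrow> (\<forall>j<t. f ^ l j dvd b j)" using dec by (auto simp: cyclic_decomposition_def)
    also have "\<dots> \<longleftrightarrow> (\<forall>j\<in>(!) js ` {..<t}. f ^ l j dvd b j)"
      using bij_betw_imp_surj_on[OF bij] by auto
    also have "\<dots> \<longleftrightarrow> (\<forall>j<t. f ^ (ls ! j) dvd a j)" using ab nth by auto
    finally show "(\<Sum>j<t. a j \<star> u (js ! j)) = 0 \<longleftrightarrow> (\<forall>j<t. f ^ (ls ! j) dvd a j)" .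
  qed
  ultimately show ?thesis using lent by blast
qed

end

text \<open>Vectors of type \<^typ>\<open>'k vec\<close> do not form an \<^class>\<open>ab_group_add\<close>, so the module of a matrix is
  transported to functions that vanish from the dimension on.\<close>

definition vec_fun :: "'k::zero vec \<Rightarrow> nat \<Rightarrow> 'k" where
  "vec_fun v = (\<lambda>i. if i < dim_vec v then v $ i else 0)"

lemma vec_vec_fun: "v \<in> carrier_vec n \<Longrightarrow> vec n (vec_fun v) = v"
  by (intro eq_vecI) (auto simp: vec_fun_def)

lemma vec_fun_zero: "vec_fun (0\<^sub>v n) = 0"
  by (auto simp: vec_fun_def)

lemma vec_fun_add:
  "v \<in> carrier_vec n \<Longrightarrow> w \<in> carrier_vec n \<Longrightarrow> vec_fun (v + w) = vec_fun v + (vec_fun w :: nat \<Rightarrow> 'k::monoid_add)"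
  by (auto simp: vec_fun_def)

definition fun_act :: "'k::field mat \<Rightarrow> 'k poly \<Rightarrow> (nat \<Rightarrow> 'k) \<Rightarrow> nat \<Rightarrow> 'k" where
  "fun_act M p x = vec_fun (poly_mat p M *\<^sub>v vec (dim_row M) x)"

lemma fun_act_vec_fun:
  "M \<in> carrier_mat n n \<Longrightarrow> v \<in> carrier_vec n \<Longrightarrow> fun_act M p (vec_fun v) = vec_fun (poly_mat p M *\<^sub>v v)"
  by (auto simp: fun_act_def vec_vec_fun)

lemma fun_action:
  assumes M: "M \<in> carrier_mat n n"
  shows "ring_action (vec_fun ` carrier_vec n) (fun_act M)"
proof
  note [simp] = fun_act_vec_fun[OF M]
  have pc: "poly_mat p M *\<^sub>v v \<in> carrier_vec n" if "v \<in> carrier_vec n" for p v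
    by (rule mult_mat_vec_carrier[OF poly_mat_carrier[OF M] that])
  show "0 \<in> vec_fun ` carrier_vec n" by (metis image_eqI vec_fun_zero zero_carrier_vec)
  fix v w :: "nat \<Rightarrow> 'a" and a b
  assume "v \<in> vec_fun ` carrier_vec n"
  then obtain v' where v: "v' \<in> carrier_vec n" "v = vec_fun v'" by blast
  show "fun_act M a v \<in> vec_fun ` carrier_vec n" using v pc by simp
  show "fun_act M (a + b) v = fun_act M a v + fun_act M b v"
    using v pc M by (simp add: poly_mat_add add_mult_distrib_mat_vec[of _ n n] flip: vec_fun_add[of _ n])
  show "fun_act M (a * b) v = fun_act M a (fun_act M b v)"
    using v pc M by (simp add: poly_mat_mult_vec)
  show "fun_act M 1 v = v" using v M by (simp add: poly_mat_1)
  assume "w \<in> vec_fun ` carrier_vec n"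
  then obtain w' where w: "w' \<in> carrier_vec n" "w = vec_fun w'" by blast
  show "v + w \<in> vec_fun ` carrier_vec n"
    using v w by (auto intro!: image_eqI[of _ _ "v' + w'"] simp: vec_fun_add)
  show "fun_act M a (v + w) = fun_act M a v + fun_act M a w"
    using v w pc M by (simp add: mult_add_distrib_mat_vec[of _ n n] flip: vec_fun_add[of _ n])
qed

lemma poly_kernel_carrier: "M \<in> carrier_mat n n \<Longrightarrow> poly_kernel M p \<subseteq> carrier_vec n"
  by (auto simp: poly_kernel_def)

lemma poly_kernel_add:
  assumes M: "M \<in> carrier_mat n n" and "v \<in> poly_kernel M p" "w \<in> poly_kernel M p"
  shows "v + w \<in> poly_kernel M p"
proof -
  have v: "v \<in> carrier_vec n" and w: "w \<in> carrier_vec n" using assms poly_kernel_carrier[OF M] by blast+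
  show ?thesis
    using assms v w mult_add_distrib_mat_vec[OF poly_mat_carrier[OF M] v w] by (simp add: poly_kernel_def)
qed

lemma poly_kernel_dvd_mono:
  assumes "M \<in> carrier_mat n n" "p dvd q"
  shows "poly_kernel M p \<subseteq> poly_kernel M q"
proof -
  obtain r where "q = r * p" using assms(2) unfolding dvd_def by (metis mult.commute)
  then show ?thesis using poly_kernel_mult_right[OF assms(1)] by auto
qed

text \<open>Each of the finitely many vectors involved has an exponent that kills it; the sum of
  these is a common exponent.\<close>

lemma primary_part_bounded:
  fixes M :: "'k::{field,finite} mat"
  assumes M: "M \<in> carrier_mat n n"
  shows "\<exists>N. (\<Union>k. poly_kernel M (f ^ k)) = poly_kernel M (f ^ N)"
proof -
  let ?K = "\<Union>k. poly_kernel M (f ^ k)"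
  have fin: "finite ?K"
    using poly_kernel_carrier[OF M] finite_carrier_vec by (intro finite_subset[OF UN_least]) 
  have "\<forall>v\<in>?K. \<exists>k. v \<in> poly_kernel M (f ^ k)" by blast
  from bchoice[OF this] obtain \<kappa> where \<kappa>: "\<And>v. v \<in> ?K \<Longrightarrow> v \<in> poly_kernel M (f ^ \<kappa> v)" by blast
  let ?N = "sum \<kappa> ?K"
  have "v \<in> poly_kernel M (f ^ ?N)" if v: "v \<in> ?K" for v
  proof -
    have "f ^ \<kappa> v dvd f ^ ?N" using fin v by (intro le_imp_power_dvd member_le_sum) auto
    then show ?thesis using poly_kernel_dvd_mono[OF M] \<kappa>[OF v] by blast
  qed
  then have "?K = poly_kernel M (f ^ ?N)" by blast
  then show ?thesis by blast
qed

theorem primary_partition_exists: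
  fixes M :: "'k::{field,finite} mat"
  assumes M: "M \<in> carrier_mat n n" and f: "irreducible f"
  shows "\<exists>l. primary_partition M f l"
proof -
  let ?V = "vec_fun ` carrier_vec n :: (nat \<Rightarrow> 'k) set"
  let ?act = "fun_act M"
  interpret ring_action ?V ?act by (rule fun_action[OF M])
  interpret primary_action ?V ?act f
  proof
    show "f \<noteq> 0" using f by auto
    show "\<not> f dvd 1" using f irreducible_not_unit by blast
    fix a assume "\<not> f dvd a"
    then obtain u v where "u * f + v * a = 1" using irreducible_comaximal[OF f] unfolding comaximal_def by blast
    then have "a * v - 1 = f * (- u)" by (simp add: algebra_simps)
    then show "\<exists>b. f dvd a * b - 1" by (metis dvd_triv_left)
  qed
  obtain N where K: "(\<Union>k. poly_kernel M (f ^ k)) = poly_kernel M (f ^ N)"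
    using primary_part_bounded[OF M] by blast
  let ?K = "poly_kernel M (f ^ N)"
  note Kn = subsetD[OF poly_kernel_carrier[OF M]]
  have act: "?act p (vec_fun v) = vec_fun (poly_mat p M *\<^sub>v v)" if "v \<in> ?K" for p v
    by (rule fun_act_vec_fun[OF M Kn[OF that]])
  define U where "U = vec_fun ` ?K"
  have sub: "submod U"
    unfolding submod_def U_def
  proof (intro conjI ballI allI)
    show "vec_fun ` ?K \<subseteq> ?V" using Kn by blast
    show "0 \<in> vec_fun ` ?K" using zero_in_poly_kernel[OF M] vec_fun_zero by (metis image_eqI)
    fix x assume "x \<in> vec_fun ` ?K"
    then obtain v where v: "v \<in> ?K" "x = vec_fun v" by blast
    show "?act a x \<in> vec_fun ` ?K" for a
      using v act poly_mat_act_poly_kernel[OF M v(1)] by auto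
    fix y assume "y \<in> vec_fun ` ?K"
    then obtain w where w: "w \<in> ?K" "y = vec_fun w" by blast
    have "x + y = vec_fun (v + w)" using v w vec_fun_add[OF Kn Kn] by simp
    then show "x + y \<in> vec_fun ` ?K" using poly_kernel_add[OF M v(1) w(1)] by blast
  qed
  interpret U: ring_action U ?act by (rule submod_action[OF sub])
  have "?act (f ^ N) x = 0" if "x \<in> U" for x
    using that act vec_fun_zero[of n] M unfolding U_def by (auto simp: poly_kernel_def)
  moreover have "finite U" by (simp add: U_def)
  ultimately obtain t u0 l0 where "cyclic_decomposition f U t u0 l0"
    using cyclic_decomposition_exists[OF sub] by blast
  then obtain l u where l: "is_partition l" and dec: "cyclic_decomposition f U (length l) u ((!) l)"
    using cyclic_decomposition_sorted by blast
  let ?t = "length l"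
  define comb where "comb = (\<lambda>a. \<Sum>j<?t. ?act (a j) (u j))"
  have uU: "u j \<in> U" if "j < ?t" for j using dec that by (simp add: cyclic_decomposition_def)
  have span: "\<exists>a. x = comb a" if "x \<in> U" for x
    using dec that by (simp add: cyclic_decomposition_def comb_def)
  have rel: "comb a = 0 \<longleftrightarrow> (\<forall>j<?t. f ^ (l ! j) dvd a j)" for a
    using dec by (simp add: cyclic_decomposition_def comb_def)
  have combU: "comb a \<in> U" for a
    unfolding comb_def by (intro U.sum_closed U.act_closed uU) auto
  have comb_add: "comb (\<lambda>j. a j + b j) = comb a + comb b" for a b
    unfolding comb_def sum.distrib[symmetric] by (intro sum.cong refl U.add_act uU) auto
  have comb_diff: "comb (\<lambda>j. a j - b j) = comb a - comb b" for a b
    unfolding comb_def sum_subtractf[symmetric] by (intro sum.cong refl U.diff_act uU) auto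
  have comb_mult: "comb (\<lambda>j. p * a j) = ?act p (comb a)" for p a
  proof -
    have "?act p (comb a) = (\<Sum>j<?t. ?act p (?act (a j) (u j)))"
      unfolding comb_def by (intro U.act_sum U.act_closed uU) auto
    also have "\<dots> = comb (\<lambda>j. p * a j)"
      unfolding comb_def by (intro sum.cong refl U.mult_act[symmetric] uU) auto
    finally show ?thesis ..
  qed
  have comb_eq: "comb a = comb b \<longleftrightarrow> (\<forall>j<?t. residue (f ^ (l ! j)) (a j) = residue (f ^ (l ! j)) (b j))" for a b
    using rel[of "\<lambda>j. a j - b j"] unfolding comb_diff residue_eq_iff by simp
  \<comment> \<open>The coordinates of \<open>v\<close> with respect to the generators. The chosen
    coefficients are arbitrary, but by \<open>comb_eq\<close> their residues modulo
    \<open>f ^ (l ! j)\<close> depend only on \<open>v\<close>.\<close>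
  define \<phi> where "\<phi> = (\<lambda>v. \<lambda>j\<in>{..<?t}. residue (f ^ (l ! j)) ((SOME a. vec_fun v = comb a) j))"
  have phi: "\<phi> v = (\<lambda>j\<in>{..<?t}. residue (f ^ (l ! j)) (a j))" if "vec_fun v = comb a" for v a
  proof -
    have "vec_fun v = comb (SOME a. vec_fun v = comb a)" by (rule someI[of "\<lambda>a. vec_fun v = comb a", OF that])
    then have "\<forall>j<?t. residue (f ^ (l ! j)) ((SOME a. vec_fun v = comb a) j) = residue (f ^ (l ! j)) (a j)"
      using that comb_eq by metis
    then show ?thesis unfolding \<phi>_def by (intro restrict_ext) simp
  qed
  let ?P = "primary_submodule M f"
  let ?N = "direct_sum_over {..<?t} (\<lambda>j. cyclic_module class_ring (f ^ (l ! j)))"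
  have P: "carrier ?P = ?K" using primary_submodule_simps(1)[OF M] K by simp
  have rep: "\<exists>a. vec_fun v = comb a" if "v \<in> ?K" for v using span that by (simp add: U_def)
  have "\<phi> \<in> LinearCombinations.module_hom class_ring ?P ?N"
    unfolding LinearCombinations.module_hom_def P mem_Collect_eq
  proof (intro conjI allI impI funcsetI)
    fix v assume "v \<in> ?K"
    then obtain a where a: "vec_fun v = comb a" using rep by blast
    show "\<phi> v \<in> carrier ?N" unfolding phi[OF a] direct_sum_over_simps by (simp add: PiE_iff cyclic_module_simps)
  next
    fix v w assume vw: "v \<in> ?K \<and> w \<in> ?K"
    then obtain a b where a: "vec_fun v = comb a" and b: "vec_fun w = comb b" using rep by blast
    have "vec_fun (v + w) = comb (\<lambda>j. a j + b j)"
      using vec_fun_add[OF Kn[OF conjunct1[OF vw]] Kn[OF conjunct2[OF vw]]] a b by (simp add: comb_add)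
    from phi[OF this] show "\<phi> (v \<oplus>\<^bsub>?P\<^esub> w) = \<phi> v \<oplus>\<^bsub>?N\<^esub> \<phi> w"
      unfolding phi[OF a] phi[OF b] direct_sum_over_simps primary_submodule_simps(2)
      by (auto simp: cyclic_module_simps intro!: restrict_ext)
  next
    fix p :: "'k poly" and v assume pv: "p \<in> carrier class_ring \<and> v \<in> ?K"
    then obtain a where a: "vec_fun v = comb a" using rep by blast
    have "vec_fun (poly_mat p M *\<^sub>v v) = comb (\<lambda>j. p * a j)"
      using act[of v p] pv a by (simp add: comb_mult)
    from phi[OF this] show "\<phi> (p \<odot>\<^bsub>?P\<^esub> v) = p \<odot>\<^bsub>?N\<^esub> \<phi> v"
      unfolding phi[OF a] direct_sum_over_simps primary_submodule_simps(3)
      by (auto simp: cyclic_module_simps intro!: restrict_ext)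
  qed
  moreover have "bij_betw \<phi> (carrier ?P) (carrier ?N)"
    unfolding bij_betw_def P
  proof
    show "inj_on \<phi> ?K"
    proof (rule inj_onI)
      fix v w assume v: "v \<in> ?K" and w: "w \<in> ?K" and eq: "\<phi> v = \<phi> w"
      obtain a b where a: "vec_fun v = comb a" and b: "vec_fun w = comb b" using rep v w by blast
      have "residue (f ^ (l ! j)) (a j) = residue (f ^ (l ! j)) (b j)" if "j < ?t" for j
        using fun_cong[OF eq[unfolded phi[OF a] phi[OF b]], of j] that by simp
      then have "vec_fun v = vec_fun w" unfolding a b comb_eq by blast
      then have "vec n (vec_fun v) = vec n (vec_fun w)" by (rule arg_cong)
      then show "v = w" unfolding vec_vec_fun[OF Kn[OF v]] vec_vec_fun[OF Kn[OF w]] .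
    qed
    show "\<phi> ` ?K = carrier ?N"
    proof (intro equalityI subsetI)
      fix C assume "C \<in> \<phi> ` ?K"
      then obtain v where v: "v \<in> ?K" and C: "C = \<phi> v" by blast
      obtain a where a: "vec_fun v = comb a" using rep[OF v] by blast
      show "C \<in> carrier ?N"
        unfolding C phi[OF a] direct_sum_over_simps by (simp add: PiE_iff cyclic_module_simps)
    next
      fix C assume "C \<in> carrier ?N"
      then have C: "C \<in> (\<Pi>\<^sub>E j\<in>{..<?t}. range (residue (f ^ (l ! j))))"
        by (simp add: direct_sum_over_simps cyclic_module_simps)
      then have "\<forall>j\<in>{..<?t}. \<exists>a. C j = residue (f ^ (l ! j)) a" by (auto simp: PiE_iff)
      from bchoice[OF this] obtain a where a: "\<And>j. j < ?t \<Longrightarrow> C j = residue (f ^ (l ! j)) (a j)" by auto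
      obtain v where v: "v \<in> ?K" "vec_fun v = comb a" using combU[of a] by (auto simp: U_def)
      have "C = \<phi> v"
        unfolding phi[OF v(2)] using C a by (intro ext) (auto simp: PiE_iff extensional_def)
      then show "C \<in> \<phi> ` ?K" using v(1) by blast
    qed
  qed
  ultimately have "primary_partition M f l"
    using l unfolding primary_partition_def module_isomorphic_def by blast
  then show ?thesis by blast
qed

text \<open>Some partition exists, and the cardinalities determine it. From here on no isomorphism
  has to be constructed: it suffices to count kernels.\<close>

theorem primary_partition_iff:
  fixes M :: "'k::{field,finite} mat"
  assumes M: "M \<in> carrier_mat n n" and f: "irreducible f"
  shows "primary_partition M f l \<longleftrightarrow> is_partition l \<and>
    (\<forall>k. card (poly_kernel M (f ^ k)) = CARD('k) ^ (degree f * truncated_size l k))" (is "_ \<longleftrightarrow> ?R")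
proof
  assume "primary_partition M f l"
  then show ?R
    using card_poly_kernel_of_primary_partition[OF M, of f l] f by (auto simp: primary_partition_def)
next
  assume R: ?R
  obtain l' where l': "primary_partition M f l'" using primary_partition_exists[OF M f] by blast
  have card2: "1 < CARD('k)" using card_mono[of UNIV "{0, 1 :: 'k}"] by simp
  have "\<not> is_unit f" "f \<noteq> 0" using f irreducible_not_unit by auto
  then have d: "degree f > 0" by (auto simp: is_unit_iff_degree)
  have "CARD('k) ^ (degree f * truncated_size l k) = CARD('k) ^ (degree f * truncated_size l' k)" for k
    using R card_poly_kernel_of_primary_partition[OF M \<open>f \<noteq> 0\<close> l', of k] by simp
  then have "truncated_size l k = truncated_size l' k" for k
    using power_inject_exp[OF card2] d by simp
  then have "mset l = mset l'"
    using R l' by (intro mset_eq_of_truncated_size) (auto simp: is_partition_def primary_partition_def)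
  then have "l = l'" using R l' by (intro is_partition_mset_unique) (auto simp: primary_partition_def)
  then show "primary_partition M f l" using l' by simp
qed

section \<open>Separations and class types\<close>

lemma mset_partition_plus: "mset (partition_plus \<mu> \<nu>) = mset \<mu> + mset \<nu>"
  by (simp add: partition_plus_def)

lemma is_partition_plus: "is_partition \<mu> \<Longrightarrow> is_partition \<nu> \<Longrightarrow> is_partition (partition_plus \<mu> \<nu>)"
  by (auto simp: is_partition_def partition_plus_def sorted_wrt_rev)

text \<open>A type keeps only the degree of an irreducible polynomial. The label \<open>f\<close> of
  a piece \<open>(f, \<mu>)\<close> also records the component from which it was split; collected
  here are the parts of all pieces labelled \<open>f\<close>.\<close>

definition piece_sum :: "('f \<times> nat list) multiset \<Rightarrow> 'f \<Rightarrow> nat multiset" where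
  "piece_sum P f = (\<Sum>x\<in>#P. if fst x = f then mset (snd x) else {#})"

lemma piece_sum_add_mset:
  "piece_sum (add_mset (f, \<mu>) P) h = (if f = h then mset \<mu> else {#}) + piece_sum P h"
  by (cases "f = h") (simp_all add: piece_sum_def)

text \<open>Lets a given ordering of the components of a type be lifted to the labelled pieces
  behind them.\<close>

lemma image_mset_eq_mset_map:
  "mset ys = image_mset h P \<Longrightarrow> \<exists>xs. mset xs = P \<and> map h xs = ys"
proof (induction ys arbitrary: P)
  case (Cons y ys)
  then have "image_mset h P = add_mset y (mset ys)" by simp
  then obtain x P' where P: "P = add_mset x P'" "h x = y" "image_mset h P' = mset ys"
    by (metis msed_map_invR)
  then obtain xs where "mset xs = P'" "map h xs = ys" using Cons.IH[of P'] by auto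
  then show ?case using P by (intro exI[of _ "x # xs"]) auto
qed auto

text \<open>Replacing a labelled piece by two pieces with the same label keeps every
  \<open>piece_sum\<close>, so labels can be propagated along the separation steps.\<close>

lemma is_separation_pieces:
  assumes fin: "finite A" and L: "\<And>f. f \<in> A \<Longrightarrow> is_partition (L f) \<and> L f \<noteq> []"
    and sep: "is_separation (image_mset (\<lambda>f. (d f, L f)) (mset_set A)) S'"
  shows "\<exists>P. S' = image_mset (\<lambda>(f, \<mu>). (d f, \<mu>)) P \<and>
    (\<forall>(f, \<mu>)\<in>#P. f \<in> A \<and> is_partition \<mu> \<and> \<mu> \<noteq> []) \<and> (\<forall>f\<in>A. piece_sum P f = mset (L f))"
  using sep unfolding is_separation_def
proof (induction rule: rtranclp_induct)
  case base
  let ?P = "image_mset (\<lambda>f. (f, L f)) (mset_set A)"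
  have "piece_sum ?P f = mset (L f)" if "f \<in> A" for f
  proof -
    have "piece_sum ?P f = (\<Sum>g\<in>A. if g = f then mset (L g) else {#})"
      unfolding piece_sum_def sum_unfold_sum_mset image_mset.compositionality comp_def fst_conv snd_conv ..
    then show ?thesis using fin that by simp
  qed
  then show ?case using L fin
    by (intro exI[of _ ?P]) (auto simp: image_mset.compositionality comp_def)
next
  case (step S1 S2)
  then obtain P where P: "S1 = image_mset (\<lambda>(f, \<mu>). (d f, \<mu>)) P"
    "\<forall>(f, \<mu>)\<in>#P. f \<in> A \<and> is_partition \<mu> \<and> \<mu> \<noteq> []" "\<forall>f\<in>A. piece_sum P f = mset (L f)" by blast
  from step(2) obtain \<mu> \<nu> c U where
    1: "is_partition \<mu>" "\<mu> \<noteq> []" "is_partition \<nu>" "\<nu> \<noteq> []"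
      "S1 = add_mset (c, partition_plus \<mu> \<nu>) U" "S2 = add_mset (c, \<mu>) (add_mset (c, \<nu>) U)"
    by (auto elim!: separation_step.cases)
  \<comment> \<open>Several labelled pieces may look like the component being split; any of them can
    be chosen.\<close>
  have "image_mset (\<lambda>(f, \<mu>). (d f, \<mu>)) P = add_mset (c, partition_plus \<mu> \<nu>) U"
    using P(1) 1(5) by simp
  from msed_map_invR[OF this] obtain x P' where x: "P = add_mset x P'"
    "(\<lambda>(f, \<mu>). (d f, \<mu>)) x = (c, partition_plus \<mu> \<nu>)" "image_mset (\<lambda>(f, \<mu>). (d f, \<mu>)) P' = U"
    by blast
  then obtain f where f: "x = (f, partition_plus \<mu> \<nu>)" "d f = c" by (cases x) auto
  show ?case
  proof (intro exI[of _ "add_mset (f, \<mu>) (add_mset (f, \<nu>) P')"] conjI)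
    show "\<forall>f'\<in>A. piece_sum (add_mset (f, \<mu>) (add_mset (f, \<nu>) P')) f' = mset (L f')"
      using P(3) unfolding x(1) f(1) by (auto simp: piece_sum_add_mset mset_partition_plus add.assoc)
  qed (use 1 P(2) x f in auto)
qed

lemma separation_step_union:
  assumes "separation_step S S'"
  shows "separation_step (W + S) (W + S')"
  using assms
proof (cases rule: separation_step.cases)
  case (1 \<mu> \<nu> d U)
  then show ?thesis using separation_step.intros[of \<mu> \<nu> d "W + U"] by simp
qed

lemma is_separation_union: "is_separation S S' \<Longrightarrow> is_separation (W + S) (W + S')"
  unfolding is_separation_def
  by (induction rule: rtranclp_induct) (auto intro: rtranclp.rtrancl_into_rtrancl separation_step_union)

lemma is_separation_trans: "is_separation S S' \<Longrightarrow> is_separation S' S'' \<Longrightarrow> is_separation S S''"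
  unfolding is_separation_def by (rule rtranclp_trans)

text \<open>The pieces are split off one at a time; the parts of those that remain form an
  intermediate partition \<open>\<nu>\<close>.\<close>

lemma is_separation_component:
  "\<lbrakk>Q \<noteq> {#}; \<forall>\<mu>\<in>#Q. is_partition \<mu> \<and> \<mu> \<noteq> []; is_partition l; mset l = (\<Sum>\<mu>\<in>#Q. mset \<mu>)\<rbrakk>
    \<Longrightarrow> is_separation (add_mset (d, l) U) (image_mset (Pair d) Q + U)"
proof (induction Q arbitrary: l U)
  case (add \<mu> Q)
  show ?case
  proof (cases "Q = {#}")
    case True
    then have "l = \<mu>" using add.prems by (intro is_partition_mset_unique) auto
    then show ?thesis using True by (simp add: is_separation_def)
  next
    case False
    let ?N = "\<Sum>\<mu>\<in>#Q. mset \<mu>"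
    have "\<forall>x\<in>#?N. 0 < x" using add.prems(2) by (auto simp: is_partition_def)
    then obtain \<nu> where \<nu>: "is_partition \<nu>" "mset \<nu> = ?N" using is_partition_of_mset by blast
    obtain \<mu>' where "\<mu>' \<in># Q" using False by blast
    then have "mset \<nu> \<noteq> {#}" using add.prems(2) \<nu>(2) by (auto simp: sum_mset_0_iff)
    then have \<nu>0: "\<nu> \<noteq> []" by auto
    have "l = partition_plus \<mu> \<nu>"
      using add.prems \<nu> by (intro is_partition_mset_unique) (auto simp: mset_partition_plus is_partition_plus)
    then have "separation_step (add_mset (d, l) U) (add_mset (d, \<mu>) (add_mset (d, \<nu>) U))"
      using add.prems \<nu> \<nu>0 by (auto intro: separation_step.intros)
    moreover have "is_separation (add_mset (d, \<nu>) (add_mset (d, \<mu>) U)) (image_mset (Pair d) Q + add_mset (d, \<mu>) U)"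
      using add.prems \<nu> False by (intro add.IH) auto
    ultimately show ?thesis
      by (simp add: is_separation_def add_mset_commute converse_rtranclp_into_rtranclp)
  qed
qed simp

text \<open>Converse of \<open>is_separation_pieces\<close>, one label at a time. Each label does
  occur among the pieces because \<open>L f\<close> has a part.\<close>

lemma is_separation_of_pieces:
  "\<lbrakk>finite A; \<And>f. f \<in> A \<Longrightarrow> is_partition (L f) \<and> L f \<noteq> [];
    \<forall>(f, \<mu>)\<in>#P. f \<in> A \<and> is_partition \<mu> \<and> \<mu> \<noteq> []; \<And>f. f \<in> A \<Longrightarrow> piece_sum P f = mset (L f)\<rbrakk>
   \<Longrightarrow> is_separation (image_mset (\<lambda>f. (d f, L f)) (mset_set A)) (image_mset (\<lambda>(f, \<mu>). (d f, \<mu>)) P)"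
proof (induction A arbitrary: P rule: finite_induct)
  case empty
  have "x \<notin># P" for x using empty.prems(2) by (cases x) auto
  then have "P = {#}" by (meson multiset_nonemptyE)
  then show ?case by (simp add: is_separation_def)
next
  case (insert f A)
  define Pf where "Pf = filter_mset (\<lambda>x. fst x = f) P"
  define P' where "P' = filter_mset (\<lambda>x. fst x \<noteq> f) P"
  have P: "P = Pf + P'" unfolding Pf_def P'_def by (rule multiset_partition)
  let ?Q = "image_mset snd Pf"
  have Pf: "image_mset (\<lambda>(f, \<mu>). (d f, \<mu>)) Pf = image_mset (Pair (d f)) ?Q"
    by (auto simp: Pf_def image_mset.compositionality intro!: image_mset_cong)
  have sum_Pf: "piece_sum P f = (\<Sum>\<mu>\<in>#?Q. mset \<mu>)"
  proof -
    have "piece_sum P f = piece_sum Pf f + piece_sum P' f" unfolding P by (simp add: piece_sum_def)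
    moreover have "piece_sum P' f = {#}" unfolding piece_sum_def by (rule sum_mset.neutral) (auto simp: P'_def)
    moreover have "piece_sum Pf f = (\<Sum>\<mu>\<in>#?Q. mset \<mu>)"
      unfolding piece_sum_def image_mset.compositionality comp_def
      by (intro arg_cong[where f = sum_mset] image_mset_cong) (auto simp: Pf_def)
    ultimately show ?thesis by simp
  qed
  have "mset (L f) \<noteq> {#}" using insert.prems(1)[of f] by simp
  then have Q0: "?Q \<noteq> {#}" using insert.prems(3)[of f] sum_Pf by auto
  have "is_separation (image_mset (\<lambda>f. (d f, L f)) (mset_set A)) (image_mset (\<lambda>(f, \<mu>). (d f, \<mu>)) P')"
  proof (rule insert.IH)
    show "is_partition (L g) \<and> L g \<noteq> []" if "g \<in> A" for g using insert.prems(1) that by blast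
    show "\<forall>(g, \<mu>)\<in>#P'. g \<in> A \<and> is_partition \<mu> \<and> \<mu> \<noteq> []" using insert.prems(2) by (auto simp: P'_def)
    fix g assume g: "g \<in> A"
    then have "g \<noteq> f" using insert.hyps by blast
    then have "piece_sum Pf g = {#}" unfolding piece_sum_def by (intro sum_mset.neutral) (auto simp: Pf_def)
    then have "piece_sum P g = piece_sum P' g" unfolding P by (simp add: piece_sum_def)
    then show "piece_sum P' g = mset (L g)" using insert.prems(3)[of g] g by simp
  qed
  then have "is_separation (image_mset (Pair (d f)) ?Q + image_mset (\<lambda>f. (d f, L f)) (mset_set A))
      (image_mset (\<lambda>(f, \<mu>). (d f, \<mu>)) P)"
    unfolding P image_mset_union Pf by (rule is_separation_union)
  moreover have "is_separation (add_mset (d f, L f) (image_mset (\<lambda>f. (d f, L f)) (mset_set A)))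
      (image_mset (Pair (d f)) ?Q + image_mset (\<lambda>f. (d f, L f)) (mset_set A))"
    using insert.prems Q0 sum_Pf by (intro is_separation_component) (auto simp: Pf_def)
  ultimately show ?case using insert.hyps is_separation_trans by simp
qed


text \<open>The two cardinality conditions force \<open>A\<close> to be the set of irreducible
  factors: outside \<open>A\<close> the kernels are trivial, and inside \<open>A\<close> a nonempty
  partition makes the kernel at exponent 1 nontrivial.\<close>

lemma class_type_intro:
  fixes M :: "'k::{field,finite} mat"
  assumes M: "M \<in> carrier_mat n n"
    and A: "\<And>f. f \<in> A \<Longrightarrow> monic f \<and> irreducible f" "\<And>f. f \<in> A \<Longrightarrow> is_partition (L f) \<and> L f \<noteq> []"
    and card_in: "\<And>f k. f \<in> A \<Longrightarrow> card (poly_kernel M (f ^ k)) = CARD('k) ^ (degree f * truncated_size (L f) k)"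
    and card_out: "\<And>f. monic f \<Longrightarrow> irreducible f \<Longrightarrow> f \<notin> A \<Longrightarrow> card (poly_kernel M f) = 1"
  shows "has_class_type M (image_mset (\<lambda>f. (degree f, L f)) (mset_set A))"
proof -
  have card2: "1 < CARD('k)" using card_mono[of UNIV "{0, 1 :: 'k}"] by simp
  have "f \<in> char_factors M \<longleftrightarrow> f \<in> A" if f: "monic f" "irreducible f" for f
  proof
    assume "f \<in> char_factors M"
    then have "poly_kernel M f \<noteq> {0\<^sub>v n}" using char_factors_eq[OF M] by blast
    then show "f \<in> A"
      using card_out[OF f] zero_in_poly_kernel[OF M, of f] by (metis card_1_singletonE singletonD)
  next
    assume fA: "f \<in> A"
    have "\<not> is_unit f" "f \<noteq> 0" using f irreducible_not_unit by auto
    then have "degree f > 0" by (auto simp: is_unit_iff_degree)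
    moreover obtain x xs where "L f = x # xs" "0 < x"
      using A(2)[OF fA] by (cases "L f") (auto simp: is_partition_def)
    ultimately have "degree f * truncated_size (L f) 1 > 0" by (simp add: truncated_size_def)
    then have "card (poly_kernel M f) \<noteq> 1"
      using card_in[OF fA, of 1] card2 by (metis one_less_power less_irrefl power_one_right)
    then show "f \<in> char_factors M" using f char_factors_eq[OF M] by auto
  qed
  then have "char_factors M = A" using A(1) by (auto simp: char_factors_def)
  moreover have "primary_partition M f (L f)" if "f \<in> A" for f
    using primary_partition_iff[OF M] A that card_in by blast
  ultimately show ?thesis unfolding has_class_type_def by blast
qed

lemma finite_char_factors:
  fixes M :: "'k::{field,finite} mat"
  assumes M: "M \<in> carrier_mat n n"
  shows "finite (char_factors M)"
proof (rule finite_subset)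
  have "degree (char_poly M) = n" "char_poly M \<noteq> 0" using degree_monic_char_poly[OF M] by auto
  then show "char_factors M \<subseteq> short_polys (Suc n)"
    by (auto simp: char_factors_def short_polys_def dest!: dvd_imp_degree_le intro!: coeff_eq_0)
qed simp

lemma primary_partition_nonempty:
  fixes M :: "'k::{field,finite} mat"
  assumes M: "M \<in> carrier_mat n n" and f: "irreducible f" and l: "primary_partition M f l"
    and nontriv: "poly_kernel M f \<noteq> {0\<^sub>v n}"
  shows "l \<noteq> []"
proof
  assume "l = []"
  have "card (poly_kernel M (f ^ 1)) = CARD('k) ^ (degree f * truncated_size l 1)"
    using l primary_partition_iff[OF M f, of l] by blast
  then have "card (poly_kernel M f) = 1" by (simp add: \<open>l = []\<close> truncated_size_def)
  then show False
    using nontriv zero_in_poly_kernel[OF M, of f] by (auto simp: card_1_singleton_iff)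
qed

lemma class_type_cards:
  fixes M :: "'k::{field,finite} mat"
  assumes M: "M \<in> carrier_mat n n" and T: "has_class_type M T"
  shows "\<exists>L. T = image_mset (\<lambda>f. (degree f, L f)) (mset_set (char_factors M)) \<and>
    (\<forall>f\<in>char_factors M. is_partition (L f) \<and> L f \<noteq> [] \<and>
      (\<forall>k. card (poly_kernel M (f ^ k)) = CARD('k) ^ (degree f * truncated_size (L f) k)))"
proof -
  obtain L where L: "\<And>f. f \<in> char_factors M \<Longrightarrow> primary_partition M f (L f)"
    "T = image_mset (\<lambda>f. (degree f, L f)) (mset_set (char_factors M))"
    using T unfolding has_class_type_def by blast
  show ?thesis
  proof (intro exI[of _ L] conjI ballI L(2))
    fix f assume f: "f \<in> char_factors M"
    then have irr: "irreducible f" and nontriv: "poly_kernel M f \<noteq> {0\<^sub>v n}"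
      using char_factors_eq[OF M] by auto
    show "is_partition (L f)" using L(1)[OF f] by (simp add: primary_partition_def)
    show "L f \<noteq> []" by (rule primary_partition_nonempty[OF M irr L(1)[OF f] nontriv])
    show "\<forall>k. card (poly_kernel M (f ^ k)) = CARD('k) ^ (degree f * truncated_size (L f) k)"
      using primary_partition_iff[OF M irr, of "L f"] L(1)[OF f] by blast
  qed
qed

text \<open>The sum of all multiplicities serves as \<open>N\<close>. The exponents stay free above
  \<open>N\<close>, so that each can be enlarged until its kernel is the full primary part.\<close>

lemma char_poly_dvd_prod_char_factors:
  fixes M :: "'k::{field,finite} mat"
  assumes M: "M \<in> carrier_mat n n"
  shows "\<exists>N. \<forall>e. (\<forall>f\<in>char_factors M. N \<le> e f) \<longrightarrow> char_poly M dvd (\<Prod>f\<in>char_factors M. f ^ e f)"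
proof -
  have mon: "monic (char_poly M)" using degree_monic_char_poly[OF M] by auto
  obtain as g where as: "finite as" "char_poly M = (\<Prod>a\<in>as. a ^ Suc (g a))" "as \<subseteq> {q. irreducible q \<and> monic q}"
    using monic_irreducible_factorization[OF mon] by blast
  have "a \<in> char_factors M" if a: "a \<in> as" for a
  proof -
    have "a ^ Suc (g a) dvd char_poly M" unfolding as(2) using as(1) a by (rule dvd_prodI)
    then have "a dvd char_poly M" by (rule dvd_trans[rotated]) simp
    then show ?thesis using as(3) a by (auto simp: char_factors_def)
  qed
  then have sub: "as \<subseteq> char_factors M" by blast
  show ?thesis
  proof (intro exI allI impI)
    fix e assume e: "\<forall>f\<in>char_factors M. (\<Sum>a\<in>as. Suc (g a)) \<le> e f"
    have "char_poly M dvd (\<Prod>a\<in>as. a ^ e a)"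
      unfolding as(2)
    proof (rule prod_dvd_prod)
      fix a assume a: "a \<in> as"
      have "Suc (g a) \<le> (\<Sum>a\<in>as. Suc (g a))" using as(1) a by (intro member_le_sum) auto
      also have "\<dots> \<le> e a" using e sub a by blast
      finally show "a ^ Suc (g a) dvd a ^ e a" by (rule le_imp_power_dvd)
    qed
    also have "\<dots> dvd (\<Prod>f\<in>char_factors M. f ^ e f)"
      using sub finite_char_factors[OF M] by (intro prod_dvd_prod_subset)
    finally show "char_poly M dvd (\<Prod>f\<in>char_factors M. f ^ e f)" .
  qed
qed

lemma single_char_factor_nilpotent:
  fixes M :: "'k::{field,finite} mat"
  assumes M: "M \<in> carrier_mat n n" and f: "char_factors M \<subseteq> {f}"
  shows "\<exists>N. poly_kernel M (f ^ N) = carrier_vec n"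
proof -
  obtain N where N: "\<And>e. \<forall>f\<in>char_factors M. N \<le> e f \<Longrightarrow> char_poly M dvd (\<Prod>f\<in>char_factors M. f ^ e f)"
    using char_poly_dvd_prod_char_factors[OF M] by blast
  have "(\<Prod>f\<in>char_factors M. f ^ N) dvd (\<Prod>f\<in>{f}. f ^ N)"
    using f by (intro prod_dvd_prod_subset) auto
  then have "char_poly M dvd f ^ N" using N[of "\<lambda>_. N"] dvd_trans by auto
  then have "poly_kernel M (char_poly M) \<subseteq> poly_kernel M (f ^ N)" by (rule poly_kernel_dvd_mono[OF M])
  then show ?thesis using poly_kernel_char_poly[OF M] poly_kernel_carrier[OF M] by blast
qed

text \<open>Any other irreducible polynomial \<open>F\<close> of the same degree can take over the role of \<open>f\<close>:
  with \<open>F \<circ> p = f u\<close>, \<open>u\<close> prime to \<open>f\<close>, the kernels of \<open>F(p(X))\<^sup>k\<close> and \<open>f(X)\<^sup>k\<close> agree.\<close>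

lemma change_irreducible:
  fixes X :: "'k::{field,finite} mat"
  assumes X: "X \<in> carrier_mat n n" and type: "has_class_type X {#(degree F, \<mu>)#}"
    and F: "irreducible F" "monic F"
  shows "\<exists>p. (\<forall>k. card (poly_kernel (poly_mat p X) (F ^ k)) = CARD('k) ^ (degree F * truncated_size \<mu> k)) \<and>
    (\<forall>G. irreducible G \<longrightarrow> monic G \<longrightarrow> G \<noteq> F \<longrightarrow> (\<forall>k. card (poly_kernel (poly_mat p X) (G ^ k)) = 1))"
proof -
  obtain L where L: "{#(degree F, \<mu>)#} = image_mset (\<lambda>f. (degree f, L f)) (mset_set (char_factors X))"
    "\<forall>f\<in>char_factors X. is_partition (L f) \<and> L f \<noteq> [] \<and>
      (\<forall>k. card (poly_kernel X (f ^ k)) = CARD('k) ^ (degree f * truncated_size (L f) k))"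
    using class_type_cards[OF X type] by blast
  obtain f M' where "mset_set (char_factors X) = add_mset f M'" "(degree f, L f) = (degree F, \<mu>)"
    "image_mset (\<lambda>f. (degree f, L f)) M' = {#}"
    using msed_map_invR[OF L(1)[symmetric]] by blast
  then have f: "mset_set (char_factors X) = {#f#}" "degree f = degree F" "L f = \<mu>" by simp_all
  have cf: "char_factors X = {f}"
    using arg_cong[OF f(1), of set_mset] finite_char_factors[OF X] by simp
  then have irr: "irreducible f" by (auto simp: char_factors_def)
  obtain p where p: "f dvd pcompose F p" "\<not> f ^ 2 dvd pcompose F p"
    using simple_root_mod_irreducible[OF irr F(1)] f(2) by auto
  obtain u where u: "pcompose F p = f * u" using p(1) unfolding dvd_def by blast
  \<comment> \<open>This is where \<open>f ^ 2\<close> must not divide \<open>F(p)\<close>.\<close>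
  have fu: "comaximal f u" using p(2) u irr by (intro irreducible_comaximal) (auto simp: power2_eq_square)
  obtain N where N: "poly_kernel X (f ^ N) = carrier_vec n"
    using single_char_factor_nilpotent[OF X equalityD1[OF cf]] by blast
  let ?P = "poly_mat p X"
  have P: "?P \<in> carrier_mat n n" using X by simp
  have kerP: "poly_kernel ?P q = poly_kernel X (pcompose q p)" for q
    using X by (auto simp: poly_kernel_def poly_mat_pcompose[OF X])
  have ker: "poly_kernel ?P (F ^ k) = poly_kernel X (f ^ k)" for k
  proof -
    have eq: "pcompose (F ^ k) p = u ^ k * f ^ k" by (simp add: pcompose_hom.hom_power u power_mult_distrib)
    have "v \<in> poly_kernel X (f ^ k)" if v: "v \<in> poly_kernel X (u ^ k * f ^ k)" for v
    proof -
      have vn: "v \<in> carrier_vec n" using v poly_kernel_carrier[OF X] by blast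
      let ?w = "poly_mat (f ^ k) X *\<^sub>v v"
      have wn: "?w \<in> carrier_vec n" by (rule mult_mat_vec_carrier[OF poly_mat_carrier[OF X] vn])
      have "?w \<in> poly_kernel X (u ^ k)"
        using v vn wn X poly_mat_mult_vec[OF X vn, of "u ^ k" "f ^ k"] by (simp add: poly_kernel_def)
      \<comment> \<open>As \<open>f(X)\<close> is nilpotent and \<open>u\<close> is prime to
        \<open>f\<close>, \<open>u(X) ^ k\<close> is injective and can be cancelled.\<close>
      moreover have "?w \<in> poly_kernel X (f ^ N)" using N wn by simp
      ultimately have "?w = 0\<^sub>v n"
        using poly_kernel_comaximal[OF X comaximal_powers[OF fu]] by blast
      then show ?thesis using vn X by (simp add: poly_kernel_def)
    qed
    then show ?thesis unfolding kerP eq using poly_kernel_mult_right[OF X] by blast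
  qed
  have "card (poly_kernel ?P (G ^ k)) = 1" if G: "irreducible G" "monic G" "G \<noteq> F" for G k
  proof -
    \<comment> \<open>Since \<open>F ^ N\<close> kills the whole space, every power of another
      irreducible polynomial acts injectively.\<close>
    have "\<not> G dvd F" using monic_irreducible_dvd_eq G F by blast
    then have "comaximal (G ^ k) (F ^ N)" using G by (intro comaximal_powers irreducible_comaximal)
    moreover have "poly_kernel ?P (F ^ N) = carrier_vec n" using ker N by simp
    ultimately have "poly_kernel ?P (G ^ k) \<subseteq> {0\<^sub>v n}"
      using poly_kernel_comaximal[OF P] poly_kernel_carrier[OF P] by blast
    then have "poly_kernel ?P (G ^ k) = {0\<^sub>v n}" using zero_in_poly_kernel[OF P] by blast
    then show ?thesis by simp
  qed
  moreover have "card (poly_kernel ?P (F ^ k)) = CARD('k) ^ (degree F * truncated_size \<mu> k)" for k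
    using L(2) cf f(2,3) ker by simp
  ultimately show ?thesis by blast
qed

section \<open>Block sums\<close>

lemma card_poly_kernel_four_block:
  assumes A: "A \<in> carrier_mat n n" and B: "B \<in> carrier_mat m m"
  shows "card (poly_kernel (four_block_mat A (0\<^sub>m n m) (0\<^sub>m m n) B) p)
    = card (poly_kernel A p) * card (poly_kernel B p)"
proof -
  let ?F = "four_block_mat A (0\<^sub>m n m) (0\<^sub>m m n) B"
  have F: "?F \<in> carrier_mat (n + m) (n + m)" by (rule four_block_carrier_mat[OF A B])
  have zero: "0\<^sub>v (n + m) = 0\<^sub>v n @\<^sub>v (0\<^sub>v m :: 'a vec)" by (intro eq_vecI) auto
  have iff: "a @\<^sub>v b \<in> poly_kernel ?F p \<longleftrightarrow> a \<in> poly_kernel A p \<and> b \<in> poly_kernel B p"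
    if a: "a \<in> carrier_vec n" and b: "b \<in> carrier_vec m" for a b
  proof -
    have pa: "poly_mat p A *\<^sub>v a \<in> carrier_vec n"
      by (rule mult_mat_vec_carrier[OF poly_mat_carrier[OF A] a])
    have "a @\<^sub>v b \<in> poly_kernel ?F p \<longleftrightarrow> poly_mat p ?F *\<^sub>v (a @\<^sub>v b) = 0\<^sub>v (n + m)"
      using F A B a b by (simp add: poly_kernel_def)
    also have "poly_mat p ?F *\<^sub>v (a @\<^sub>v b) = poly_mat p A *\<^sub>v a @\<^sub>v poly_mat p B *\<^sub>v b"
      unfolding poly_mat_four_block[OF A B]
      by (rule mult_mat_vec_split[OF poly_mat_carrier[OF A] poly_mat_carrier[OF B] a b])
    also have "\<dots> = 0\<^sub>v (n + m) \<longleftrightarrow> poly_mat p A *\<^sub>v a = 0\<^sub>v n \<and> poly_mat p B *\<^sub>v b = 0\<^sub>v m"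
      unfolding zero by (rule append_vec_eq[OF pa zero_carrier_vec])
    finally show ?thesis using A B a b by (simp add: poly_kernel_def)
  qed
  have "bij_betw (\<lambda>(a, b). a @\<^sub>v b) (poly_kernel A p \<times> poly_kernel B p) (poly_kernel ?F p)"
    unfolding bij_betw_def
  proof
    show "inj_on (\<lambda>(a, b). a @\<^sub>v b) (poly_kernel A p \<times> poly_kernel B p)"
      using poly_kernel_carrier[OF A] by (auto simp: inj_on_def append_vec_eq[of _ n] subset_eq)
    show "(\<lambda>(a, b). a @\<^sub>v b) ` (poly_kernel A p \<times> poly_kernel B p) = poly_kernel ?F p"
    proof (intro equalityI subsetI)
      fix v assume v: "v \<in> poly_kernel ?F p"
      then have vc: "v \<in> carrier_vec (n + m)" using poly_kernel_carrier[OF F] by blast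
      have ab: "vec_first v n @\<^sub>v vec_last v m \<in> poly_kernel ?F p" using v vec_first_last_append[OF vc] by simp
      have "vec_first v n \<in> poly_kernel A p \<and> vec_last v m \<in> poly_kernel B p"
        using iff[OF vec_first_carrier vec_last_carrier] ab by blast
      then show "v \<in> (\<lambda>(a, b). a @\<^sub>v b) ` (poly_kernel A p \<times> poly_kernel B p)"
        using vec_first_last_append[OF vc]
        by (intro image_eqI[of _ _ "(vec_first v n, vec_last v m)"]) auto
    next
      fix v assume "v \<in> (\<lambda>(a, b). a @\<^sub>v b) ` (poly_kernel A p \<times> poly_kernel B p)"
      then obtain a b where ab: "a \<in> poly_kernel A p" "b \<in> poly_kernel B p" "v = a @\<^sub>v b" by auto
      then show "v \<in> poly_kernel ?F p"
        using iff[of a b] subsetD[OF poly_kernel_carrier[OF A]] subsetD[OF poly_kernel_carrier[OF B]] by blast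
    qed
  qed
  then show ?thesis by (simp add: card_cartesian_product flip: bij_betw_same_card)
qed

lemma four_block_diag_mult:
  assumes "A \<in> carrier_mat n n" "B \<in> carrier_mat m m" "C \<in> carrier_mat n n" "D \<in> carrier_mat m m"
  shows "four_block_mat A (0\<^sub>m n m) (0\<^sub>m m n) B * four_block_mat C (0\<^sub>m n m) (0\<^sub>m m n) D
    = four_block_mat (A * C) (0\<^sub>m n m) (0\<^sub>m m n) (B * (D :: 'a::field mat))"
  using assms by (subst mult_four_block_mat[of _ n n _ m _ m]) auto

definition mset_truncated_size :: "nat multiset \<Rightarrow> nat \<Rightarrow> nat" where
  "mset_truncated_size A k = (\<Sum>x\<in>#A. min x k)"

text \<open>Each pair of blocks is adjusted to its prescribed labels before it is added. Blocks with
  equal labels then contribute to the same primary component, which undoes the separation on both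
  sides, while commutation is checked block by block.\<close>

lemma componentwise_block_sum:
  fixes ps qs :: "('k::{field,finite} poly \<times> nat list) list"
  assumes "list_all2 (\<lambda>(f, \<mu>) (g, \<nu>). types_commute TYPE('k) {#(degree f, \<mu>)#} {#(degree g, \<nu>)#}) ps qs"
    and "\<forall>(f, \<mu>)\<in>set ps. irreducible f \<and> monic f" and "\<forall>(g, \<nu>)\<in>set qs. irreducible g \<and> monic g"
  shows "\<exists>n. \<exists>X\<in>carrier_mat n n. \<exists>Y\<in>carrier_mat n n. X * Y = Y * X \<and>
    (\<forall>h k. irreducible h \<longrightarrow> monic h \<longrightarrow>
      card (poly_kernel X (h ^ k)) = CARD('k) ^ (degree h * mset_truncated_size (piece_sum (mset ps) h) k) \<and>
      card (poly_kernel Y (h ^ k)) = CARD('k) ^ (degree h * mset_truncated_size (piece_sum (mset qs) h) k))"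
  using assms
proof (induction rule: list_all2_induct)
  case Nil
  have "carrier_vec 0 = {0\<^sub>v 0 :: 'k vec}" by (auto intro!: eq_vecI simp del: zero_vec_zero)
  then have "poly_kernel (0\<^sub>m 0 0) p = {0\<^sub>v 0}" for p :: "'k poly"
    using zero_in_poly_kernel[of "0\<^sub>m 0 0" 0 p] poly_kernel_carrier[of "0\<^sub>m 0 0" 0 p] by auto
  then show ?case
    by (intro exI[of _ 0] bexI[of _ "0\<^sub>m 0 0"]) (auto simp: piece_sum_def mset_truncated_size_def)
next
  case (Cons x ps y qs)
  obtain f \<mu> g \<nu> where xy: "x = (f, \<mu>)" "y = (g, \<nu>)" by (cases x, cases y)
  have fg: "irreducible f" "monic f" "irreducible g" "monic g" using Cons.prems xy by auto
  obtain m X Y where X: "X \<in> carrier_mat m m" and Y: "Y \<in> carrier_mat m m" and XY: "X * Y = Y * X"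
    and tX: "has_class_type (X :: 'k mat) {#(degree f, \<mu>)#}" and tY: "has_class_type (Y :: 'k mat) {#(degree g, \<nu>)#}"
    using Cons.hyps(1) unfolding xy types_commute_def by auto
  obtain p where p: "\<forall>k. card (poly_kernel (poly_mat p X) (f ^ k)) = CARD('k) ^ (degree f * truncated_size \<mu> k)"
    "\<forall>h. irreducible h \<longrightarrow> monic h \<longrightarrow> h \<noteq> f \<longrightarrow> (\<forall>k. card (poly_kernel (poly_mat p X) (h ^ k)) = 1)"
    using change_irreducible[OF X tX fg(1,2)] by blast
  obtain q where q: "\<forall>k. card (poly_kernel (poly_mat q Y) (g ^ k)) = CARD('k) ^ (degree g * truncated_size \<nu> k)"
    "\<forall>h. irreducible h \<longrightarrow> monic h \<longrightarrow> h \<noteq> g \<longrightarrow> (\<forall>k. card (poly_kernel (poly_mat q Y) (h ^ k)) = 1)"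
    using change_irreducible[OF Y tY fg(3,4)] by blast
  let ?X = "poly_mat p X" and ?Y = "poly_mat q Y"
  have X': "?X \<in> carrier_mat m m" and Y': "?Y \<in> carrier_mat m m" using X Y by auto
  have XY': "?X * ?Y = ?Y * ?X" by (rule poly_mat_commute[OF X Y XY])
  obtain n X2 Y2 where X2: "X2 \<in> carrier_mat n n" and Y2: "Y2 \<in> carrier_mat n n" and XY2: "X2 * Y2 = Y2 * X2"
    and card2: "\<And>h k. irreducible h \<Longrightarrow> monic h \<Longrightarrow>
      card (poly_kernel X2 (h ^ k)) = CARD('k) ^ (degree h * mset_truncated_size (piece_sum (mset ps) h) k) \<and>
      card (poly_kernel Y2 (h ^ k)) = CARD('k) ^ (degree h * mset_truncated_size (piece_sum (mset qs) h) k)"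
    using Cons.IH Cons.prems by auto
  let ?F = "\<lambda>A B. four_block_mat A (0\<^sub>m m n) (0\<^sub>m n m) B"
  \<comment> \<open>The factor 1 for a label other than \<open>h\<close> corresponds to the trivial
    kernels that \<open>change_irreducible\<close> provides there.\<close>
  have size: "CARD('k) ^ (degree h * mset_truncated_size (piece_sum (mset (z # zs)) h) k)
      = (if h = fst z then CARD('k) ^ (degree h * truncated_size (snd z) k) else 1)
       * CARD('k) ^ (degree h * mset_truncated_size (piece_sum (mset zs) h) k)"
    for h k and z :: "'k poly \<times> nat list" and zs
    by (cases z) (auto simp: piece_sum_add_mset mset_truncated_size_def truncated_size_mset distrib_left power_add)
  show ?case
  proof (rule exI[of _ "m + n"], rule bexI[of _ "?F ?X X2"], rule bexI[of _ "?F ?Y Y2"], intro conjI allI impI)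
    show "?F ?X X2 * ?F ?Y Y2 = ?F ?Y Y2 * ?F ?X X2"
      using X' Y' X2 Y2 XY' XY2 by (simp add: four_block_diag_mult)
    fix h :: "'k poly" and k assume h: "irreducible h" "monic h"
    show "card (poly_kernel (?F ?X X2) (h ^ k))
        = CARD('k) ^ (degree h * mset_truncated_size (piece_sum (mset (x # ps)) h) k)"
      unfolding card_poly_kernel_four_block[OF X' X2] size using p h card2[OF h, of k] by (auto simp: xy)
    show "card (poly_kernel (?F ?Y Y2) (h ^ k))
        = CARD('k) ^ (degree h * mset_truncated_size (piece_sum (mset (y # qs)) h) k)"
      unfolding card_poly_kernel_four_block[OF Y' Y2] size using q h card2[OF h, of k] by (auto simp: xy)
  qed (use X' Y' X2 Y2 in \<open>auto intro!: four_block_carrier_mat\<close>)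
qed


text \<open>The representing matrices \<open>M1\<close> and \<open>M2\<close> are unrelated to each
  other. They only provide the irreducible polynomials used as labels, and kernel cardinalities that
  the commuting block sums reproduce.\<close>

theorem types_commute_of_separations:
  assumes S: "representable TYPE('k::{field,finite}) S" "is_separation S S'"
    and T: "representable TYPE('k) T" "is_separation T T'"
    and comm: "commute_componentwise TYPE('k) S' T'"
  shows "types_commute TYPE('k) S T"
proof -
  obtain n1 M1 n2 M2 where M1: "M1 \<in> carrier_mat n1 n1" "has_class_type (M1 :: 'k mat) S"
    and M2: "M2 \<in> carrier_mat n2 n2" "has_class_type (M2 :: 'k mat) T"
    using S(1) T(1) unfolding representable_def by blast
  let ?A1 = "char_factors M1" and ?A2 = "char_factors M2"
  obtain L1 where L1: "S = image_mset (\<lambda>f. (degree f, L1 f)) (mset_set ?A1)"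
    "\<forall>f\<in>?A1. is_partition (L1 f) \<and> L1 f \<noteq> [] \<and>
      (\<forall>k. card (poly_kernel M1 (f ^ k)) = CARD('k) ^ (degree f * truncated_size (L1 f) k))"
    using class_type_cards[OF M1] by blast
  obtain L2 where L2: "T = image_mset (\<lambda>f. (degree f, L2 f)) (mset_set ?A2)"
    "\<forall>f\<in>?A2. is_partition (L2 f) \<and> L2 f \<noteq> [] \<and>
      (\<forall>k. card (poly_kernel M2 (f ^ k)) = CARD('k) ^ (degree f * truncated_size (L2 f) k))"
    using class_type_cards[OF M2] by blast
  have A1: "monic f \<and> irreducible f" if "f \<in> ?A1" for f using that by (simp add: char_factors_def)
  have A2: "monic f \<and> irreducible f" if "f \<in> ?A2" for f using that by (simp add: char_factors_def)
  have "\<exists>P. S' = image_mset (\<lambda>(f, \<mu>). (degree f, \<mu>)) P \<and>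
    (\<forall>(f, \<mu>)\<in>#P. f \<in> ?A1 \<and> is_partition \<mu> \<and> \<mu> \<noteq> []) \<and> (\<forall>f\<in>?A1. piece_sum P f = mset (L1 f))"
    using L1(2) S(2) unfolding L1(1) by (intro is_separation_pieces[OF finite_char_factors[OF M1(1)]]) auto
  then obtain P where P: "S' = image_mset (\<lambda>(f, \<mu>). (degree f, \<mu>)) P"
    "\<forall>(f, \<mu>)\<in>#P. f \<in> ?A1 \<and> is_partition \<mu> \<and> \<mu> \<noteq> []" "\<forall>f\<in>?A1. piece_sum P f = mset (L1 f)" by blast
  have "\<exists>Q. T' = image_mset (\<lambda>(f, \<mu>). (degree f, \<mu>)) Q \<and>
    (\<forall>(f, \<mu>)\<in>#Q. f \<in> ?A2 \<and> is_partition \<mu> \<and> \<mu> \<noteq> []) \<and> (\<forall>f\<in>?A2. piece_sum Q f = mset (L2 f))"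
    using L2(2) T(2) unfolding L2(1) by (intro is_separation_pieces[OF finite_char_factors[OF M2(1)]]) auto
  then obtain Q where Q: "T' = image_mset (\<lambda>(f, \<mu>). (degree f, \<mu>)) Q"
    "\<forall>(f, \<mu>)\<in>#Q. f \<in> ?A2 \<and> is_partition \<mu> \<and> \<mu> \<noteq> []" "\<forall>f\<in>?A2. piece_sum Q f = mset (L2 f)" by blast
  obtain ss ts where st: "mset ss = S'" "mset ts = T'" "list_all2 (\<lambda>s t. types_commute TYPE('k) {#s#} {#t#}) ss ts"
    using comm unfolding commute_componentwise_def by blast
  \<comment> \<open>The lists that pair the components of \<open>S'\<close> and \<open>T'\<close>
    are lifted to labelled pieces, so each pair knows its two polynomials.\<close>
  obtain ps where ps: "mset ps = P" "map (\<lambda>(f, \<mu>). (degree f, \<mu>)) ps = ss"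
    using image_mset_eq_mset_map[of ss] st(1) P(1) by blast
  obtain qs where qs: "mset qs = Q" "map (\<lambda>(f, \<mu>). (degree f, \<mu>)) qs = ts"
    using image_mset_eq_mset_map[of ts] st(2) Q(1) by blast
  have all2: "list_all2 (\<lambda>(f, \<mu>) (g, \<nu>). types_commute TYPE('k) {#(degree f, \<mu>)#} {#(degree g, \<nu>)#}) ps qs"
    using st(3) unfolding ps(2)[symmetric] qs(2)[symmetric] list_all2_map1 list_all2_map2
    by (rule list_all2_mono) (auto split: prod.splits)
  have "\<forall>(f, \<mu>)\<in>set ps. irreducible f \<and> monic f" "\<forall>(g, \<nu>)\<in>set qs. irreducible g \<and> monic g"
    using P(2) Q(2) A1 A2 unfolding ps(1)[symmetric] qs(1)[symmetric] by auto
  from componentwise_block_sum[OF all2 this] obtain n X Y where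
    X: "X \<in> carrier_mat n n" and Y: "Y \<in> carrier_mat n n" and XY: "X * Y = Y * X"
    and card: "\<And>h k. irreducible h \<Longrightarrow> monic h \<Longrightarrow>
      card (poly_kernel X (h ^ k)) = CARD('k) ^ (degree h * mset_truncated_size (piece_sum P h) k) \<and>
      card (poly_kernel Y (h ^ k)) = CARD('k) ^ (degree h * mset_truncated_size (piece_sum Q h) k)"
    unfolding ps(1) qs(1) by blast
  have "has_class_type X (image_mset (\<lambda>f. (degree f, L1 f)) (mset_set ?A1))"
  proof (rule class_type_intro[OF X A1])
    show "is_partition (L1 f) \<and> L1 f \<noteq> []" if "f \<in> ?A1" for f using L1(2) that by blast
    show "card (poly_kernel X (f ^ k)) = CARD('k) ^ (degree f * truncated_size (L1 f) k)" if "f \<in> ?A1" for f k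
      using card[of f k] A1[OF that] P(3) that by (simp add: mset_truncated_size_def truncated_size_mset)
    fix f :: "'k poly" assume f: "monic f" "irreducible f" "f \<notin> ?A1"
    have "piece_sum P f = {#}" unfolding piece_sum_def by (rule sum_mset.neutral) (use P(2) f(3) in auto)
    then show "card (poly_kernel X f) = 1" using card[of f 1] f by (simp add: mset_truncated_size_def)
  qed
  moreover have "has_class_type Y (image_mset (\<lambda>f. (degree f, L2 f)) (mset_set ?A2))"
  proof (rule class_type_intro[OF Y A2])
    show "is_partition (L2 f) \<and> L2 f \<noteq> []" if "f \<in> ?A2" for f using L2(2) that by blast
    show "card (poly_kernel Y (f ^ k)) = CARD('k) ^ (degree f * truncated_size (L2 f) k)" if "f \<in> ?A2" for f k
      using card[of f k] A2[OF that] Q(3) that by (simp add: mset_truncated_size_def truncated_size_mset)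
    fix f :: "'k poly" assume f: "monic f" "irreducible f" "f \<notin> ?A2"
    have "piece_sum Q f = {#}" unfolding piece_sum_def by (rule sum_mset.neutral) (use Q(2) f(3) in auto)
    then show "card (poly_kernel Y f) = 1" using card[of f 1] f by (simp add: mset_truncated_size_def)
  qed
  ultimately show ?thesis unfolding types_commute_def L1(1)[symmetric] L2(1)[symmetric] using X Y XY by blast
qed

section \<open>Subspaces and basis matrices\<close>

definition vec_subspace :: "nat \<Rightarrow> 'k::field vec set \<Rightarrow> bool" where
  "vec_subspace n V \<longleftrightarrow> V \<subseteq> carrier_vec n \<and> 0\<^sub>v n \<in> V \<and> (\<forall>v\<in>V. \<forall>w\<in>V. v + w \<in> V) \<and> (\<forall>c. \<forall>v\<in>V. c \<cdot>\<^sub>v v \<in> V)"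

text \<open>A basis is kept as an injective matrix \<open>B\<close>, which later intertwines a
  matrix with its restriction. A vector outside the image is appended as a new column; the image
  grows within the finite set \<open>V\<close>.\<close>

lemma extend_basis_matrix:
  fixes V :: "'k::{field,finite} vec set"
  assumes V: "vec_subspace n V"
  shows "\<lbrakk>B \<in> carrier_mat n m; \<And>w. w \<in> carrier_vec m \<Longrightarrow> B *\<^sub>v w = 0\<^sub>v n \<Longrightarrow> w = 0\<^sub>v m;
    (\<lambda>w. B *\<^sub>v w) ` carrier_vec m \<subseteq> V\<rbrakk> \<Longrightarrow>
    \<exists>m'. \<exists>B'\<in>carrier_mat n m'. (\<forall>w\<in>carrier_vec m'. B' *\<^sub>v w = 0\<^sub>v n \<longrightarrow> w = 0\<^sub>v m') \<and>
      (\<lambda>w. B' *\<^sub>v w) ` carrier_vec m' = V"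
proof (induction "card V - card ((\<lambda>w. B *\<^sub>v w) ` carrier_vec m)" arbitrary: B m rule: less_induct)
  case less
  note B = less.prems(1)
  let ?im = "(\<lambda>w. B *\<^sub>v w) ` carrier_vec m"
  have Vn: "V \<subseteq> carrier_vec n" using V by (simp add: vec_subspace_def)
  then have finV: "finite V" using finite_carrier_vec finite_subset by blast
  show ?case
  proof (cases "?im = V")
    case True
    then show ?thesis using less.prems by blast
  next
    case False
    then obtain v where v: "v \<in> V" "v \<notin> ?im" using less.prems(3) by blast
    have vn: "v \<in> carrier_vec n" using v Vn by blast
    define B' where "B' = mat n (Suc m) (\<lambda>(i, j). if j < m then B $$ (i, j) else v $ i)"
    have B': "B' \<in> carrier_mat n (Suc m)" by (simp add: B'_def)
    have B'w: "B' *\<^sub>v w = B *\<^sub>v vec m (($) w) + w $ m \<cdot>\<^sub>v v" if w: "w \<in> carrier_vec (Suc m)" for w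
    proof (rule eq_vecI)
      fix i assume "i < dim_vec (B *\<^sub>v vec m (($) w) + w $ m \<cdot>\<^sub>v v)"
      then have i: "i < n" using vn by simp
      have "(B' *\<^sub>v w) $ i = (\<Sum>j<Suc m. B' $$ (i, j) * w $ j)"
        using B' i w by (simp add: scalar_prod_def atLeast0LessThan)
      also have "\<dots> = (\<Sum>j<m. B $$ (i, j) * w $ j) + v $ i * w $ m"
        using i by (simp add: B'_def)
      finally show "(B' *\<^sub>v w) $ i = (B *\<^sub>v vec m (($) w) + w $ m \<cdot>\<^sub>v v) $ i"
        using B vn i by (simp add: scalar_prod_def atLeast0LessThan mult.commute)
    qed (use B B' vn in auto)
    have inj: "w = 0\<^sub>v (Suc m)" if w: "w \<in> carrier_vec (Suc m)" and 0: "B' *\<^sub>v w = 0\<^sub>v n" for w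
    proof -
      let ?w = "vec m (($) w)" and ?c = "w $ m"
      have Bw: "B *\<^sub>v ?w \<in> carrier_vec n" using B by (intro mult_mat_vec_carrier) auto
      have sum: "B *\<^sub>v ?w + ?c \<cdot>\<^sub>v v = 0\<^sub>v n" using 0 B'w[OF w] by simp
      \<comment> \<open>A nonzero last coordinate would put the new column \<open>v\<close> into the
        image of \<open>B\<close>.\<close>
      have c: "?c = 0"
      proof (rule ccontr)
        assume c: "?c \<noteq> 0"
        have "v = B *\<^sub>v ((- inverse ?c) \<cdot>\<^sub>v ?w)"
        proof (rule eq_vecI)
          fix i assume "i < dim_vec (B *\<^sub>v ((- inverse ?c) \<cdot>\<^sub>v ?w))"
          then have i: "i < n" using B by simp
          have "(B *\<^sub>v ?w) $ i + ?c * v $ i = 0"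
            using arg_cong[OF sum, of "\<lambda>x. x $ i"] i vn Bw by simp
          then have "?c * v $ i = - ((B *\<^sub>v ?w) $ i)" by (simp add: eq_neg_iff_add_eq_0 add.commute)
          then have "v $ i = - inverse ?c * (B *\<^sub>v ?w) $ i" using c by (simp add: field_simps)
          also have "\<dots> = (B *\<^sub>v ((- inverse ?c) \<cdot>\<^sub>v ?w)) $ i"
            using B i by (subst mult_mat_vec[OF B]) auto
          finally show "v $ i = (B *\<^sub>v ((- inverse ?c) \<cdot>\<^sub>v ?w)) $ i" .
        qed (use B vn in auto)
        then have "v \<in> ?im" by (rule image_eqI) simp
        then show False using v(2) by blast
      qed
      have "B *\<^sub>v ?w + 0 \<cdot>\<^sub>v v = B *\<^sub>v ?w" using B vn by (intro eq_vecI) auto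
      then have "B *\<^sub>v ?w = 0\<^sub>v n" using sum c by simp
      then have "?w = 0\<^sub>v m" using less.prems(2) by simp
      then have "w $ i = 0" if "i < m" for i using that by (metis index_vec index_zero_vec(1))
      then show ?thesis using w c by (intro eq_vecI) (auto simp: less_Suc_eq)
    qed
    let ?im' = "(\<lambda>w. B' *\<^sub>v w) ` carrier_vec (Suc m)"
    have im': "?im' \<subseteq> V"
    proof clarify
      fix w :: "'k vec" assume w: "w \<in> carrier_vec (Suc m)"
      have "B *\<^sub>v vec m (($) w) \<in> V" using less.prems(3) by (auto simp: image_subset_iff)
      moreover have "w $ m \<cdot>\<^sub>v v \<in> V" using V v(1) by (auto simp: vec_subspace_def)
      ultimately show "B' *\<^sub>v w \<in> V" using V unfolding B'w[OF w] by (auto simp: vec_subspace_def)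
    qed
    have "?im \<subset> ?im'"
    proof
      show "?im \<subseteq> ?im'"
      proof clarify
        fix w :: "'k vec" assume w: "w \<in> carrier_vec m"
        let ?w = "vec (Suc m) (\<lambda>j. if j < m then w $ j else 0)"
        have "vec m (($) ?w) = w" using w by (intro eq_vecI) auto
        moreover have "B *\<^sub>v w + 0 \<cdot>\<^sub>v v = B *\<^sub>v w" using B vn by (intro eq_vecI) auto
        ultimately have "B' *\<^sub>v ?w = B *\<^sub>v w" using B'w[of ?w] by simp
        then show "B *\<^sub>v w \<in> ?im'" by (intro image_eqI[of _ _ ?w]) auto
      qed
      let ?u = "vec (Suc m) (\<lambda>j. if j < m then 0 else 1)"
      have u: "vec m (($) ?u) = 0\<^sub>v m" by (intro eq_vecI) auto
      have "B *\<^sub>v vec m (($) ?u) = 0\<^sub>v n" unfolding u using B by (intro eq_vecI) auto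
      then have "B' *\<^sub>v ?u = 0\<^sub>v n + ?u $ m \<cdot>\<^sub>v v" using B'w[of ?u] by simp
      then have "B' *\<^sub>v ?u = v" using vn by simp
      then have "v \<in> ?im'" by (intro image_eqI[of _ _ ?u]) auto
      then show "?im \<noteq> ?im'" using v(2) by blast
    qed
    then have "card ?im < card ?im'" using finite_subset[OF im' finV] by (intro psubset_card_mono)
    moreover have "card ?im' \<le> card V" by (rule card_mono[OF finV im'])
    ultimately have "card V - card ?im' < card V - card ?im" by simp
    from less.hyps[OF this B' inj im'] show ?thesis .
  qed
qed

lemma basis_matrix_exists:
  fixes V :: "'k::{field,finite} vec set"
  assumes V: "vec_subspace n V"
  shows "\<exists>m. \<exists>B\<in>carrier_mat n m. (\<forall>w\<in>carrier_vec m. B *\<^sub>v w = 0\<^sub>v n \<longrightarrow> w = 0\<^sub>v m) \<and>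
    (\<lambda>w. B *\<^sub>v w) ` carrier_vec m = V"
\<comment> \<open>The construction starts from the matrix without columns.\<close>
proof (rule extend_basis_matrix[OF V, of "0\<^sub>m n 0" 0])
  have "0\<^sub>m n 0 *\<^sub>v w = 0\<^sub>v n" if "w \<in> carrier_vec 0" for w :: "'k vec"
    using that by (intro eq_vecI) (auto simp: scalar_prod_def)
  then show "(\<lambda>w. 0\<^sub>m n 0 *\<^sub>v w) ` carrier_vec 0 \<subseteq> V" using V by (auto simp: vec_subspace_def)
qed (auto intro!: eq_vecI simp del: zero_vec_zero)

section \<open>Invariant subspaces and joint primary decomposition\<close>

text \<open>If the columns of \<open>B\<close> are a basis of \<open>V\<close>, invariance gives
  \<open>X B = B X'\<close>. Then \<open>B\<close> maps the kernel of \<open>p(X')\<close>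
  bijectively onto the part of the kernel of \<open>p(X)\<close> in \<open>V\<close>, and
  commutation of \<open>X'\<close> and \<open>Y'\<close> follows by cancelling
  \<open>B\<close>.\<close>

lemma restrict_to_subspace:
  fixes X Y :: "'k::{field,finite} mat"
  assumes X: "X \<in> carrier_mat n n" and Y: "Y \<in> carrier_mat n n" and XY: "X * Y = Y * X"
    and V: "vec_subspace n V" and XV: "\<And>v. v \<in> V \<Longrightarrow> X *\<^sub>v v \<in> V" and YV: "\<And>v. v \<in> V \<Longrightarrow> Y *\<^sub>v v \<in> V"
  shows "\<exists>m. \<exists>X'\<in>carrier_mat m m. \<exists>Y'\<in>carrier_mat m m. X' * Y' = Y' * X' \<and>
    (\<forall>p. card (poly_kernel X' p) = card (V \<inter> poly_kernel X p)) \<and>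
    (\<forall>p. card (poly_kernel Y' p) = card (V \<inter> poly_kernel Y p))"
proof -
  have "\<exists>m. \<exists>B\<in>carrier_mat n m. (\<forall>w\<in>carrier_vec m. B *\<^sub>v w = 0\<^sub>v n \<longrightarrow> w = 0\<^sub>v m) \<and>
    (\<lambda>w. B *\<^sub>v w) ` carrier_vec m = V"
    by (rule basis_matrix_exists[OF V])
  then obtain m B where B: "B \<in> carrier_mat n m" and ker: "\<forall>w\<in>carrier_vec m. B *\<^sub>v w = 0\<^sub>v n \<longrightarrow> w = 0\<^sub>v m"
    and im: "(\<lambda>w. B *\<^sub>v w) ` carrier_vec m = V" by auto
  have inj: "v = w" if v: "v \<in> carrier_vec m" and w: "w \<in> carrier_vec m" and eq: "B *\<^sub>v v = B *\<^sub>v w" for v w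
  proof -
    have "B *\<^sub>v (v - w) = 0\<^sub>v n"
      using B eq mult_minus_distrib_mat_vec[OF B v w] mult_mat_vec_carrier[OF B w] by simp
    then have d: "v - w = 0\<^sub>v m" using ker v w by simp
    show ?thesis
    proof (rule eq_vecI)
      fix i assume "i < dim_vec w"
      then show "v $ i = w $ i" using arg_cong[OF d, of "\<lambda>x. x $ i"] v w by simp
    qed (use v w in simp)
  qed
  have cancel: "C = D" if C: "C \<in> carrier_mat m m" and D: "D \<in> carrier_mat m m" and eq: "B * C = B * D" for C D
  proof (rule mat_col_eqI)
    fix j assume "j < dim_col D"
    then have j: "j < m" using D by simp
    have "B *\<^sub>v col C j = B *\<^sub>v col D j"
      using arg_cong[OF eq, of "\<lambda>M. col M j"] col_mult2[OF B C j] col_mult2[OF B D j] by simp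
    then show "col C j = col D j" by (rule inj[OF col_carrier_vec[OF j C] col_carrier_vec[OF j D]])
  qed (use C D in auto)
  \<comment> \<open>The columns of \<open>Z'\<close> are the coordinates of the images of the basis
    vectors under \<open>Z\<close>.\<close>
  have lift: "\<exists>Z'\<in>carrier_mat m m. Z * B = B * Z'"
    if Z: "Z \<in> carrier_mat n n" and ZV: "\<And>v. v \<in> V \<Longrightarrow> Z *\<^sub>v v \<in> V" for Z
  proof -
    have "\<forall>j\<in>{..<m}. \<exists>x. x \<in> carrier_vec m \<and> Z *\<^sub>v col B j = B *\<^sub>v x"
    proof
      fix j assume "j \<in> {..<m}"
      then have "col B j = B *\<^sub>v unit_vec m j"
        using B by (intro eq_vecI) (auto simp: scalar_prod_right_unit)
      then have "col B j \<in> V" using im by auto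
      then have "Z *\<^sub>v col B j \<in> (\<lambda>w. B *\<^sub>v w) ` carrier_vec m" using ZV im by simp
      then show "\<exists>x. x \<in> carrier_vec m \<and> Z *\<^sub>v col B j = B *\<^sub>v x" by auto
    qed
    from bchoice[OF this] obtain x where x: "\<And>j. j < m \<Longrightarrow> x j \<in> carrier_vec m \<and> Z *\<^sub>v col B j = B *\<^sub>v x j"
      by auto
    define Z' where "Z' = mat m m (\<lambda>(i, j). x j $ i)"
    have Z': "Z' \<in> carrier_mat m m" by (simp add: Z'_def)
    have "Z * B = B * Z'"
    proof (rule mat_col_eqI)
      fix j assume "j < dim_col (B * Z')"
      then have j: "j < m" using Z' by simp
      have "col Z' j = x j" using x[OF j] j by (intro eq_vecI) (auto simp: Z'_def)
      then show "col (Z * B) j = col (B * Z') j"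
        using x[OF j] col_mult2[OF Z B j] col_mult2[OF B Z' j] by simp
    qed (use B Z Z' in auto)
    then show ?thesis using Z' by blast
  qed
  have card: "card (poly_kernel Z' p) = card (V \<inter> poly_kernel Z p)"
    if Z: "Z \<in> carrier_mat n n" and Z': "Z' \<in> carrier_mat m m" and ZB: "Z * B = B * Z'" for Z Z' p
  proof -
    have iff: "B *\<^sub>v w \<in> poly_kernel Z p \<longleftrightarrow> w \<in> poly_kernel Z' p" if w: "w \<in> carrier_vec m" for w
    proof -
      have pw: "poly_mat p Z' *\<^sub>v w \<in> carrier_vec m"
        by (rule mult_mat_vec_carrier[OF poly_mat_carrier[OF Z'] w])
      have "poly_mat p Z *\<^sub>v (B *\<^sub>v w) = (poly_mat p Z * B) *\<^sub>v w"
        by (rule assoc_mult_mat_vec[OF poly_mat_carrier[OF Z] B w, symmetric])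
      also have "poly_mat p Z * B = B * poly_mat p Z'" by (rule poly_mat_intertwine[OF Z Z' B ZB])
      also have "\<dots> *\<^sub>v w = B *\<^sub>v (poly_mat p Z' *\<^sub>v w)"
        by (rule assoc_mult_mat_vec[OF B poly_mat_carrier[OF Z'] w])
      also have "\<dots> = 0\<^sub>v n \<longleftrightarrow> poly_mat p Z' *\<^sub>v w = 0\<^sub>v m"
        using ker pw B by (auto intro!: eq_vecI)
      finally show ?thesis using Z Z' w mult_mat_vec_carrier[OF B w] by (simp add: poly_kernel_def)
    qed
    have "bij_betw (\<lambda>w. B *\<^sub>v w) (poly_kernel Z' p) (V \<inter> poly_kernel Z p)"
      unfolding bij_betw_def
    proof
      show "inj_on (\<lambda>w. B *\<^sub>v w) (poly_kernel Z' p)"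
        using inj poly_kernel_carrier[OF Z'] by (intro inj_onI) blast
      show "(\<lambda>w. B *\<^sub>v w) ` poly_kernel Z' p = V \<inter> poly_kernel Z p"
        unfolding im[symmetric] using iff poly_kernel_carrier[OF Z', of p] by (auto simp: subset_eq)
    qed
    then show ?thesis by (rule bij_betw_same_card)
  qed
  obtain X' where X': "X' \<in> carrier_mat m m" "X * B = B * X'" using lift[OF X XV] by blast
  obtain Y' where Y': "Y' \<in> carrier_mat m m" "Y * B = B * Y'" using lift[OF Y YV] by blast
  have twice: "B * (Z1' * Z2') = Z1 * (Z2 * B)"
    if "Z1 \<in> carrier_mat n n" "Z1' \<in> carrier_mat m m" "Z1 * B = B * Z1'"
      "Z2' \<in> carrier_mat m m" "Z2 * B = B * Z2'" for Z1 Z1' Z2 Z2'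
  proof -
    have "B * (Z1' * Z2') = (B * Z1') * Z2'" by (rule assoc_mult_mat[OF B that(2,4), symmetric])
    also have "\<dots> = Z1 * (B * Z2')" unfolding that(3)[symmetric] by (rule assoc_mult_mat[OF that(1) B that(4)])
    finally show ?thesis unfolding that(5) .
  qed
  have "B * (X' * Y') = X * (Y * B)" by (rule twice[OF X X' Y'])
  also have "\<dots> = Y * (X * B)"
    unfolding assoc_mult_mat[OF X Y B, symmetric] assoc_mult_mat[OF Y X B, symmetric] XY ..
  also have "\<dots> = B * (Y' * X')" by (rule twice[OF Y Y' X', symmetric])
  finally have "X' * Y' = Y' * X'"
    by (rule cancel[OF mult_carrier_mat[OF X'(1) Y'(1)] mult_carrier_mat[OF Y'(1) X'(1)]])
  then show ?thesis using X' Y' card[OF X] card[OF Y] by blast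
qed

section \<open>Primary decomposition of invariant subspaces\<close>

definition poly_invariant :: "'k::field mat \<Rightarrow> 'k vec set \<Rightarrow> bool" where
  "poly_invariant M W \<longleftrightarrow> vec_subspace (dim_row M) W \<and> (\<forall>p. \<forall>v\<in>W. poly_mat p M *\<^sub>v v \<in> W)"

text \<open>For \<open>r * a + s * b = 1\<close>, the polynomials \<open>s * b\<close> and
  \<open>r * a\<close> act on the kernel of \<open>a * b\<close> as the projections onto the kernels
  of \<open>a\<close> and \<open>b\<close>. Being polynomials in \<open>M\<close>, they preserve
  \<open>W\<close>.\<close>

lemma card_comaximal_split:
  fixes M :: "'k::{field,finite} mat"
  assumes M: "M \<in> carrier_mat n n" and W: "poly_invariant M W" and ab: "comaximal a b"
  shows "card (W \<inter> poly_kernel M (a * b)) = card (W \<inter> poly_kernel M a) * card (W \<inter> poly_kernel M b)"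
proof -
  obtain r s where rs: "r * a + s * b = 1" using ab unfolding comaximal_def by blast
  have Wadd: "v + w \<in> W" if "v \<in> W" "w \<in> W" for v w
    using W that by (auto simp: poly_invariant_def vec_subspace_def)
  have Wp: "poly_mat p M *\<^sub>v v \<in> W" if "v \<in> W" for p v using W that by (auto simp: poly_invariant_def)
  note Kn = subsetD[OF poly_kernel_carrier[OF M]]
  have pc: "poly_mat p M *\<^sub>v v \<in> carrier_vec n" if "v \<in> carrier_vec n" for p v
    by (rule mult_mat_vec_carrier[OF poly_mat_carrier[OF M] that])
  have kerI: "poly_mat p M *\<^sub>v v \<in> poly_kernel M q"
    if "v \<in> poly_kernel M (a * b)" "a * b dvd q * p" for p q v
  proof -
    have v: "v \<in> carrier_vec n" by (rule Kn[OF that(1)])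
    have "v \<in> poly_kernel M (q * p)" using poly_kernel_dvd_mono[OF M that(2)] that(1) by blast
    then show ?thesis using v pc[OF v] M poly_mat_mult_vec[OF M v, of q p] by (simp add: poly_kernel_def)
  qed
  have split: "poly_mat (r * a) M *\<^sub>v v + poly_mat (s * b) M *\<^sub>v v = v" if v: "v \<in> carrier_vec n" for v
  proof -
    have "poly_mat (r * a) M *\<^sub>v v + poly_mat (s * b) M *\<^sub>v v = poly_mat (r * a + s * b) M *\<^sub>v v"
      unfolding poly_mat_add[OF M]
      by (rule add_mult_distrib_mat_vec[OF poly_mat_carrier[OF M] poly_mat_carrier[OF M] v, symmetric])
    then show ?thesis using v M by (simp add: rs poly_mat_1)
  qed
  have "bij_betw (\<lambda>(v, w). v + w) ((W \<inter> poly_kernel M a) \<times> (W \<inter> poly_kernel M b)) (W \<inter> poly_kernel M (a * b))"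
    unfolding bij_betw_def
  proof
    have proj: "poly_mat (s * b) M *\<^sub>v (v + w) = v"
      if v: "v \<in> poly_kernel M a" and w: "w \<in> poly_kernel M b" for v w
    proof -
      have "poly_mat (s * b) M *\<^sub>v (v + w) = poly_mat (s * b) M *\<^sub>v v + poly_mat (s * b) M *\<^sub>v w"
        by (rule mult_add_distrib_mat_vec[OF poly_mat_carrier[OF M] Kn[OF v] Kn[OF w]])
      \<comment> \<open>Both sides are zero; in this form the sum is the decomposition of
        \<open>v\<close> given by \<open>split\<close>.\<close>
      also have "poly_mat (s * b) M *\<^sub>v w = poly_mat (r * a) M *\<^sub>v v"
        using poly_kernel_mult_right[OF M w, of s] poly_kernel_mult_right[OF M v, of r] M
        by (simp add: poly_kernel_def)
      also have "poly_mat (s * b) M *\<^sub>v v + poly_mat (r * a) M *\<^sub>v v = v"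
        using split[OF Kn[OF v]] comm_add_vec[OF pc[OF Kn[OF v]] pc[OF Kn[OF v]]] by simp
      finally show ?thesis .
    qed
    have proj2: "poly_mat (r * a) M *\<^sub>v (v + w) = w"
      if v: "v \<in> poly_kernel M a" and w: "w \<in> poly_kernel M b" for v w
    proof -
      have "poly_mat (r * a) M *\<^sub>v (v + w) = poly_mat (r * a) M *\<^sub>v v + poly_mat (r * a) M *\<^sub>v w"
        by (rule mult_add_distrib_mat_vec[OF poly_mat_carrier[OF M] Kn[OF v] Kn[OF w]])
      also have "poly_mat (r * a) M *\<^sub>v v = poly_mat (s * b) M *\<^sub>v w"
        using poly_kernel_mult_right[OF M w, of s] poly_kernel_mult_right[OF M v, of r] M
        by (simp add: poly_kernel_def)
      also have "poly_mat (s * b) M *\<^sub>v w + poly_mat (r * a) M *\<^sub>v w = w"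
        using split[OF Kn[OF w]] comm_add_vec[OF pc[OF Kn[OF w]] pc[OF Kn[OF w]]] by simp
      finally show ?thesis .
    qed
    show "inj_on (\<lambda>(v, w). v + w) ((W \<inter> poly_kernel M a) \<times> (W \<inter> poly_kernel M b))"
    proof (rule inj_onI, clarify)
      fix v w v' w' assume *: "v \<in> poly_kernel M a" "w \<in> poly_kernel M b" "v' \<in> poly_kernel M a" "w' \<in> poly_kernel M b"
        and eq: "v + w = v' + w'"
      show "v = v' \<and> w = w'"
        using proj[OF *(1,2)] proj[OF *(3,4)] proj2[OF *(1,2)] proj2[OF *(3,4)] unfolding eq by simp
    qed
    show "(\<lambda>(v, w). v + w) ` ((W \<inter> poly_kernel M a) \<times> (W \<inter> poly_kernel M b)) = W \<inter> poly_kernel M (a * b)"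
    proof (intro equalityI subsetI)
      fix x assume "x \<in> (\<lambda>(v, w). v + w) ` ((W \<inter> poly_kernel M a) \<times> (W \<inter> poly_kernel M b))"
      then obtain v w where vw: "v \<in> W" "v \<in> poly_kernel M a" "w \<in> W" "w \<in> poly_kernel M b" "x = v + w" by auto
      have "v \<in> poly_kernel M (a * b)" "w \<in> poly_kernel M (a * b)"
        using vw(2,4) poly_kernel_dvd_mono[OF M, of a "a * b"] poly_kernel_dvd_mono[OF M, of b "a * b"] by auto
      then show "x \<in> W \<inter> poly_kernel M (a * b)" using vw Wadd poly_kernel_add[OF M] by simp
    next
      fix x assume x: "x \<in> W \<inter> poly_kernel M (a * b)"
      then have xn: "x \<in> carrier_vec n" using Kn by blast
      have "x = poly_mat (s * b) M *\<^sub>v x + poly_mat (r * a) M *\<^sub>v x"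
        using split[OF xn] comm_add_vec[OF pc[OF xn] pc[OF xn]] by simp
      moreover have "poly_mat (s * b) M *\<^sub>v x \<in> W \<inter> poly_kernel M a"
        using x Wp by (auto intro!: kerI simp: mult.left_commute)
      moreover have "poly_mat (r * a) M *\<^sub>v x \<in> W \<inter> poly_kernel M b"
        using x Wp by (auto intro!: kerI simp: mult_ac)
      ultimately show "x \<in> (\<lambda>(v, w). v + w) ` ((W \<inter> poly_kernel M a) \<times> (W \<inter> poly_kernel M b))"
        by (intro image_eqI[of _ _ "(poly_mat (s * b) M *\<^sub>v x, poly_mat (r * a) M *\<^sub>v x)"]) auto
    qed
  qed
  then have "card (W \<inter> poly_kernel M (a * b)) = card ((W \<inter> poly_kernel M a) \<times> (W \<inter> poly_kernel M b))"
    by (rule bij_betw_same_card[symmetric])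
  then show ?thesis by (simp add: card_cartesian_product)
qed

definition primary_part :: "'k::field mat \<Rightarrow> 'k poly \<Rightarrow> 'k vec set" where
  "primary_part M f = (\<Union>k. poly_kernel M (f ^ k))"

lemma primary_part_eq_poly_kernel:
  fixes M :: "'k::{field,finite} mat"
  assumes M: "M \<in> carrier_mat n n"
  shows "\<exists>N. \<forall>k\<ge>N. primary_part M f = poly_kernel M (f ^ k)"
proof -
  obtain N where N: "primary_part M f = poly_kernel M (f ^ N)"
    using primary_part_bounded[OF M] unfolding primary_part_def by blast
  have "primary_part M f = poly_kernel M (f ^ k)" if "N \<le> k" for k
    using poly_kernel_dvd_mono[OF M le_imp_power_dvd[OF that, of f]] N by (auto simp: primary_part_def)
  then show ?thesis by blast
qed

lemma comaximal_prod:
  "finite B \<Longrightarrow> (\<And>g. g \<in> B \<Longrightarrow> comaximal (F g) c) \<Longrightarrow> comaximal (\<Prod>g\<in>B. F g) c"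
proof (induction B rule: finite_induct)
  case empty
  show ?case by (simp add: comaximal_def) (metis add.right_neutral mult_1 mult_zero_left)
qed (simp add: comaximal_mult)

theorem card_eq_prod_primary_parts:
  fixes M :: "'k::{field,finite} mat"
  assumes M: "M \<in> carrier_mat n n" and W: "poly_invariant M W"
  shows "card W = (\<Prod>g\<in>char_factors M. card (W \<inter> primary_part M g))"
proof -
  have fin: "finite (char_factors M)" by (rule finite_char_factors[OF M])
  obtain N where N: "\<And>e. \<forall>f\<in>char_factors M. N \<le> e f \<Longrightarrow> char_poly M dvd (\<Prod>f\<in>char_factors M. f ^ e f)"
    using char_poly_dvd_prod_char_factors[OF M] by blast
  have "\<forall>f. \<exists>K. \<forall>k\<ge>K. primary_part M f = poly_kernel M (f ^ k)"
    using primary_part_eq_poly_kernel[OF M] by blast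
  from choice[OF this] obtain K where K: "\<And>f k. K f \<le> k \<Longrightarrow> primary_part M f = poly_kernel M (f ^ k)" by blast
  \<comment> \<open>Large enough for two purposes: the product of the powers is a multiple of
    \<open>char_poly M\<close>, and each kernel has reached the full primary part.\<close>
  define e where "e = (\<lambda>f. max N (K f))"
  have ker_e: "poly_kernel M (f ^ e f) = primary_part M f" for f using K[of f "e f"] by (simp add: e_def)
  have "card (W \<inter> poly_kernel M (\<Prod>g\<in>B. g ^ e g)) = (\<Prod>g\<in>B. card (W \<inter> primary_part M g))"
    if "B \<subseteq> char_factors M" for B
    using finite_subset[OF that fin] that
  proof (induction B rule: finite_induct)
    case empty
    have "poly_kernel M 1 = {0\<^sub>v n}"
      using M by (auto simp: poly_kernel_def poly_mat_1)
    moreover have "0\<^sub>v n \<in> W" using W M by (auto simp: poly_invariant_def vec_subspace_def)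
    ultimately show ?case by simp
  next
    case (insert h B)
    have "comaximal (g ^ e g) (h ^ e h)" if g: "g \<in> B" for g
    proof (intro comaximal_powers irreducible_comaximal)
      have gh: "irreducible g" "monic g" "irreducible h" "monic h"
        using insert.prems g by (auto simp: char_factors_def)
      then show "irreducible g" by simp
      show "\<not> g dvd h" using monic_irreducible_dvd_eq[of g h] gh g insert.hyps by blast
    qed
    then have "comaximal (\<Prod>g\<in>B. g ^ e g) (h ^ e h)" by (rule comaximal_prod[OF insert.hyps(1)])
    from card_comaximal_split[OF M W comaximal_sym[OF this]] show ?case
      using insert by (simp add: ker_e)
  qed
  from this[OF subset_refl] have "card (W \<inter> poly_kernel M (\<Prod>g\<in>char_factors M. g ^ e g))
      = (\<Prod>g\<in>char_factors M. card (W \<inter> primary_part M g))" .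
  moreover have "W \<subseteq> poly_kernel M (\<Prod>g\<in>char_factors M. g ^ e g)"
  proof -
    have "char_poly M dvd (\<Prod>g\<in>char_factors M. g ^ e g)" by (rule N) (simp add: e_def)
    then have "carrier_vec n \<subseteq> poly_kernel M (\<Prod>g\<in>char_factors M. g ^ e g)"
      using poly_kernel_dvd_mono[OF M] poly_kernel_char_poly[OF M] by blast
    then show ?thesis using W M by (auto simp: poly_invariant_def vec_subspace_def)
  qed
  ultimately show ?thesis by (simp add: Int_absorb2)
qed


section \<open>Joint primary blocks of a commuting pair\<close>

lemma single_primary_class_type:
  fixes M :: "'k::{field,finite} mat"
  assumes M: "M \<in> carrier_mat n n" and f: "irreducible f" "monic f"
    and nil: "poly_kernel M (f ^ N) = carrier_vec n" and nontriv: "card (carrier_vec n :: 'k vec set) \<noteq> 1"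
  shows "\<exists>l. is_partition l \<and> l \<noteq> [] \<and> has_class_type M {#(degree f, l)#} \<and>
    (\<forall>k. card (poly_kernel M (f ^ k)) = CARD('k) ^ (degree f * truncated_size l k))"
proof -
  obtain l where l: "is_partition l"
    "\<forall>k. card (poly_kernel M (f ^ k)) = CARD('k) ^ (degree f * truncated_size l k)"
    using primary_partition_exists[OF M f(1)] primary_partition_iff[OF M f(1)] by blast
  have l0: "l \<noteq> []"
  proof
    assume "l = []"
    then have "card (poly_kernel M (f ^ N)) = 1" using l(2) by (simp add: truncated_size_def)
    then show False using nil nontriv by simp
  qed
  have "has_class_type M (image_mset (\<lambda>f. (degree f, l)) (mset_set {f}))"
  proof (rule class_type_intro[OF M])
    fix h assume h: "monic h" "irreducible h" "h \<notin> {f}"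
    then have "comaximal h (f ^ N)"
      using monic_irreducible_dvd_eq[of h f] f comaximal_powers[OF irreducible_comaximal[of h f], of 1 N] by auto
    then have "poly_kernel M h \<subseteq> {0\<^sub>v n}"
      using poly_kernel_comaximal[OF M] poly_kernel_carrier[OF M] nil by blast
    then have "poly_kernel M h = {0\<^sub>v n}" using zero_in_poly_kernel[OF M] by blast
    then show "card (poly_kernel M h) = 1" by simp
  qed (use l l0 f in auto)
  then show ?thesis using l l0 by auto
qed

lemma poly_invariant_poly_kernel:
  assumes X: "X \<in> carrier_mat n n" and Y: "Y \<in> carrier_mat n n" and XY: "X * Y = Y * X"
  shows "poly_invariant Y (poly_kernel X p)"
  unfolding poly_invariant_def vec_subspace_def
proof (intro conjI allI ballI)
  show "poly_kernel X p \<subseteq> carrier_vec (dim_row Y)" "0\<^sub>v (dim_row Y) \<in> poly_kernel X p"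
    using poly_kernel_carrier[OF X] zero_in_poly_kernel[OF X] Y by auto
  fix v assume v: "v \<in> poly_kernel X p"
  then have vn: "v \<in> carrier_vec n" using poly_kernel_carrier[OF X] by blast
  show "v + w \<in> poly_kernel X p" if "w \<in> poly_kernel X p" for w by (rule poly_kernel_add[OF X v that])
  show "c \<cdot>\<^sub>v v \<in> poly_kernel X p" for c
    using v X vn mult_mat_vec[OF poly_mat_carrier[OF X] vn, of p c] by (auto simp: poly_kernel_def)
  fix q
  have "poly_mat p X *\<^sub>v (poly_mat q Y *\<^sub>v v) = (poly_mat p X * poly_mat q Y) *\<^sub>v v"
    by (rule assoc_mult_mat_vec[OF poly_mat_carrier[OF X] poly_mat_carrier[OF Y] vn, symmetric])
  also have "\<dots> = poly_mat q Y *\<^sub>v (poly_mat p X *\<^sub>v v)"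
    unfolding poly_mat_commute[OF X Y XY]
    by (rule assoc_mult_mat_vec[OF poly_mat_carrier[OF Y] poly_mat_carrier[OF X] vn])
  also have "poly_mat p X *\<^sub>v v = 0\<^sub>v n" using v X by (simp add: poly_kernel_def)
  also have "poly_mat q Y *\<^sub>v 0\<^sub>v n = 0\<^sub>v n" 
    using zero_in_poly_kernel[OF Y, of q] Y by (simp add: poly_kernel_def)
  finally show "poly_mat q Y *\<^sub>v v \<in> poly_kernel X p"
    using mult_mat_vec_carrier[OF poly_mat_carrier[OF Y] vn] X by (simp add: poly_kernel_def)
qed

lemma poly_invariant_Int:
  "poly_invariant M V \<Longrightarrow> poly_invariant M W \<Longrightarrow> poly_invariant M (V \<inter> W)"
  by (auto simp: poly_invariant_def vec_subspace_def)

lemma poly_mat_X: "M \<in> carrier_mat n n \<Longrightarrow> poly_mat [:0, 1:] M = M"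
  by (intro eq_matI) (auto simp: poly_mat_def)

text \<open>On the block both \<open>f(X)\<close> and \<open>g(Y)\<close> are nilpotent, so the
  restrictions have single-component types. A zero block would give empty partitions, which types
  exclude.\<close>

lemma joint_primary_block:
  fixes X Y :: "'k::{field,finite} mat"
  assumes X: "X \<in> carrier_mat n n" and Y: "Y \<in> carrier_mat n n" and XY: "X * Y = Y * X"
    and f: "irreducible f" "monic f" and g: "irreducible g" "monic g"
    and nontriv: "card (primary_part X f \<inter> primary_part Y g) \<noteq> 1"
  shows "\<exists>l l'. is_partition l \<and> l \<noteq> [] \<and> is_partition l' \<and> l' \<noteq> [] \<and>
    types_commute TYPE('k) {#(degree f, l)#} {#(degree g, l')#} \<and>
    (\<forall>k. card (poly_kernel X (f ^ k) \<inter> primary_part Y g) = CARD('k) ^ (degree f * truncated_size l k)) \<and>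
    (\<forall>k. card (poly_kernel Y (g ^ k) \<inter> primary_part X f) = CARD('k) ^ (degree g * truncated_size l' k))"
proof -
  let ?V = "primary_part X f \<inter> primary_part Y g"
  obtain N1 where N1: "primary_part X f = poly_kernel X (f ^ N1)" using primary_part_eq_poly_kernel[OF X] by blast
  obtain N2 where N2: "primary_part Y g = poly_kernel Y (g ^ N2)" using primary_part_eq_poly_kernel[OF Y] by blast
  have invX: "poly_invariant X ?V" and invY: "poly_invariant Y ?V"
    unfolding N1 N2 using XY
    by (auto intro!: poly_invariant_Int poly_invariant_poly_kernel X Y)
  have V: "vec_subspace n ?V" using invX X by (simp add: poly_invariant_def)
  have XV: "X *\<^sub>v v \<in> ?V" if "v \<in> ?V" for v
    using invX that poly_mat_X[OF X] unfolding poly_invariant_def by metis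
  have YV: "Y *\<^sub>v v \<in> ?V" if "v \<in> ?V" for v
    using invY that poly_mat_X[OF Y] unfolding poly_invariant_def by metis
  obtain m X' Y' where X': "X' \<in> carrier_mat m m" and Y': "Y' \<in> carrier_mat m m" and XY': "X' * Y' = Y' * X'"
    and cX: "\<forall>p. card (poly_kernel X' p) = card (?V \<inter> poly_kernel X p)"
    and cY: "\<forall>p. card (poly_kernel Y' p) = card (?V \<inter> poly_kernel Y p)"
    using restrict_to_subspace[OF X Y XY V XV YV] by blast
  have all: "poly_kernel Z' p = carrier_vec m \<and> card (carrier_vec m :: 'k vec set) = card ?V"
    if Z': "Z' \<in> carrier_mat m m" and Z: "Z \<in> carrier_mat n n" and p: "?V \<subseteq> poly_kernel Z p"
      and c: "\<forall>p. card (poly_kernel Z' p) = card (?V \<inter> poly_kernel Z p)" for Z Z' p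
  proof -
    \<comment> \<open>The zero polynomial kills everything, so its case of the cardinality statement
      compares the whole spaces.\<close>
    have "poly_kernel Z' 0 = carrier_vec m" "poly_kernel Z 0 = carrier_vec n"
      using Z Z' by (auto simp: poly_kernel_def poly_mat_0)
    moreover have "?V \<subseteq> carrier_vec n" using V by (simp add: vec_subspace_def)
    ultimately have "card (carrier_vec m :: 'k vec set) = card ?V"
      using spec[OF c, of 0] by (simp add: Int_absorb2)
    moreover have "card (poly_kernel Z' p) = card ?V" using c p by (simp add: Int_absorb2)
    moreover have "poly_kernel Z' p \<subseteq> carrier_vec m" by (rule poly_kernel_carrier[OF Z'])
    ultimately show ?thesis using card_subset_eq[OF finite_carrier_vec, of "poly_kernel Z' p" m] by simp
  qed
  have allX: "poly_kernel X' (f ^ N1) = carrier_vec m" "card (carrier_vec m :: 'k vec set) = card ?V"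
    using all[OF X' X _ cX, of "f ^ N1"] N1 by auto
  have allY: "poly_kernel Y' (g ^ N2) = carrier_vec m"
    using all[OF Y' Y _ cY, of "g ^ N2"] N2 by auto
  obtain l where l: "is_partition l" "l \<noteq> []" "has_class_type X' {#(degree f, l)#}"
    "\<forall>k. card (poly_kernel X' (f ^ k)) = CARD('k) ^ (degree f * truncated_size l k)"
    using single_primary_class_type[OF X' f allX(1)] allX(2) nontriv by auto
  obtain l' where l': "is_partition l'" "l' \<noteq> []" "has_class_type Y' {#(degree g, l')#}"
    "\<forall>k. card (poly_kernel Y' (g ^ k)) = CARD('k) ^ (degree g * truncated_size l' k)"
    using single_primary_class_type[OF Y' g allY] allX(2) nontriv by auto
  have "?V \<inter> poly_kernel X (f ^ k) = poly_kernel X (f ^ k) \<inter> primary_part Y g" for k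
    by (auto simp: primary_part_def)
  moreover have "?V \<inter> poly_kernel Y (g ^ k) = poly_kernel Y (g ^ k) \<inter> primary_part X f" for k
    by (auto simp: primary_part_def)
  moreover have "types_commute TYPE('k) {#(degree f, l)#} {#(degree g, l')#}"
    unfolding types_commute_def using X' Y' XY' l(3) l'(3) by blast
  ultimately show ?thesis using l l' cX cY by (intro exI[of _ l] exI[of _ l']) auto
qed

lemma piece_sum_eq_of_cards:
  assumes q: "1 < (q :: nat)" and d: "0 < (d :: nat)" and l: "is_partition l"
    and P: "\<forall>(f, \<mu>)\<in>#P. is_partition \<mu>"
    and eq: "\<And>k. q ^ (d * truncated_size l k) = q ^ (d * mset_truncated_size (piece_sum P f) k)"
  shows "piece_sum P f = mset l"
proof -
  have "\<forall>x\<in>#piece_sum P f. 0 < x"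
    using P by (auto simp: piece_sum_def is_partition_def split: if_splits)
  then obtain l' where l': "is_partition l'" "mset l' = piece_sum P f" using is_partition_of_mset by blast
  have "truncated_size l' k = truncated_size l k" for k
  proof -
    have "d * truncated_size l k = d * mset_truncated_size (piece_sum P f) k"
      using eq[of k] by (rule power_inject_exp[OF q, THEN iffD1])
    then have "truncated_size l k = mset_truncated_size (piece_sum P f) k" using d by simp
    then show ?thesis using l'(2) by (simp add: mset_truncated_size_def truncated_size_mset)
  qed
  then have "mset l' = mset l" using l l'(1) by (intro mset_eq_of_truncated_size) (auto simp: is_partition_def)
  then show ?thesis using l'(2) by simp
qed

lemma mset_truncated_size_piece_sum:
  assumes "finite I"
  shows "mset_truncated_size (piece_sum (image_mset (\<lambda>i. (a i, l i)) (mset_set I)) f) k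
    = (\<Sum>i\<in>I. if a i = f then truncated_size (l i) k else 0)"
  using assms
proof (induction I rule: finite_induct)
  case empty
  then show ?case by (simp add: piece_sum_def mset_truncated_size_def)
next
  case (insert i I)
  have "mset_truncated_size (A + B) k = mset_truncated_size A k + mset_truncated_size B k" for A B
    by (simp add: mset_truncated_size_def)
  then show ?case
    using insert by (auto simp: piece_sum_add_mset mset_truncated_size_def truncated_size_mset)
qed

theorem separations_of_types_commute:
  assumes "types_commute TYPE('k::{field,finite}) S T"
  shows "\<exists>S' T'. is_separation S S' \<and> is_separation T T' \<and> commute_componentwise TYPE('k) S' T'"
proof -
  obtain n X Y where X: "X \<in> carrier_mat n n" and Y: "Y \<in> carrier_mat n n" and XY: "X * Y = Y * X"
    and tX: "has_class_type (X :: 'k mat) S" and tY: "has_class_type (Y :: 'k mat) T"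
    using assms unfolding types_commute_def by blast
  let ?A = "char_factors X" and ?B = "char_factors Y"
  have finA: "finite ?A" and finB: "finite ?B" using finite_char_factors X Y by blast+
  obtain L where L: "S = image_mset (\<lambda>f. (degree f, L f)) (mset_set ?A)"
    "\<forall>f\<in>?A. is_partition (L f) \<and> L f \<noteq> [] \<and>
      (\<forall>k. card (poly_kernel X (f ^ k)) = CARD('k) ^ (degree f * truncated_size (L f) k))"
    using class_type_cards[OF X tX] by blast
  obtain L' where L': "T = image_mset (\<lambda>f. (degree f, L' f)) (mset_set ?B)"
    "\<forall>f\<in>?B. is_partition (L' f) \<and> L' f \<noteq> [] \<and>
      (\<forall>k. card (poly_kernel Y (f ^ k)) = CARD('k) ^ (degree f * truncated_size (L' f) k))"
    using class_type_cards[OF Y tY] by blast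
  have irrA: "irreducible f" "monic f" if "f \<in> ?A" for f using that by (auto simp: char_factors_def)
  have irrB: "irreducible f" "monic f" if "f \<in> ?B" for f using that by (auto simp: char_factors_def)
  have deg: "0 < degree f" if "irreducible f" for f :: "'k poly"
    using that irreducible_not_unit[of f] by (auto simp: is_unit_iff_degree)
  have card2: "1 < CARD('k)" using card_mono[of UNIV "{0, 1 :: 'k}"] by simp
  \<comment> \<open>The pairs whose block is nonzero; only these give components of the
    separations.\<close>
  define I where "I = {i \<in> ?A \<times> ?B. card (primary_part X (fst i) \<inter> primary_part Y (snd i)) \<noteq> 1}"
  have finI: "finite I" using finA finB by (simp add: I_def)
  \<comment> \<open>The partitions of \<open>X\<close> and \<open>Y\<close> on a block are bundled
    so that a single choice fixes both.\<close>
  define good where "good = (\<lambda>i ll. is_partition (fst ll) \<and> fst ll \<noteq> [] \<and> is_partition (snd ll) \<and> snd ll \<noteq> [] \<and>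
    types_commute TYPE('k) {#(degree (fst i), fst ll)#} {#(degree (snd i), snd ll)#} \<and>
    (\<forall>k. card (poly_kernel X (fst i ^ k) \<inter> primary_part Y (snd i)) = CARD('k) ^ (degree (fst i) * truncated_size (fst ll) k)) \<and>
    (\<forall>k. card (poly_kernel Y (snd i ^ k) \<inter> primary_part X (fst i)) = CARD('k) ^ (degree (snd i) * truncated_size (snd ll) k)))"
  have "\<forall>i\<in>I. \<exists>ll. good i ll"
  proof
    fix i assume i: "i \<in> I"
    then have fg: "fst i \<in> ?A" "snd i \<in> ?B" by (auto simp: I_def)
    obtain l l' where "good i (l, l')"
      using joint_primary_block[OF X Y XY irrA[OF fg(1)] irrB[OF fg(2)]] i by (auto simp: I_def good_def)
    then show "\<exists>ll. good i ll" by blast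
  qed
  from bchoice[OF this] obtain ll where ll: "\<And>i. i \<in> I \<Longrightarrow> good i (ll i)" by blast
  define l where "l = (\<lambda>i. fst (ll i))"
  define l' where "l' = (\<lambda>i. snd (ll i))"
  have lI: "is_partition (l i)" "l i \<noteq> []" "is_partition (l' i)" "l' i \<noteq> []"
    "types_commute TYPE('k) {#(degree (fst i), l i)#} {#(degree (snd i), l' i)#}"
    "\<And>k. card (poly_kernel X (fst i ^ k) \<inter> primary_part Y (snd i)) = CARD('k) ^ (degree (fst i) * truncated_size (l i) k)"
    "\<And>k. card (poly_kernel Y (snd i ^ k) \<inter> primary_part X (fst i)) = CARD('k) ^ (degree (snd i) * truncated_size (l' i) k)"
    if "i \<in> I" for i using ll[OF that] by (simp_all add: good_def l_def l'_def)
  have trivial: "card (poly_kernel X (f ^ k) \<inter> primary_part Y g) = 1 \<and> card (poly_kernel Y (g ^ k) \<inter> primary_part X f) = 1"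
    if "f \<in> ?A" "g \<in> ?B" "(f, g) \<notin> I" for f g k
  proof -
    have "card (primary_part X f \<inter> primary_part Y g) = 1" using that by (simp add: I_def)
    then obtain z where z: "primary_part X f \<inter> primary_part Y g = {z}" by (rule card_1_singletonE)
    have 0: "0\<^sub>v n \<in> poly_kernel X p" "0\<^sub>v n \<in> poly_kernel Y p" for p
      using zero_in_poly_kernel[OF X] zero_in_poly_kernel[OF Y] by blast+
    have sub: "poly_kernel X (f ^ k) \<subseteq> primary_part X f" "poly_kernel Y (g ^ k) \<subseteq> primary_part Y g" for k
      by (auto simp: primary_part_def)
    have zp: "0\<^sub>v n \<in> primary_part X f" "0\<^sub>v n \<in> primary_part Y g"
      using 0 by (auto simp: primary_part_def)
    then have "0\<^sub>v n \<in> {z}" unfolding z[symmetric] by (rule IntI)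
    then have z0: "z = 0\<^sub>v n" by simp
    have "poly_kernel X (f ^ k) \<inter> primary_part Y g = {0\<^sub>v n}"
      using z 0(1)[of "f ^ k"] zp sub(1)[of k] unfolding z0 by blast
    moreover have "poly_kernel Y (g ^ k) \<inter> primary_part X f = {0\<^sub>v n}"
      using z 0(2)[of "g ^ k"] zp sub(2)[of k] unfolding z0 by blast
    ultimately show ?thesis by simp
  qed
  define P where "P = image_mset (\<lambda>i. (fst i, l i)) (mset_set I)"
  define Q where "Q = image_mset (\<lambda>i. (snd i, l' i)) (mset_set I)"
  have PI: "\<forall>(f, \<mu>)\<in>#P. f \<in> ?A \<and> is_partition \<mu> \<and> \<mu> \<noteq> []"
    using finI lI by (auto simp: P_def I_def)
  have QI: "\<forall>(f, \<mu>)\<in>#Q. f \<in> ?B \<and> is_partition \<mu> \<and> \<mu> \<noteq> []"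
    using finI lI by (auto simp: Q_def I_def)
  have sumP: "piece_sum P f = mset (L f)" if f: "f \<in> ?A" for f
  proof (rule piece_sum_eq_of_cards[OF card2 deg[OF irrA(1)[OF f]]])
    show "is_partition (L f)" using L(2) f by blast
    show "\<forall>(f, \<mu>)\<in>#P. is_partition \<mu>" using PI by auto
    fix k
    have "mset_truncated_size (piece_sum P f) k = (\<Sum>i\<in>I. if fst i = f then truncated_size (l i) k else 0)"
      unfolding P_def by (rule mset_truncated_size_piece_sum[OF finI])
    also have "\<dots> = (\<Sum>i\<in>{i\<in>I. fst i = f}. truncated_size (l i) k)"
      using finI by (simp add: sum.inter_filter)
    also have "{i\<in>I. fst i = f} = Pair f ` {g\<in>?B. (f, g) \<in> I}" by (auto simp: I_def)
    also have "(\<Sum>i\<in>Pair f ` {g\<in>?B. (f, g) \<in> I}. truncated_size (l i) k) = (\<Sum>g\<in>{g\<in>?B. (f, g) \<in> I}. truncated_size (l (f, g)) k)"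
      by (rule sum.reindex_cong[of "Pair f"]) (auto simp: inj_on_def)
    also have "\<dots> = (\<Sum>g\<in>?B. if (f, g) \<in> I then truncated_size (l (f, g)) k else 0)"
      using finB by (simp add: sum.inter_filter)
    finally have size: "mset_truncated_size (piece_sum P f) k
        = (\<Sum>g\<in>?B. if (f, g) \<in> I then truncated_size (l (f, g)) k else 0)" .
    have "CARD('k) ^ (degree f * truncated_size (L f) k) = card (poly_kernel X (f ^ k))"
      using L(2) f by simp
    \<comment> \<open>The kernel of \<open>f(X) ^ k\<close> is invariant under \<open>Y\<close> and
      splits along the primary parts of \<open>Y\<close>. Thus the exponents over all
      \<open>g\<close> add up, for every \<open>k\<close>, and determine the multiset of
      parts.\<close>
    also have "\<dots> = (\<Prod>g\<in>?B. card (poly_kernel X (f ^ k) \<inter> primary_part Y g))"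
      by (rule card_eq_prod_primary_parts[OF Y poly_invariant_poly_kernel[OF X Y XY]])
    \<comment> \<open>Pairs outside \<open>I\<close> contribute the factor 1, that is, exponent
      0.\<close>
    also have "\<dots> = (\<Prod>g\<in>?B. CARD('k) ^ (degree f * (if (f, g) \<in> I then truncated_size (l (f, g)) k else 0)))"
      using lI(6)[of "(f, _)"] trivial[OF f] by (intro prod.cong) auto
    also have "\<dots> = CARD('k) ^ (degree f * mset_truncated_size (piece_sum P f) k)"
      unfolding size by (simp add: sum_distrib_left power_sum)
    finally show "CARD('k) ^ (degree f * truncated_size (L f) k)
        = CARD('k) ^ (degree f * mset_truncated_size (piece_sum P f) k)" .
  qed
  have sumQ: "piece_sum Q g = mset (L' g)" if g: "g \<in> ?B" for g
  proof (rule piece_sum_eq_of_cards[OF card2 deg[OF irrB(1)[OF g]]])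
    show "is_partition (L' g)" using L'(2) g by blast
    show "\<forall>(f, \<mu>)\<in>#Q. is_partition \<mu>" using QI by auto
    fix k
    have "mset_truncated_size (piece_sum Q g) k = (\<Sum>i\<in>I. if snd i = g then truncated_size (l' i) k else 0)"
      unfolding Q_def by (rule mset_truncated_size_piece_sum[OF finI])
    also have "\<dots> = (\<Sum>i\<in>{i\<in>I. snd i = g}. truncated_size (l' i) k)"
      using finI by (simp add: sum.inter_filter)
    also have "{i\<in>I. snd i = g} = (\<lambda>f. (f, g)) ` {f\<in>?A. (f, g) \<in> I}" by (auto simp: I_def)
    also have "(\<Sum>i\<in>(\<lambda>f. (f, g)) ` {f\<in>?A. (f, g) \<in> I}. truncated_size (l' i) k)
        = (\<Sum>f\<in>{f\<in>?A. (f, g) \<in> I}. truncated_size (l' (f, g)) k)"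
      by (rule sum.reindex_cong[of "\<lambda>f. (f, g)"]) (auto simp: inj_on_def)
    also have "\<dots> = (\<Sum>f\<in>?A. if (f, g) \<in> I then truncated_size (l' (f, g)) k else 0)"
      using finA by (simp add: sum.inter_filter)
    finally have size: "mset_truncated_size (piece_sum Q g) k
        = (\<Sum>f\<in>?A. if (f, g) \<in> I then truncated_size (l' (f, g)) k else 0)" .
    have "CARD('k) ^ (degree g * truncated_size (L' g) k) = card (poly_kernel Y (g ^ k))"
      using L'(2) g by simp
    also have "\<dots> = (\<Prod>f\<in>?A. card (poly_kernel Y (g ^ k) \<inter> primary_part X f))"
      by (rule card_eq_prod_primary_parts[OF X poly_invariant_poly_kernel[OF Y X XY[symmetric]]])
    also have "\<dots> = (\<Prod>f\<in>?A. CARD('k) ^ (degree g * (if (f, g) \<in> I then truncated_size (l' (f, g)) k else 0)))"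
      using lI(7)[of "(_, g)"] trivial[OF _ g] by (intro prod.cong) auto
    also have "\<dots> = CARD('k) ^ (degree g * mset_truncated_size (piece_sum Q g) k)"
      unfolding size by (simp add: sum_distrib_left power_sum)
    finally show "CARD('k) ^ (degree g * truncated_size (L' g) k)
        = CARD('k) ^ (degree g * mset_truncated_size (piece_sum Q g) k)" .
  qed
  let ?S' = "image_mset (\<lambda>(f, \<mu>). (degree f, \<mu>)) P" and ?T' = "image_mset (\<lambda>(f, \<mu>). (degree f, \<mu>)) Q"
  have "is_separation S ?S'" unfolding L(1)
    using L(2) sumP by (intro is_separation_of_pieces[OF finA _ PI]) auto
  moreover have "is_separation T ?T'" unfolding L'(1)
    using L'(2) sumQ by (intro is_separation_of_pieces[OF finB _ QI]) auto
  moreover have "commute_componentwise TYPE('k) ?S' ?T'"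
  proof -
    \<comment> \<open>Both separations are indexed by the blocks, so one enumeration of
      \<open>I\<close> orders their components compatibly.\<close>
    obtain xs where xs: "mset xs = mset_set I" using ex_mset by blast
    then have "set xs = I" using finI by (metis finite_set_mset_mset_set set_mset_mset)
    then have "list_all2 (\<lambda>s t. types_commute TYPE('k) {#s#} {#t#})
        (map (\<lambda>i. (degree (fst i), l i)) xs) (map (\<lambda>i. (degree (snd i), l' i)) xs)"
      using lI(5) by (auto simp: list_all2_map1 list_all2_map2 list.rel_refl_strong intro!: list.rel_refl_strong)
    moreover have "mset (map (\<lambda>i. (degree (fst i), l i)) xs) = ?S'" "mset (map (\<lambda>i. (degree (snd i), l' i)) xs) = ?T'"
      by (simp_all add: xs P_def Q_def image_mset.compositionality comp_def)
    ultimately show ?thesis unfolding commute_componentwise_def by blast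
  qed
  ultimately show ?thesis by blast
qed

theorem proposition2p9:
  fixes S T :: ctype
  assumes "is_type S" and "is_type T"
    and "representable TYPE('k::{field,finite}) S"
    and "representable TYPE('k) T"
  shows "types_commute TYPE('k) S T \<longleftrightarrow>
    (\<exists>S' T'. is_separation S S' \<and> is_separation T T' \<and>
       commute_componentwise TYPE('k) S' T')"
  using assms(3,4) types_commute_of_separations separations_of_types_commute by blast

end
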